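(* Let $(\Lambda,\mathscr{L})$ and $(\Gamma,\mathscr{G})$ be graphs of groups with basepoints $p\in\Lambda$, $q\in\Gamma$ and Bass–Serre trees $\tilde\Lambda$, $\tilde\Gamma$ with distinguished lifts $\tilde p$, $\tilde q$. Let $f_\sharp\colon\pi_1(\Lambda,\mathscr{L},p)\to\pi_1(\Gamma,\mathscr{G},q)$ be a homomorphism and let $\tilde f\colon(\tilde\Lambda,\tilde p)\to(\tilde\Gamma,\tilde q)$ be an $f_\sharp$-equivariant morphism of trees, i.e. $\tilde f(h.x)=f_\sharp(h).\tilde f(x)$ for all $h\in\pi_1(\Lambda,\mathscr{L},p)$ and $x\in\tilde\Lambda$. Then there is a morphism of graphs of groups $f\colon(\Lambda,\mathscr{L},p)\to(\Gamma,\mathscr{G},q)$ which induces $f_\sharp$ and $\tilde f$ and such that the square $\pi_\Gamma\tilde f=f\pi_\Lambda$ commutes, where $\pi_\Lambda\colon\tilde\Lambda\to(\Lambda,\mathscr{L})$ and $\pi_\Gamma\colon\tilde\Gamma\to(\Gamma,\mathscr{G})$ are the covering projections.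
   Context: A graph of groups $(\Gamma,\mathscr{G})$ is a connected graph with vertex groups $\mathscr{G}_v$, edge groups $\mathscr{G}_e=\mathscr{G}_{\bar e}$ and monomorphisms $\iota_e\colon\mathscr{G}_e\to\mathscr{G}_{\tau(e)}$ ($\tau(e)$ the terminal vertex of the oriented edge $e$, $\bar e$ its reverse). A path is a sequence $e_1'g_1e_2g_2\cdots g_{k-1}e_k'$ with $e_1'e_2\cdots e_k'$ an edge path in $\Gamma$ (first and last terms may be segments of edges or empty) and $g_i\in\mathscr{G}_{\tau(e_i)}$. Homotopy rel endpoints is generated by inserting or deleting $\sigma\bar\sigma$ and replacing $g\,e\,\iota_e(h)\,g'$ by $g\,\iota_{\bar e}(h)\,e\,g'$, $h\in\mathscr{G}_e$. $\pi_1(\Gamma,\mathscr{G},p)$ is the group of homotopy classes of loops at $p$. A morphism of graphs sends vertices to vertices and each edge to an edge or (collapsing it) to a vertex. A morphism $f\colon(\Lambda,\mathscr{L})\to(\Gamma,\mathscr{G})$ of graphs of groups is a morphism of graphs $\Lambda\to\Gamma$, homomorphisms $f_v\colon\mathscr{L}_v\to\mathscr{G}_{f(v)}$, $f_e\colon\mathscr{L}_e\to\mathscr{G}_{f(e)}$ and, for each oriented edge $e$, an element $\delta_e\in\mathscr{G}_{f(\tau(e))}$ such that $f_{\tau(e)}(\iota_e(h))=\delta_e\,\iota_{f(e)}(f_e(h))\,\delta_e^{-1}$ for $h\in\mathscr{L}_e$ (with $\iota_{f(e)}$ the identity if $e$ is collapsed). It acts on paths by $g\mapsto f_v(g)$,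 $e\mapsto\delta_{\bar e}f(e)\delta_e^{-1}$, preserving homotopy, and so induces a homomorphism $\pi_1(\Lambda,\mathscr{L},p)\to\pi_1(\Gamma,\mathscr{G},f(p))$. Bass–Serre tree. $\tilde\Gamma$ is the tree with an action of $\pi_1(\Gamma,\mathscr{G},q)$ without inversions, with quotient $\Gamma$, inducing $\mathscr{G}$. Concretely, vertices over $v$ are the homotopy classes of paths from $q$ to $v$ modulo right multiplication by $\mathscr{G}_v$; for each path $\gamma$ from $q$ to $\tau(\bar e)$ there is an edge over $e$ from the class of $\gamma$ to the class of $\gamma e$; $\tilde q$ is the class of the constant path; $\pi_1$ acts by concatenation on the left. Every path from $q$ lifts to a path in $\tilde\Gamma$ from $\tilde q$. The projection $\pi_\Gamma$ is a morphism of graphs of groups ($\tilde\Gamma$ having trivial groups), with elements $\delta$ chosen (using fixed coset representatives) so that for every tight path $\tilde\gamma$ from $\tilde q$, $\pi_\Gamma(\tilde\gamma)$ lifts to $\tilde\gamma$; similarly for $\tilde\Lambda$. Commutation of the square means: for every tight path $\tilde\gamma$ in $\tilde\Lambda$ from $\tilde p$ to a point $x$, the paths $\pi_\Gamma(\tilde f(\tilde\gamma))$ and $f(\pi_\Lambda(\tilde\gamma))$ are homotopic rel endpoints up to right multiplication by an element of the vertex group at the terminal endpoint (if it is a vertex). A morphism $f$ with $f(p)=q$ induces the unique morphism of trees sending $\tilde p$ to $\tilde q$ for which this square commutes.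
   Formalization: When the tight path ends at an interior point of an edge, the square is asserted to commute only up to that edge's group; strict homotopy there, as literally defined, fails in general (e.g. one edge, vertex groups Z, edge group 2Z, translation by 1 in a vertex group). *)

theory Defs
  imports Complex_Main "HOL-Algebra.Algebra" "Graph_Theory.Graph_Theory"
begin

section \<open>Graphs of groups\<close>

text \<open>
  The underlying graph is a graph in the sense of Serre: oriented edges with a fixed-point free
  reversal (\<^locale>\<open>bidirected_digraph\<close>); it may be infinite and may have loops and multiple edges.
  All vertex and edge groups of one graph of groups have their carriers in one common type.
\<close>

record ('v, 'e, 'g) graph_of_groups =
  gr :: "('v, 'e) pre_digraph"
  erev :: "'e \<Rightarrow> 'e"
  vgrp :: "'v \<Rightarrow> 'g monoid"
  egrp :: "'e \<Rightarrow> 'g monoid"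
  inc :: "'e \<Rightarrow> 'g \<Rightarrow> 'g"

locale graph_of_groups =
  bidirected_digraph "gr G" "erev G" for G :: "('v, 'e, 'g) graph_of_groups" +
  assumes connected: "Digraph_Component.connected (gr G)"
    and vgrp: "v \<in> verts (gr G) \<Longrightarrow> group (vgrp G v)"
    and egrp: "e \<in> arcs (gr G) \<Longrightarrow> group (egrp G e)"
    and egrp_erev: "e \<in> arcs (gr G) \<Longrightarrow> egrp G (erev G e) = egrp G e"
    and inc_hom: "e \<in> arcs (gr G) \<Longrightarrow> inc G e \<in> hom (egrp G e) (vgrp G (head (gr G) e))"
    and inc_inj: "e \<in> arcs (gr G) \<Longrightarrow> inj_on (inc G e) (carrier (egrp G e))"


section \<open>Points, paths and homotopy\<close>

text \<open>
  Every oriented edge \<open>e\<close> is parametrised by \<open>[0,1]\<close> from its tail to its head, the reversed edge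
  by the opposite parameter. An interior point is the set of its two descriptions
  \<open>(e, a)\<close> and \<open>(erev e, 1 - a)\<close>.
\<close>

datatype ('v, 'e) point = Vert 'v | Mid "('e \<times> real) set"

definition edge_point :: "('v, 'e, 'g) graph_of_groups \<Rightarrow> 'e \<Rightarrow> real \<Rightarrow> ('v, 'e) point" where
  "edge_point G e a =
     (if a = 0 then Vert (tail (gr G) e)
      else if a = 1 then Vert (head (gr G) e)
      else Mid {(e, a), (erev G e, 1 - a)})"

definition points :: "('v, 'e, 'g) graph_of_groups \<Rightarrow> ('v, 'e) point set" where
  "points G = Vert ` verts (gr G) \<union> {edge_point G e a | e a. e \<in> arcs (gr G) \<and> 0 \<le> a \<and> a \<le> 1}"

text \<open>
  \<open>Elt v g\<close> is a group element at the vertex \<open>v\<close>; \<open>Seg e a b\<close> is the segment of the oriented edge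
  \<open>e\<close> from parameter \<open>a\<close> to parameter \<open>b > a\<close>, so that the whole edge is \<open>Seg e 0 1\<close>. Lists of
  these are slightly more liberal than alternating words \<open>e\<^sub>1' g\<^sub>1 e\<^sub>2 \<dots> g\<^sub>k\<^sub>-\<^sub>1 e\<^sub>k'\<close>, so that
  paths can be concatenated at any point; the moves \<open>unit\<close>, \<open>mult\<close> and \<open>join\<close> below
  identify each such list with an alternating word.
\<close>

datatype ('v, 'e, 'g) piece = Elt 'v 'g | Seg 'e real real

fun piece_ok :: "('v, 'e, 'g) graph_of_groups \<Rightarrow> ('v, 'e, 'g) piece \<Rightarrow> bool" where
  "piece_ok G (Elt v g) \<longleftrightarrow> v \<in> verts (gr G) \<and> g \<in> carrier (vgrp G v)"
| "piece_ok G (Seg e a b) \<longleftrightarrow> e \<in> arcs (gr G) \<and> 0 \<le> a \<and> a < b \<and> b \<le> 1"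

fun piece_start :: "('v, 'e, 'g) graph_of_groups \<Rightarrow> ('v, 'e, 'g) piece \<Rightarrow> ('v, 'e) point" where
  "piece_start G (Elt v g) = Vert v"
| "piece_start G (Seg e a b) = edge_point G e a"

fun piece_end :: "('v, 'e, 'g) graph_of_groups \<Rightarrow> ('v, 'e, 'g) piece \<Rightarrow> ('v, 'e) point" where
  "piece_end G (Elt v g) = Vert v"
| "piece_end G (Seg e a b) = edge_point G e b"

fun gog_path ::
  "('v, 'e, 'g) graph_of_groups \<Rightarrow> ('v, 'e) point \<Rightarrow> ('v, 'e, 'g) piece list \<Rightarrow> ('v, 'e) point \<Rightarrow> bool"
where
  "gog_path G x [] y \<longleftrightarrow> x \<in> points G \<and> x = y"
| "gog_path G x (s # w) y \<longleftrightarrow> piece_ok G s \<and> piece_start G s = x \<and> gog_path G (piece_end G s) w y"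

inductive elementary_move ::
  "('v, 'e, 'g) graph_of_groups \<Rightarrow> ('v, 'e, 'g) piece list \<Rightarrow> ('v, 'e, 'g) piece list \<Rightarrow> bool"
for G where
  unit: "v \<in> verts (gr G) \<Longrightarrow> elementary_move G [Elt v \<one>\<^bsub>vgrp G v\<^esub>] []"
| mult: "\<lbrakk>v \<in> verts (gr G); g \<in> carrier (vgrp G v); h \<in> carrier (vgrp G v)\<rbrakk> \<Longrightarrow>
    elementary_move G [Elt v g, Elt v h] [Elt v (g \<otimes>\<^bsub>vgrp G v\<^esub> h)]"
| join: "\<lbrakk>e \<in> arcs (gr G); 0 \<le> a; a < b; b < c; c \<le> 1\<rbrakk> \<Longrightarrow>
    elementary_move G [Seg e a b, Seg e b c] [Seg e a c]"
| backtrack: "\<lbrakk>e \<in> arcs (gr G); 0 \<le> a; a < b; b \<le> 1\<rbrakk> \<Longrightarrow>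
    elementary_move G [Seg e a b, Seg (erev G e) (1 - b) (1 - a)] []"
| slide: "\<lbrakk>e \<in> arcs (gr G); h \<in> carrier (egrp G e)\<rbrakk> \<Longrightarrow>
    elementary_move G
      [Seg e 0 1, Elt (head (gr G) e) (inc G e h)]
      [Elt (tail (gr G) e) (inc G (erev G e) h), Seg e 0 1]"

definition homotopy_step ::
  "('v, 'e, 'g) graph_of_groups \<Rightarrow> ('v, 'e) point \<Rightarrow> ('v, 'e) point \<Rightarrow>
   ('v, 'e, 'g) piece list \<Rightarrow> ('v, 'e, 'g) piece list \<Rightarrow> bool" where
  "homotopy_step G x y u w \<longleftrightarrow>
     gog_path G x u y \<and> gog_path G x w y \<and>
     (\<exists>l c d r. u = l @ c @ r \<and> w = l @ d @ r \<and> elementary_move G c d)"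

definition homotopic ::
  "('v, 'e, 'g) graph_of_groups \<Rightarrow> ('v, 'e) point \<Rightarrow> ('v, 'e) point \<Rightarrow>
   ('v, 'e, 'g) piece list \<Rightarrow> ('v, 'e, 'g) piece list \<Rightarrow> bool" where
  "homotopic G x y u w \<longleftrightarrow>
     gog_path G x u y \<and> gog_path G x w y \<and> equivclp (homotopy_step G x y) u w"

definition hclass ::
  "('v, 'e, 'g) graph_of_groups \<Rightarrow> ('v, 'e) point \<Rightarrow> ('v, 'e) point \<Rightarrow>
   ('v, 'e, 'g) piece list \<Rightarrow> ('v, 'e, 'g) piece list set" where
  "hclass G x y u = {w. homotopic G x y u w}"

definition pi1 ::
  "('v, 'e, 'g) graph_of_groups \<Rightarrow> ('v, 'e) point \<Rightarrow> ('v, 'e, 'g) piece list set monoid" where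
  "pi1 G p =
     \<lparr>carrier = {hclass G p p u | u. gog_path G p u p},
      monoid.mult = (\<lambda>A B. \<Union>u\<in>A. \<Union>w\<in>B. hclass G p p (u @ w)),
      one = hclass G p p []\<rparr>"


section \<open>Morphisms\<close>

text \<open>\<open>emap f e = Inl v\<close> means that \<open>e\<close> is collapsed to the vertex \<open>v\<close>.\<close>

record ('v, 'e, 'w, 'd) graph_map =
  vmap :: "'v \<Rightarrow> 'w"
  emap :: "'e \<Rightarrow> 'w + 'd"

definition graph_morphism ::
  "('v, 'e, 'g) graph_of_groups \<Rightarrow> ('w, 'd, 'k) graph_of_groups \<Rightarrow>
   ('v, 'e, 'w, 'd, 'z) graph_map_scheme \<Rightarrow> bool" where
  "graph_morphism L G f \<longleftrightarrow>
     (\<forall>v \<in> verts (gr L). vmap f v \<in> verts (gr G)) \<and>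
     (\<forall>e \<in> arcs (gr L).
        case emap f e of
          Inl v \<Rightarrow> v = vmap f (tail (gr L) e) \<and> v = vmap f (head (gr L) e) \<and>
                   emap f (erev L e) = Inl v
        | Inr d \<Rightarrow> d \<in> arcs (gr G) \<and>
                   tail (gr G) d = vmap f (tail (gr L) e) \<and>
                   head (gr G) d = vmap f (head (gr L) e) \<and>
                   emap f (erev L e) = Inr (erev G d))"

definition point_map ::
  "('v, 'e, 'w, 'd, 'z) graph_map_scheme \<Rightarrow> ('v, 'e) point \<Rightarrow> ('w, 'd) point" where
  "point_map f x =
     (case x of
        Vert v \<Rightarrow> Vert (vmap f v)
      | Mid A \<Rightarrow>
          if \<exists>v. \<forall>(e, a) \<in> A. emap f e = Inl v
          then Vert (SOME v. \<forall>(e, a) \<in> A. emap f e = Inl v)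
          else Mid ((\<lambda>(e, a). (projr (emap f e), a)) ` A))"

text \<open>Action of a morphism of trees on paths, in which all group elements are trivial.\<close>

fun graph_map_piece ::
  "('v, 'e, 'w, 'd, 'z) graph_map_scheme \<Rightarrow> ('v, 'e, 'g) piece \<Rightarrow> ('w, 'd, 'g) piece list" where
  "graph_map_piece f (Elt v g) = [Elt (vmap f v) g]"
| "graph_map_piece f (Seg e a b) = (case emap f e of Inl _ \<Rightarrow> [] | Inr d \<Rightarrow> [Seg d a b])"

definition graph_map_path ::
  "('v, 'e, 'w, 'd, 'z) graph_map_scheme \<Rightarrow> ('v, 'e, 'g) piece list \<Rightarrow> ('w, 'd, 'g) piece list" where
  "graph_map_path f w = concat (map (graph_map_piece f) w)"

text \<open>\<open>twist f e\<close> is the element \<open>\<delta>\<^sub>e\<close>.\<close>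

record ('v, 'e, 'g, 'w, 'd, 'k) gog_map = "('v, 'e, 'w, 'd) graph_map" +
  vhom :: "'v \<Rightarrow> 'g \<Rightarrow> 'k"
  ehom :: "'e \<Rightarrow> 'g \<Rightarrow> 'k"
  twist :: "'e \<Rightarrow> 'k"

definition cell_grp :: "('w, 'd, 'k) graph_of_groups \<Rightarrow> 'w + 'd \<Rightarrow> 'k monoid" where
  "cell_grp G c = (case c of Inl v \<Rightarrow> vgrp G v | Inr d \<Rightarrow> egrp G d)"

definition cell_inc :: "('w, 'd, 'k) graph_of_groups \<Rightarrow> 'w + 'd \<Rightarrow> 'k \<Rightarrow> 'k" where
  "cell_inc G c = (case c of Inl v \<Rightarrow> (\<lambda>k. k) | Inr d \<Rightarrow> inc G d)"

text \<open>
  The edge homomorphism belongs to the unoriented edge, as \<open>egrp L (erev L e) = egrp L e\<close>.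
\<close>

definition gog_morphism ::
  "('v, 'e, 'g) graph_of_groups \<Rightarrow> ('w, 'd, 'k) graph_of_groups \<Rightarrow>
   ('v, 'e, 'g, 'w, 'd, 'k) gog_map \<Rightarrow> bool" where
  "gog_morphism L G f \<longleftrightarrow>
     graph_morphism L G f \<and>
     (\<forall>v \<in> verts (gr L). vhom f v \<in> hom (vgrp L v) (vgrp G (vmap f v))) \<and>
     (\<forall>e \<in> arcs (gr L).
        ehom f e \<in> hom (egrp L e) (cell_grp G (emap f e)) \<and>
        (\<forall>h \<in> carrier (egrp L e). ehom f (erev L e) h = ehom f e h) \<and>
        (let H = vgrp G (vmap f (head (gr L) e)) in
           twist f e \<in> carrier H \<and>
           (\<forall>h \<in> carrier (egrp L e).
              vhom f (head (gr L) e) (inc L e h) =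
              twist f e \<otimes>\<^bsub>H\<^esub> cell_inc G (emap f e) (ehom f e h) \<otimes>\<^bsub>H\<^esub> inv\<^bsub>H\<^esub> (twist f e))))"

text \<open>
  A whole edge \<open>e\<close> is sent to \<open>\<delta>\<^bsub>erev e\<^esub> f(e) \<delta>\<^sub>e\<^sup>-\<^sup>1\<close>; a segment receives the factor at an end of
  \<open>e\<close> exactly if it reaches that end.
\<close>

fun gog_map_piece ::
  "('v, 'e, 'g) graph_of_groups \<Rightarrow> ('w, 'd, 'k) graph_of_groups \<Rightarrow>
   ('v, 'e, 'g, 'w, 'd, 'k) gog_map \<Rightarrow> ('v, 'e, 'g) piece \<Rightarrow> ('w, 'd, 'k) piece list" where
  "gog_map_piece L G f (Elt v g) = [Elt (vmap f v) (vhom f v g)]"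
| "gog_map_piece L G f (Seg e a b) =
     (let v = vmap f (tail (gr L) e); w = vmap f (head (gr L) e) in
        (if a = 0 then [Elt v (twist f (erev L e))] else []) @
        (case emap f e of Inl _ \<Rightarrow> [] | Inr d \<Rightarrow> [Seg d a b]) @
        (if b = 1 then [Elt w (inv\<^bsub>vgrp G w\<^esub> (twist f e))] else []))"

definition gog_map_path ::
  "('v, 'e, 'g) graph_of_groups \<Rightarrow> ('w, 'd, 'k) graph_of_groups \<Rightarrow>
   ('v, 'e, 'g, 'w, 'd, 'k) gog_map \<Rightarrow> ('v, 'e, 'g) piece list \<Rightarrow> ('w, 'd, 'k) piece list" where
  "gog_map_path L G f w = concat (map (gog_map_piece L G f) w)"

definition induces_hom ::
  "('v, 'e, 'g) graph_of_groups \<Rightarrow> ('v, 'e) point \<Rightarrow>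
   ('w, 'd, 'k) graph_of_groups \<Rightarrow> ('w, 'd) point \<Rightarrow>
   ('v, 'e, 'g, 'w, 'd, 'k) gog_map \<Rightarrow>
   (('v, 'e, 'g) piece list set \<Rightarrow> ('w, 'd, 'k) piece list set) \<Rightarrow> bool" where
  "induces_hom L p G q f \<phi> \<longleftrightarrow>
     (\<forall>u. gog_path L p u p \<longrightarrow> \<phi> (hclass L p p u) = hclass G q q (gog_map_path L G f u))"


section \<open>The Bass--Serre tree\<close>

text \<open>
  \<open>coset G q v u\<close> is the homotopy class of the path \<open>u\<close> from \<open>q\<close> to the vertex \<open>v\<close> modulo right
  multiplication by the vertex group at \<open>v\<close>. The tree is a graph of groups with trivial groups. Its
  vertices are pairs of a vertex and such a class; its edges are triples of an edge and two
  vertices of the tree, the tail and the head.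
\<close>

definition coset ::
  "('v, 'e, 'g) graph_of_groups \<Rightarrow> ('v, 'e) point \<Rightarrow> 'v \<Rightarrow>
   ('v, 'e, 'g) piece list \<Rightarrow> ('v, 'e, 'g) piece list set" where
  "coset G q v u = {w. \<exists>g \<in> carrier (vgrp G v). homotopic G q (Vert v) w (u @ [Elt v g])}"

type_synonym ('v, 'e, 'g) tvert = "'v \<times> ('v, 'e, 'g) piece list set"
type_synonym ('v, 'e, 'g) tedge = "'e \<times> ('v, 'e, 'g) tvert \<times> ('v, 'e, 'g) tvert"

definition bs_arcs ::
  "('v, 'e, 'g) graph_of_groups \<Rightarrow> ('v, 'e) point \<Rightarrow> ('v, 'e, 'g) tedge set" where
  "bs_arcs G q =
     {(e, (tail (gr G) e, coset G q (tail (gr G) e) u),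
          (head (gr G) e, coset G q (head (gr G) e) (u @ [Seg e 0 1])))
      | e u. e \<in> arcs (gr G) \<and> gog_path G q u (Vert (tail (gr G) e))}"

definition bs_tree ::
  "('v, 'e, 'g) graph_of_groups \<Rightarrow> ('v, 'e) point \<Rightarrow>
   (('v, 'e, 'g) tvert, ('v, 'e, 'g) tedge, unit) graph_of_groups" where
  "bs_tree G q =
     \<lparr>gr = \<lparr>verts = {(v, coset G q v u) | v u. v \<in> verts (gr G) \<and> gog_path G q u (Vert v)},
            arcs = bs_arcs G q,
            tail = (\<lambda>(e, x, y). x),
            head = (\<lambda>(e, x, y). y)\<rparr>,
      erev = (\<lambda>(e, x, y). if (e, x, y) \<in> bs_arcs G q then (erev G e, y, x) else (e, x, y)),
      vgrp = (\<lambda>_. singleton_group ()),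
      egrp = (\<lambda>_. singleton_group ()),
      inc = (\<lambda>_ _. ())\<rparr>"

definition act_vert ::
  "('v, 'e, 'g) graph_of_groups \<Rightarrow> ('v, 'e) point \<Rightarrow> ('v, 'e, 'g) piece list set \<Rightarrow>
   ('v, 'e, 'g) tvert \<Rightarrow> ('v, 'e, 'g) tvert" where
  "act_vert G q h x = (case x of (v, C) \<Rightarrow> (v, \<Union>u\<in>h. \<Union>w\<in>C. coset G q v (u @ w)))"

definition act_edge ::
  "('v, 'e, 'g) graph_of_groups \<Rightarrow> ('v, 'e) point \<Rightarrow> ('v, 'e, 'g) piece list set \<Rightarrow>
   ('v, 'e, 'g) tedge \<Rightarrow> ('v, 'e, 'g) tedge" where
  "act_edge G q h = (\<lambda>(e, x, y). (e, act_vert G q h x, act_vert G q h y))"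

definition act_point ::
  "('v, 'e, 'g) graph_of_groups \<Rightarrow> ('v, 'e) point \<Rightarrow> ('v, 'e, 'g) piece list set \<Rightarrow>
   (('v, 'e, 'g) tvert, ('v, 'e, 'g) tedge) point \<Rightarrow>
   (('v, 'e, 'g) tvert, ('v, 'e, 'g) tedge) point" where
  "act_point G q h x =
     (case x of
        Vert v \<Rightarrow> Vert (act_vert G q h v)
      | Mid A \<Rightarrow> Mid ((\<lambda>(d, a). (act_edge G q h d, a)) ` A))"

text \<open>
  \<open>lift_edge G q u e a\<close> is the lift of \<open>e\<close> through the end point of the lift of \<open>u\<close>, where \<open>u\<close> is a
  path from \<open>q\<close> to the point of \<open>e\<close> with parameter \<open>a\<close>. In \<open>lift_path G q u w\<close>, the path \<open>w\<close> is
  lifted starting at the end point of the lift of \<open>u\<close>.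
\<close>

definition lift_edge ::
  "('v, 'e, 'g) graph_of_groups \<Rightarrow> ('v, 'e) point \<Rightarrow> ('v, 'e, 'g) piece list \<Rightarrow>
   'e \<Rightarrow> real \<Rightarrow> ('v, 'e, 'g) tedge" where
  "lift_edge G q u e a =
     (let v = tail (gr G) e; w = head (gr G) e in
       (e, (v, coset G q v (u @ (if a = 0 then [] else [Seg (erev G e) (1 - a) 1]))),
           (w, coset G q w (u @ (if a = 1 then [] else [Seg e a 1])))))"

fun lift_path ::
  "('v, 'e, 'g) graph_of_groups \<Rightarrow> ('v, 'e) point \<Rightarrow> ('v, 'e, 'g) piece list \<Rightarrow>
   ('v, 'e, 'g) piece list \<Rightarrow>
   (('v, 'e, 'g) tvert, ('v, 'e, 'g) tedge, unit) piece list" where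
  "lift_path G q u [] = []"
| "lift_path G q u (Elt v g # w) = lift_path G q (u @ [Elt v g]) w"
| "lift_path G q u (Seg e a b # w) =
     Seg (lift_edge G q u e a) a b # lift_path G q (u @ [Seg e a b]) w"

definition base_lift ::
  "('v, 'e, 'g) graph_of_groups \<Rightarrow> ('v, 'e) point \<Rightarrow>
   (('v, 'e, 'g) tvert, ('v, 'e, 'g) tedge) point" where
  "base_lift G q =
     (case q of
        Vert v \<Rightarrow> Vert (v, coset G q v [])
      | Mid A \<Rightarrow> Mid ((\<lambda>(e, a). (lift_edge G q [] e a, a)) ` A))"

text \<open>Tight paths in a tree: no group elements, no backtracking.\<close>

definition tight_tree_path ::
  "('v, 'e, unit) graph_of_groups \<Rightarrow> ('v, 'e) point \<Rightarrow> ('v, 'e, unit) piece list \<Rightarrow>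
   ('v, 'e) point \<Rightarrow> bool" where
  "tight_tree_path T x w y \<longleftrightarrow>
     gog_path T x w y \<and>
     (\<forall>s \<in> set w. \<exists>e a b. s = Seg e a b) \<and>
     \<not> (\<exists>l r e a b c d. w = l @ [Seg e a b, Seg (erev T e) c d] @ r)"

text \<open>
  The elements \<open>\<delta>\<close> of a covering projection depend on a choice of coset representatives; any choice
  with the lifting property is admitted.
\<close>

definition covering_projection ::
  "('v, 'e, 'g) graph_of_groups \<Rightarrow> ('v, 'e) point \<Rightarrow>
   (('v, 'e, 'g) tvert, ('v, 'e, 'g) tedge, unit, 'v, 'e, 'g) gog_map \<Rightarrow> bool" where
  "covering_projection G q \<pi> \<longleftrightarrow>
     gog_morphism (bs_tree G q) G \<pi> \<and>
     (\<forall>x \<in> verts (gr (bs_tree G q)). vmap \<pi> x = fst x) \<and>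
     (\<forall>d \<in> arcs (gr (bs_tree G q)). emap \<pi> d = Inr (fst d)) \<and>
     (\<forall>w x. tight_tree_path (bs_tree G q) (base_lift G q) w x \<longrightarrow>
        lift_path G q [] (gog_map_path (bs_tree G q) G \<pi> w) = w)"


section \<open>Commutation of the square\<close>

text \<open>
  Elements of the group at a point, as loops. At an interior point of an edge this is the edge
  group: to a path ending inside \<open>e\<close>, \<open>h\<close> is attached by inserting \<open>\<iota>\<^bsub>erev e\<^esub>(h)\<close> before the final
  segment of \<open>e\<close>. This indeterminacy cannot be dropped: the coset representatives of \<open>\<pi>\<^sub>\<Gamma>\<close> and the
  images of those of \<open>\<pi>\<^sub>\<Lambda>\<close> differ by edge group elements that vary from lift to lift of \<open>e\<close>.
\<close>

definition point_group_loops ::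
  "('v, 'e, 'g) graph_of_groups \<Rightarrow> ('v, 'e) point \<Rightarrow> ('v, 'e, 'g) piece list set" where
  "point_group_loops G y =
     (case y of
        Vert v \<Rightarrow> {[Elt v g] | g. g \<in> carrier (vgrp G v)}
      | Mid A \<Rightarrow> {[Seg (erev G e) (1 - a) 1, Elt (tail (gr G) e) (inc G (erev G e) h), Seg e 0 a]
                  | e a h. (e, a) \<in> A \<and> h \<in> carrier (egrp G e)})"

definition square_commutes ::
  "('v, 'e, 'g) graph_of_groups \<Rightarrow> ('v, 'e) point \<Rightarrow>
   ('w, 'd, 'k) graph_of_groups \<Rightarrow> ('w, 'd) point \<Rightarrow>
   (('v, 'e, 'g) tvert, ('v, 'e, 'g) tedge, unit, 'v, 'e, 'g) gog_map \<Rightarrow>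
   (('w, 'd, 'k) tvert, ('w, 'd, 'k) tedge, unit, 'w, 'd, 'k) gog_map \<Rightarrow>
   ('v, 'e, 'g, 'w, 'd, 'k) gog_map \<Rightarrow>
   (('v, 'e, 'g) tvert, ('v, 'e, 'g) tedge, ('w, 'd, 'k) tvert, ('w, 'd, 'k) tedge) graph_map \<Rightarrow>
   bool" where
  "square_commutes L p G q \<pi>L \<pi>G f ft \<longleftrightarrow>
     (\<forall>w x. tight_tree_path (bs_tree L p) (base_lift L p) w x \<longrightarrow>
        (let y = point_map f (point_map \<pi>L x) in
         \<exists>c \<in> point_group_loops G y.
           homotopic G q y
             (gog_map_path (bs_tree G q) G \<pi>G (graph_map_path ft w))
             (gog_map_path L G f (gog_map_path (bs_tree L p) L \<pi>L w) @ c)))"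

definition pointed_tree_morphism ::
  "('v, 'e, 'g) graph_of_groups \<Rightarrow> ('v, 'e) point \<Rightarrow>
   ('w, 'd, 'k) graph_of_groups \<Rightarrow> ('w, 'd) point \<Rightarrow>
   (('v, 'e, 'g) tvert, ('v, 'e, 'g) tedge, ('w, 'd, 'k) tvert, ('w, 'd, 'k) tedge) graph_map \<Rightarrow>
   bool" where
  "pointed_tree_morphism L p G q ft \<longleftrightarrow>
     graph_morphism (bs_tree L p) (bs_tree G q) ft \<and>
     point_map ft (base_lift L p) = base_lift G q"

text \<open>
  The morphism of trees induced by \<open>f\<close> is the unique pointed one for which the square commutes.
\<close>

definition induces_tree_morphism ::
  "('v, 'e, 'g) graph_of_groups \<Rightarrow> ('v, 'e) point \<Rightarrow>
   ('w, 'd, 'k) graph_of_groups \<Rightarrow> ('w, 'd) point \<Rightarrow>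
   (('v, 'e, 'g) tvert, ('v, 'e, 'g) tedge, unit, 'v, 'e, 'g) gog_map \<Rightarrow>
   (('w, 'd, 'k) tvert, ('w, 'd, 'k) tedge, unit, 'w, 'd, 'k) gog_map \<Rightarrow>
   ('v, 'e, 'g, 'w, 'd, 'k) gog_map \<Rightarrow>
   (('v, 'e, 'g) tvert, ('v, 'e, 'g) tedge, ('w, 'd, 'k) tvert, ('w, 'd, 'k) tedge) graph_map \<Rightarrow>
   bool" where
  "induces_tree_morphism L p G q \<pi>L \<pi>G f ft \<longleftrightarrow>
     pointed_tree_morphism L p G q ft \<and>
     square_commutes L p G q \<pi>L \<pi>G f ft \<and>
     (\<forall>gt. pointed_tree_morphism L p G q gt \<and> square_commutes L p G q \<pi>L \<pi>G f gt \<longrightarrow>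
        (\<forall>x \<in> verts (gr (bs_tree L p)). vmap gt x = vmap ft x) \<and>
        (\<forall>d \<in> arcs (gr (bs_tree L p)). emap gt d = emap ft d))"

definition equivariant ::
  "('v, 'e, 'g) graph_of_groups \<Rightarrow> ('v, 'e) point \<Rightarrow>
   ('w, 'd, 'k) graph_of_groups \<Rightarrow> ('w, 'd) point \<Rightarrow>
   (('v, 'e, 'g) piece list set \<Rightarrow> ('w, 'd, 'k) piece list set) \<Rightarrow>
   (('v, 'e, 'g) tvert, ('v, 'e, 'g) tedge, ('w, 'd, 'k) tvert, ('w, 'd, 'k) tedge) graph_map \<Rightarrow>
   bool" where
  "equivariant L p G q \<phi> ft \<longleftrightarrow>
     (\<forall>h \<in> carrier (pi1 L p). \<forall>x \<in> points (bs_tree L p).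
        point_map ft (act_point L p h x) = act_point G q (\<phi> h) (point_map ft x))"

end

theory Submission
  imports Defs
begin

text \<open>
  Choose paths \<open>\<gamma>\<^sub>v\<close> in \<open>L\<close> from \<open>p\<close> to the vertices \<open>v\<close>, giving vertices \<open>x\<^sub>v\<close> of the tree, and
  paths \<open>\<beta>\<^sub>v\<close> in \<open>G\<close> from \<open>q\<close> representing the vertices \<open>ft x\<^sub>v\<close>. Then
  \<open>\<Phi> u = \<beta>\<^sub>v\<^sup>-\<^sup>1 \<phi>(\<gamma>\<^sub>v u \<gamma>\<^sub>w\<^sup>-\<^sup>1) \<beta>\<^sub>w\<close>, for paths \<open>u\<close> from \<open>v\<close> to \<open>w\<close>, is a homomorphism of path
  groupoids. By equivariance \<open>\<Phi>\<close> sends elements of vertex groups to elements of vertex groups, and an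
  edge \<open>e\<close> to \<open>m e' n\<^sup>-\<^sup>1\<close>, where \<open>e'\<close> (or a vertex, if \<open>e\<close> is collapsed) is the projection of the image
  under \<open>ft\<close> of any lift of \<open>e\<close>. These are the homomorphisms and the elements \<open>\<delta>\<close> of \<open>f\<close>, so \<open>f\<close> acts
  on paths between vertices as \<open>\<Phi>\<close>. That the vertex homomorphisms are well defined and
  restrict to the edge groups is the normal form theorem: vertex groups embed in the path
  groupoid, and \<open>m e = e n\<close> only if \<open>m\<close> and \<open>n\<close> come from the same element of the edge group.
\<close>

text \<open>The obstacle is that \<open>p\<close> and \<open>q\<close> may lie inside edges, while
  \<Phi> is defined between vertices only. So \<open>p\<close> is moved to a vertex along the chosen
  orientation of its edge; a path from \<open>p\<close> to a vertex is, up to homotopy, this initial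
  piece followed by group elements and whole edges. For f to induce \<phi> itself and not a
  conjugate of it, \<beta> at that vertex must be the image under f of the initial piece. This one
  path, and the twist at that end of the edge, are therefore prescribed, while the other choices are
  arbitrary.

  The tree is handled through paths: each of its points is the end point of a lift, and two paths
  with the same end lift to the same point exactly if they differ by an element of the group at that
  end. So the square commutes as soon as, for every path u from \<open>p\<close>, the lift of f(u)
  ends at the image under \<open>ft\<close> of the end point of the lift of u.\<close>

section \<open>A permutation group as a type class group\<close>

text \<open>
  Paths will be evaluated in the Cayley representation of a fundamental group. In the type class
  \<^class>\<open>group_add\<close> words of pieces can be calculated with, with no side conditions on end points.
\<close>

(* keeps sums in the form a + - b, to which associativity and cancellation apply *)
declare add_uminus_conv_diff [simp del]

typedef 'a permutation = "{f :: 'a \<Rightarrow> 'a. bij f}"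
  morphisms apply_permutation Permutation
  by (auto intro: bij_id)

instantiation permutation :: (type) group_add
begin

definition "0 = Permutation id"
definition "a + b = Permutation (apply_permutation a \<circ> apply_permutation b)"
definition "- a = Permutation (inv_into UNIV (apply_permutation a))"
definition "a - b = a + - (b :: 'a permutation)"

lemma bij_apply_permutation: "bij (apply_permutation a)"
  using apply_permutation by auto

instance
proof
  fix a b c :: "'a permutation"
  show "a + b + c = a + (b + c)"
    by (simp add: plus_permutation_def Permutation_inverse bij_comp bij_apply_permutation comp_assoc)
  show "0 + a = a" "a + 0 = a"
    by (simp_all add: plus_permutation_def zero_permutation_def Permutation_inverse
        apply_permutation_inverse del: id_apply)
  show "- a + a = 0"
    using bij_apply_permutation[of a]
    by (simp add: plus_permutation_def zero_permutation_def uminus_permutation_def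
        Permutation_inverse bij_imp_bij_inv bij_is_inj)
  show "a + - b = a - b"
    by (simp add: minus_permutation_def)
qed

end

lemma plus_Permutation: "bij f \<Longrightarrow> bij g \<Longrightarrow> Permutation f + Permutation g = Permutation (f \<circ> g)"
  by (simp add: plus_permutation_def Permutation_inverse)

lemmas group_add_calc = add.assoc minus_add

lemma neg_add_eq_iff: "- a + b = c \<longleftrightarrow> b = a + (c :: 'a :: group_add)"
  by (metis add_minus_cancel minus_add_cancel)

lemma add_neg_eq_iff: "a + - b = c \<longleftrightarrow> a = c + (b :: 'a :: group_add)"
  by (auto simp: add.assoc)

lemma add_cancel_eq_neg:
  "a = a + b + c \<Longrightarrow> b = - (c :: 'a :: group_add)"
  by (metis add.assoc add.right_neutral add_left_cancel eq_neg_iff_add_eq_0)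

section \<open>Calculus of paths\<close>

text \<open>No connectedness is assumed, so that it need not be shown for the Bass--Serre tree.\<close>

locale groups_on_graph =
  bidirected_digraph "gr G" "erev G" for G :: "('v, 'e, 'g) graph_of_groups" +
  assumes group_vgrp: "v \<in> verts (gr G) \<Longrightarrow> group (vgrp G v)"
    and group_egrp: "e \<in> arcs (gr G) \<Longrightarrow> group (egrp G e)"
    and egrp_rev: "e \<in> arcs (gr G) \<Longrightarrow> egrp G (erev G e) = egrp G e"
    and inc_in_hom: "e \<in> arcs (gr G) \<Longrightarrow> inc G e \<in> hom (egrp G e) (vgrp G (head (gr G) e))"

sublocale graph_of_groups \<subseteq> groups_on_graph G
  by (intro groups_on_graph.intro groups_on_graph_axioms.intro bidirected_digraph_axioms
      vgrp egrp egrp_erev inc_hom)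

fun rev_piece :: "('v, 'e, 'g) graph_of_groups \<Rightarrow> ('v, 'e, 'g) piece \<Rightarrow> ('v, 'e, 'g) piece" where
  "rev_piece G (Elt v g) = Elt v (inv\<^bsub>vgrp G v\<^esub> g)"
| "rev_piece G (Seg e a b) = Seg (erev G e) (1 - b) (1 - a)"

definition reverse_path :: "('v, 'e, 'g) graph_of_groups \<Rightarrow> ('v, 'e, 'g) piece list \<Rightarrow> ('v, 'e, 'g) piece list"
  where "reverse_path G w = rev (map (rev_piece G) w)"

lemma reverse_path_simps [simp]:
  "reverse_path G [] = []" "reverse_path G (s # w) = reverse_path G w @ [rev_piece G s]"
  "reverse_path G (u @ w) = reverse_path G w @ reverse_path G u"
  by (simp_all add: reverse_path_def)

lemma edge_point_simps [simp]:
  "edge_point G e 0 = Vert (tail (gr G) e)" "edge_point G e 1 = Vert (head (gr G) e)"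
  by (simp_all add: edge_point_def)

lemma edge_point_Mid: "0 < a \<Longrightarrow> a < 1 \<Longrightarrow> edge_point G e a = Mid {(e, a), (erev G e, 1 - a)}"
  by (simp add: edge_point_def)

lemma gog_path_end_unique: "gog_path G x w y \<Longrightarrow> gog_path G x w z \<Longrightarrow> y = z"
  by (induction w arbitrary: x) auto

context groups_on_graph
begin

lemma edge_point_in_points: "e \<in> arcs (gr G) \<Longrightarrow> 0 \<le> a \<Longrightarrow> a \<le> 1 \<Longrightarrow> edge_point G e a \<in> points G"
  by (auto simp: points_def)

lemma Vert_in_points [simp]: "Vert v \<in> points G \<longleftrightarrow> v \<in> verts (gr G)"
  by (auto simp: points_def edge_point_def split: if_splits)

lemma edge_point_erev: "e \<in> arcs (gr G) \<Longrightarrow> edge_point G (erev G e) a = edge_point G e (1 - a)"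
  by (auto simp: edge_point_def)

lemma piece_points:
  "piece_ok G s \<Longrightarrow> piece_start G s \<in> points G \<and> piece_end G s \<in> points G"
  by (cases s) (auto intro: edge_point_in_points)

lemma gog_path_points: "gog_path G x w y \<Longrightarrow> x \<in> points G \<and> y \<in> points G"
  by (induction w arbitrary: x) (auto simp: piece_points)

lemma gog_path_append:
  "gog_path G x (u @ w) z \<longleftrightarrow> (\<exists>y. gog_path G x u y \<and> gog_path G y w z)"
proof (induction u arbitrary: x)
  case Nil
  then show ?case by (auto dest: gog_path_points)
qed auto

lemma gog_path_Nil [simp]: "x \<in> points G \<Longrightarrow> gog_path G x [] x"
  by simp

lemma gog_path_single:
  "piece_ok G s \<Longrightarrow> gog_path G (piece_start G s) [s] (piece_end G s)"
  by (simp add: piece_points)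

lemma inc_closed: "e \<in> arcs (gr G) \<Longrightarrow> h \<in> carrier (egrp G e) \<Longrightarrow> inc G e h \<in> carrier (vgrp G (head (gr G) e))"
  using inc_in_hom by (auto simp: hom_def)

lemma inc_erev_closed:
  "e \<in> arcs (gr G) \<Longrightarrow> h \<in> carrier (egrp G e) \<Longrightarrow> inc G (erev G e) h \<in> carrier (vgrp G (tail (gr G) e))"
  using inc_closed[of "erev G e" h] by (simp add: egrp_rev)

lemma rev_piece_ok:
  "piece_ok G s \<Longrightarrow> piece_ok G (rev_piece G s) \<and> piece_start G (rev_piece G s) = piece_end G s \<and>
     piece_end G (rev_piece G s) = piece_start G s"
  by (cases s) (auto simp: edge_point_erev group_vgrp group.inv_closed)

lemma gog_path_rev: "gog_path G x w y \<Longrightarrow> gog_path G y (reverse_path G w) x"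
  by (induction w arbitrary: x) (auto simp: gog_path_append rev_piece_ok piece_points)

section \<open>Homotopy as a congruence on paths\<close>

lemma homotopic_refl: "gog_path G x w y \<Longrightarrow> homotopic G x y w w"
  by (auto simp: homotopic_def)

lemma homotopic_sym: "homotopic G x y u w \<Longrightarrow> homotopic G x y w u"
  by (auto simp: homotopic_def intro: equivclp_sym)

lemma homotopic_trans [trans]:
  "homotopic G x y u w \<Longrightarrow> homotopic G x y w t \<Longrightarrow> homotopic G x y u t"
  by (auto simp: homotopic_def intro: equivclp_trans)

lemma homotopic_move:
  "elementary_move G c d \<Longrightarrow> gog_path G x c y \<Longrightarrow> gog_path G x d y \<Longrightarrow> homotopic G x y c d"
  unfolding homotopic_def homotopy_step_def
  by (intro conjI r_into_equivclp) (force intro: exI[of _ "[]"])+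

lemma homotopic_context:
  assumes "gog_path G z l x" "homotopic G x y u w" "gog_path G y r t\<^sub>0"
  shows "homotopic G z t\<^sub>0 (l @ u @ r) (l @ w @ r)"
proof -
  have "equivclp (homotopy_step G x y) u w" and uw: "gog_path G x u y" "gog_path G x w y"
    using assms(2) by (auto simp: homotopic_def)
  \<comment> \<open>Steps carry their end points, so each step from \<open>x\<close> to
    \<open>y\<close> is read again as a step of the longer path.\<close>
  have move: "homotopy_step G z t\<^sub>0 (l @ u @ r) (l @ w @ r)" if "homotopy_step G x y u w" for u w
    using that assms(1,3) unfolding homotopy_step_def gog_path_append
    by (metis append.assoc)
  have "equivclp (homotopy_step G z t\<^sub>0) (l @ u @ r) (l @ w @ r)"
    using \<open>equivclp (homotopy_step G x y) u w\<close>
  proof (induction rule: equivclp_induct)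
    case base
    show ?case by simp
  next
    case (step s t)
    then have "equivclp (homotopy_step G z t\<^sub>0) (l @ s @ r) (l @ t @ r)"
      using move equivclp_sym[OF r_into_equivclp] r_into_equivclp by metis
    with step.IH show ?case
      by (rule equivclp_trans)
  qed
  then show ?thesis
    using uw assms by (auto simp: homotopic_def gog_path_append)
qed

lemma homotopic_append:
  assumes "homotopic G x y u u'" "homotopic G y z w w'"
  shows "homotopic G x z (u @ w) (u' @ w')"
proof -
  have "gog_path G x u' y" "gog_path G y w z" "gog_path G x [] x" "gog_path G z [] z"
    using assms gog_path_points by (auto simp: homotopic_def)
  then have "homotopic G x z ([] @ u @ w) ([] @ u' @ w)" "homotopic G x z (u' @ w @ []) (u' @ w' @ [])"
    using homotopic_context assms by blast+
  then show ?thesis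
    using homotopic_trans[of x z "u @ w" "u' @ w"] by simp
qed

lemma homotopic_rev_piece:
  assumes "piece_ok G s"
  shows "homotopic G (piece_start G s) (piece_start G s) [s, rev_piece G s] []"
proof (cases s)
  case (Elt v g)
  with assms have *: "v \<in> verts (gr G)" "g \<in> carrier (vgrp G v)" "inv\<^bsub>vgrp G v\<^esub> g \<in> carrier (vgrp G v)"
    "g \<otimes>\<^bsub>vgrp G v\<^esub> inv\<^bsub>vgrp G v\<^esub> g = \<one>\<^bsub>vgrp G v\<^esub>" "\<one>\<^bsub>vgrp G v\<^esub> \<in> carrier (vgrp G v)"
    by (auto simp: group_vgrp group.inv_closed group.r_inv group.is_monoid monoid.one_closed)
  have "homotopic G (Vert v) (Vert v) [Elt v g, Elt v (inv\<^bsub>vgrp G v\<^esub> g)] [Elt v \<one>\<^bsub>vgrp G v\<^esub>]"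
    using elementary_move.mult[OF *(1,2,3)] * by (intro homotopic_move) auto
  also have "homotopic G (Vert v) (Vert v) \<dots> []"
    using elementary_move.unit[OF *(1)] * by (intro homotopic_move) auto
  finally show ?thesis using Elt by simp
next
  case (Seg e a b)
  with assms show ?thesis
    by (auto intro!: homotopic_move elementary_move.backtrack simp: edge_point_erev edge_point_in_points)
qed

lemma homotopic_rev_path:
  "gog_path G x w y \<Longrightarrow> homotopic G x x (w @ reverse_path G w) []"
proof (induction w arbitrary: x)
  case Nil
  then show ?case by (auto intro: homotopic_refl)
next
  case (Cons s w)
  let ?z = "piece_end G s"
  have s: "gog_path G x [s] ?z" "gog_path G ?z [rev_piece G s] x"
    using Cons.prems by (auto simp: rev_piece_ok piece_points)
  have "homotopic G x x ([s] @ (w @ reverse_path G w) @ [rev_piece G s]) ([s] @ [] @ [rev_piece G s])"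
    using Cons s by (intro homotopic_context) auto
  also have "homotopic G x x ([s] @ [] @ [rev_piece G s]) []"
    using homotopic_rev_piece[of s] Cons.prems by auto
  finally show ?case by simp
qed

lemma rev_rev_piece [simp]: "piece_ok G s \<Longrightarrow> rev_piece G (rev_piece G s) = s"
  by (cases s) (auto simp: group_vgrp group.inv_inv)

lemma rev_rev_path: "gog_path G x w y \<Longrightarrow> reverse_path G (reverse_path G w) = w"
  by (induction w arbitrary: x) auto

lemma homotopic_rev_path':
  "gog_path G x w y \<Longrightarrow> homotopic G y y (reverse_path G w @ w) []"
  using homotopic_rev_path[OF gog_path_rev] rev_rev_path by metis

section \<open>Homotopy classes and products of loops\<close>

lemma hclass_self: "gog_path G x u y \<Longrightarrow> u \<in> hclass G x y u"
  using homotopic_refl by (simp add: hclass_def)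

lemma hclass_eq_iff:
  assumes "gog_path G x u y"
  shows "hclass G x y u = hclass G x y w \<longleftrightarrow> homotopic G x y u w"
proof
  assume eq: "hclass G x y u = hclass G x y w"
  then have "u \<in> hclass G x y w"
    using homotopic_refl[OF assms] by (auto simp: hclass_def)
  then show "homotopic G x y u w"
    by (auto simp: hclass_def dest: homotopic_sym)
next
  assume uw: "homotopic G x y u w"
  show "hclass G x y u = hclass G x y w"
    using homotopic_trans[OF uw] homotopic_trans[OF homotopic_sym[OF uw]]
    unfolding hclass_def by blast
qed

lemma pi1_mult:
  assumes "gog_path G p u p" "gog_path G p w p"
  shows "hclass G p p u \<otimes>\<^bsub>pi1 G p\<^esub> hclass G p p w = hclass G p p (u @ w)"
proof -
  have "hclass G p p (u' @ w') = hclass G p p (u @ w)"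
    if "u' \<in> hclass G p p u" "w' \<in> hclass G p p w" for u' w'
  proof -
    have "homotopic G p p (u @ w) (u' @ w')"
      using that by (auto simp: hclass_def intro: homotopic_append)
    then show ?thesis
      using hclass_eq_iff homotopic_def by metis
  qed
  then have "(\<Union>u'\<in>hclass G p p u. \<Union>w'\<in>hclass G p p w. hclass G p p (u' @ w')) =
    (\<Union>u'\<in>hclass G p p u. \<Union>w'\<in>hclass G p p w. hclass G p p (u @ w))"
    by simp
  also have "\<dots> = hclass G p p (u @ w)"
    using assms[THEN hclass_self] by auto
  finally have "(\<Union>u'\<in>hclass G p p u. \<Union>w'\<in>hclass G p p w. hclass G p p (u' @ w')) = hclass G p p (u @ w)" .
  then show ?thesis
    by (simp add: pi1_def)
qed

end

section \<open>Evaluation of paths\<close>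

definition root_point :: "('v, 'e, 'g) graph_of_groups \<Rightarrow> ('v, 'e) point" where
  "root_point G = Vert (SOME v. v \<in> verts (gr G))"

definition root_path :: "('v, 'e, 'g) graph_of_groups \<Rightarrow> ('v, 'e) point \<Rightarrow> ('v, 'e, 'g) piece list" where
  "root_path G x = (SOME u. gog_path G (root_point G) u x)"

abbreviation root_class :: "('v, 'e, 'g) graph_of_groups \<Rightarrow> ('v, 'e, 'g) piece list \<Rightarrow> ('v, 'e, 'g) piece list set"
  where "root_class G \<equiv> hclass G (root_point G) (root_point G)"

text \<open>Left multiplication by the class of \<open>u\<close>. It is extended by the identity off
  the fundamental group because a permutation has to be a bijection of the whole type.\<close>

definition translate ::
  "('v, 'e, 'g) graph_of_groups \<Rightarrow> ('v, 'e, 'g) piece list \<Rightarrow>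
   ('v, 'e, 'g) piece list set \<Rightarrow> ('v, 'e, 'g) piece list set" where
  "translate G u C =
     (if C \<in> carrier (pi1 G (root_point G)) then root_class G (u @ (SOME w. w \<in> C)) else C)"

definition piece_val ::
  "('v, 'e, 'g) graph_of_groups \<Rightarrow> ('v, 'e, 'g) piece \<Rightarrow> ('v, 'e, 'g) piece list set permutation" where
  "piece_val G s =
     (if piece_ok G s
      then Permutation
        (translate G (root_path G (piece_start G s) @ s # reverse_path G (root_path G (piece_end G s))))
      else 0)"

definition path_val ::
  "('v, 'e, 'g) graph_of_groups \<Rightarrow> ('v, 'e, 'g) piece list \<Rightarrow> ('v, 'e, 'g) piece list set permutation" where
  "path_val G w = sum_list (map (piece_val G) w)"

text \<open>
  Joining the ends of each piece to the root makes this a homomorphism on all lists of pieces; on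
  paths with common ends its fibres are the homotopy classes.
\<close>

definition elt_val where "elt_val G v g = piece_val G (Elt v g)"

text \<open>A potential along the edge: the segment from a to b has value
  \<open>- seg_val G e a + seg_val G e b\<close>, so joining segments is telescoping.\<close>

definition seg_val where "seg_val G e a = (if a = 0 then 0 else piece_val G (Seg e 0 a))"

lemma path_val_simps [simp]:
  "path_val G [] = 0" "path_val G (u @ w) = path_val G u + path_val G w"
  "path_val G (Elt v g # w) = elt_val G v g + path_val G w"
  by (simp_all add: path_val_def elt_val_def)

lemma seg_val_0 [simp]: "seg_val G e 0 = 0"
  by (simp add: seg_val_def)

section \<open>Paths between points and the regular representation\<close>

context graph_of_groups
begin

lemma verts_nonempty: "verts (gr G) \<noteq> {}"
  using connected by (simp add: connected_conv)

lemma path_between_verts: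
  assumes "v \<in> verts (gr G)" "w \<in> verts (gr G)"
  shows "\<exists>u. gog_path G (Vert v) u (Vert w)"
proof -
  have "(v, w) \<in> rtrancl_on (verts (gr G)) (symcl (arcs_ends (gr G)))"
    using connected assms by (simp add: connected_conv)
  then show ?thesis
  proof (induction rule: rtrancl_on_induct)
    case base
    then have "gog_path G (Vert v) [] (Vert v)" by simp
    then show ?case by blast
  next
    case (step y z)
    then obtain u where u: "gog_path G (Vert v) u (Vert y)" by blast
    from step obtain e where e: "e \<in> arcs (gr G)"
      "y = tail (gr G) e \<and> z = head (gr G) e \<or> z = tail (gr G) e \<and> y = head (gr G) e"
      by (auto simp: symcl_def arcs_ends_conv)
    then obtain e where "e \<in> arcs (gr G)" "y = tail (gr G) e" "z = head (gr G) e"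
      using tail_arev head_arev arev_in_arcs by metis
    then have "gog_path G (Vert v) (u @ [Seg e 0 1]) (Vert z)"
      using u by (auto simp: gog_path_append)
    then show ?case by blast
  qed
qed

lemma path_to_vert:
  assumes "x \<in> points G"
  shows "\<exists>v u. v \<in> verts (gr G) \<and> gog_path G x u (Vert v)"
proof (cases x)
  case (Vert v)
  with assms have "v \<in> verts (gr G) \<and> gog_path G x [] (Vert v)" by auto
  then show ?thesis by blast
next
  case (Mid A)
  with assms obtain e a where e: "e \<in> arcs (gr G)" "x = edge_point G e a" "0 \<le> a" "a \<le> 1"
    by (auto simp: points_def)
  with Mid have "0 < a" "a < 1" by (auto simp: edge_point_def split: if_splits)
  with e have "gog_path G x [Seg e a 1] (Vert (head (gr G) e))" by simp
  with e(1) show ?thesis by (meson head_in_verts)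
qed

lemma path_between:
  assumes "x \<in> points G" "y \<in> points G"
  shows "\<exists>u. gog_path G x u y"
proof -
  obtain v u w t where "v \<in> verts (gr G)" "gog_path G x u (Vert v)"
    "w \<in> verts (gr G)" "gog_path G y t (Vert w)"
    using assms path_to_vert by meson
  moreover from this obtain s where "gog_path G (Vert v) s (Vert w)"
    using path_between_verts by blast
  ultimately have "gog_path G x (u @ s @ reverse_path G t) y"
    by (auto simp: gog_path_append intro!: exI gog_path_rev)
  then show ?thesis by blast
qed

lemma root_point_in: "root_point G \<in> points G"
  unfolding root_point_def using verts_nonempty by (simp add: some_in_eq)

lemma gog_path_root: "x \<in> points G \<Longrightarrow> gog_path G (root_point G) (root_path G x) x"
  unfolding root_path_def using path_between[OF root_point_in] by (rule someI_ex)

abbreviation "rtp \<equiv> root_point G"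

lemma pi1_carrier: "C \<in> carrier (pi1 G p) \<longleftrightarrow> (\<exists>w. gog_path G p w p \<and> C = hclass G p p w)"
  by (auto simp: pi1_def)

lemma translate_hclass:
  assumes "gog_path G rtp u rtp" "gog_path G rtp w rtp"
  shows "translate G u (root_class G w) = root_class G (u @ w)"
proof -
  have "(SOME w'. w' \<in> root_class G w) \<in> root_class G w"
    using hclass_self[OF assms(2)] by (rule someI)
  then have "homotopic G rtp rtp w (SOME w'. w' \<in> root_class G w)"
    by (simp add: hclass_def)
  then have "homotopic G rtp rtp (u @ w) (u @ (SOME w'. w' \<in> root_class G w))"
    using homotopic_append homotopic_refl assms(1) by blast
  moreover have "gog_path G rtp (u @ w) rtp"
    using assms by (auto simp: gog_path_append)
  ultimately have "root_class G (u @ w) = root_class G (u @ (SOME w'. w' \<in> root_class G w))"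
    using hclass_eq_iff by blast
  moreover have "root_class G w \<in> carrier (pi1 G rtp)"
    using assms(2) pi1_carrier by blast
  ultimately show ?thesis
    by (simp add: translate_def)
qed

lemma translate_eqI:
  assumes "\<And>w. gog_path G rtp w rtp \<Longrightarrow> f (root_class G w) = g (root_class G w)"
    and "\<And>C. C \<notin> carrier (pi1 G rtp) \<Longrightarrow> f C = g C"
  shows "f = g"
  using assms pi1_carrier by (metis ext)

lemma translate_append:
  assumes "gog_path G rtp u rtp" "gog_path G rtp w rtp"
  shows "translate G u \<circ> translate G w = translate G (u @ w)"
proof (rule translate_eqI)
  fix t assume t: "gog_path G rtp t rtp"
  then have "gog_path G rtp (w @ t) rtp" "gog_path G rtp (u @ w) rtp"
    using assms by (auto simp: gog_path_append)
  then show "(translate G u \<circ> translate G w) (root_class G t) = translate G (u @ w) (root_class G t)"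
    using assms t by (simp add: translate_hclass)
qed (simp add: translate_def)

lemma translate_cong:
  assumes "homotopic G rtp rtp u w"
  shows "translate G u = translate G w"
proof (rule translate_eqI)
  have uw: "gog_path G rtp u rtp" "gog_path G rtp w rtp"
    using assms by (auto simp: homotopic_def)
  fix t assume t: "gog_path G rtp t rtp"
  then have "gog_path G rtp (u @ t) rtp" "homotopic G rtp rtp (u @ t) (w @ t)"
    using assms uw homotopic_append homotopic_refl by (auto simp: gog_path_append)
  then have "root_class G (u @ t) = root_class G (w @ t)"
    using hclass_eq_iff by blast
  with uw t show "translate G u (root_class G t) = translate G w (root_class G t)"
    by (simp add: translate_hclass)
qed (simp add: translate_def)

lemma translate_Nil: "translate G [] = id"
proof (rule translate_eqI)
  fix w assume "gog_path G rtp w rtp"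
  with translate_hclass[of "[]" w] root_point_in
  show "translate G [] (root_class G w) = id (root_class G w)" by simp
qed (simp add: translate_def)

lemma bij_translate:
  assumes "gog_path G rtp u rtp"
  shows "bij (translate G u)"
proof -
  have u': "gog_path G rtp (reverse_path G u) rtp"
    using assms by (rule gog_path_rev)
  have "translate G (reverse_path G u @ u) = id" "translate G (u @ reverse_path G u) = id"
    using translate_cong[OF homotopic_rev_path[OF assms]]
      translate_cong[OF homotopic_rev_path'[OF assms]] translate_Nil by auto
  then show ?thesis
    using translate_append assms u' o_bij by metis
qed

lemma root_conjugate:
  assumes "gog_path G x w y"
  shows "gog_path G rtp (root_path G x @ w @ reverse_path G (root_path G y)) rtp"
  using gog_path_root gog_path_rev[OF gog_path_root] gog_path_points[OF assms] assms
  by (auto simp: gog_path_append)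

text \<open>The sum telescopes: the return to the root after one piece cancels against the departure
  from the root before the next.\<close>

lemma path_val_eq:
  assumes "gog_path G x w y"
  shows "path_val G w = Permutation (translate G (root_path G x @ w @ reverse_path G (root_path G y)))"
  using assms
proof (induction w arbitrary: x)
  case Nil
  then have "gog_path G rtp (root_path G x) x" "x = y"
    by (auto simp: gog_path_root)
  then have "translate G (root_path G x @ [] @ reverse_path G (root_path G y)) = id"
    using translate_cong[OF homotopic_rev_path] translate_Nil by auto
  then show ?case by (simp add: zero_permutation_def id_def)
next
  case (Cons s w)
  let ?z = "piece_end G s"
  have ok: "piece_ok G s" "piece_start G s = x" and w: "gog_path G ?z w y"
    using Cons.prems by auto
  have s: "gog_path G x [s] ?z"
    using gog_path_single[OF ok(1)] ok(2) by simp
  let ?u = "root_path G x @ [s] @ reverse_path G (root_path G ?z)"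
    and ?w = "root_path G ?z @ w @ reverse_path G (root_path G y)"
  have z: "gog_path G rtp (root_path G ?z) ?z"
    using ok piece_points gog_path_root by blast
  have uw: "gog_path G rtp ?u rtp" "gog_path G rtp ?w rtp"
    using root_conjugate s w by blast+
  have xs: "gog_path G rtp (root_path G x @ [s]) ?z"
    using s gog_path_points[OF s] gog_path_root by (auto simp: gog_path_append)
  have wy: "gog_path G ?z (w @ reverse_path G (root_path G y)) rtp"
    using w gog_path_points[OF w] gog_path_rev[OF gog_path_root] by (auto simp: gog_path_append)
  have "homotopic G rtp rtp ((root_path G x @ [s]) @ (reverse_path G (root_path G ?z) @ root_path G ?z) @
    w @ reverse_path G (root_path G y)) ((root_path G x @ [s]) @ [] @ w @ reverse_path G (root_path G y))"
    by (rule homotopic_context[OF xs homotopic_rev_path'[OF z] wy])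
  then have "translate G (?u @ ?w) = translate G (root_path G x @ (s # w) @ reverse_path G (root_path G y))"
    by (intro translate_cong) simp
  moreover have "path_val G (s # w) = Permutation (translate G ?u) + Permutation (translate G ?w)"
    using Cons.IH[OF w] ok by (simp add: path_val_def piece_val_def)
  ultimately show ?case
    using uw by (simp add: plus_Permutation bij_translate translate_append)
qed

text \<open>The regular representation is faithful, and the detours to the root can be undone. From
  here on, equality of values replaces all reasoning with moves.\<close>

lemma homotopic_iff_path_val:
  assumes "gog_path G x u y" "gog_path G x w y"
  shows "homotopic G x y u w \<longleftrightarrow> path_val G u = path_val G w"
proof -
  let ?x = "root_path G x" and ?y = "root_path G y"
  have xy: "gog_path G rtp ?x x" "gog_path G rtp ?y y"
    using gog_path_root gog_path_points[OF assms(1)] by auto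
  have cancel: "homotopic G x y (reverse_path G ?x @ (?x @ u @ reverse_path G ?y) @ ?y) u"
    if "gog_path G x u y" for u
  proof -
    have "homotopic G x y ((reverse_path G ?x @ ?x) @ u @ (reverse_path G ?y @ ?y)) ([] @ u @ [])"
      by (rule homotopic_append[OF homotopic_rev_path'[OF xy(1)]
            homotopic_append[OF homotopic_refl[OF that] homotopic_rev_path'[OF xy(2)]]])
    then show ?thesis by simp
  qed
  show ?thesis
  proof
    assume uw: "homotopic G x y u w"
    have "homotopic G rtp rtp (?x @ u @ reverse_path G ?y) (?x @ w @ reverse_path G ?y)"
      using xy(1) uw gog_path_rev[OF xy(2)] by (rule homotopic_context)
    then show "path_val G u = path_val G w"
      using path_val_eq assms translate_cong by metis
  next
    assume eq: "path_val G u = path_val G w"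
    have loops: "gog_path G rtp (?x @ u @ reverse_path G ?y) rtp" "gog_path G rtp (?x @ w @ reverse_path G ?y) rtp"
      using assms root_conjugate by blast+
    have "translate G (?x @ u @ reverse_path G ?y) = translate G (?x @ w @ reverse_path G ?y)"
      using eq path_val_eq[OF assms(1)] path_val_eq[OF assms(2)] bij_translate loops
      by (simp add: Permutation_inject)
    \<comment> \<open>A translation evaluated at the class of the empty loop returns the class of
      its loop.\<close>
    then have "root_class G (?x @ u @ reverse_path G ?y) = root_class G (?x @ w @ reverse_path G ?y)"
      using translate_hclass[OF loops(1), of "[]"] translate_hclass[OF loops(2), of "[]"] root_point_in
      by simp
    then have "homotopic G rtp rtp (?x @ u @ reverse_path G ?y) (?x @ w @ reverse_path G ?y)"
      using hclass_eq_iff loops by blast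
    then have "homotopic G x y (reverse_path G ?x @ (?x @ u @ reverse_path G ?y) @ ?y)
      (reverse_path G ?x @ (?x @ w @ reverse_path G ?y) @ ?y)"
      by (rule homotopic_context[OF gog_path_rev[OF xy(1)] _ xy(2)])
    with cancel[OF assms(1)] cancel[OF assms(2)] show "homotopic G x y u w"
      using homotopic_sym homotopic_trans by meson
  qed
qed

lemma path_val_move:
  assumes "elementary_move G c d"
  shows "path_val G c = path_val G d"
proof -
  have "\<exists>x y. gog_path G x c y \<and> gog_path G x d y"
    using assms
  proof cases
    case (unit v)
    then show ?thesis by (auto simp: group_vgrp group.is_monoid intro: monoid.one_closed)
  next
    case (mult v g h)
    then show ?thesis by (auto simp: group_vgrp group.is_monoid intro: monoid.m_closed)
  next
    case (join e a b c)
    then show ?thesis by (auto intro: edge_point_in_points)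
  next
    case (backtrack e a b)
    then show ?thesis by (auto simp: edge_point_erev intro: edge_point_in_points)
  next
    case (slide e h)
    then show ?thesis by (auto simp: inc_closed inc_erev_closed)
  qed
  then show ?thesis
    using homotopic_iff_path_val homotopic_move assms by blast
qed

section \<open>Values of group elements and segments\<close>

lemma elt_val_one [simp]: "v \<in> verts (gr G) \<Longrightarrow> elt_val G v \<one>\<^bsub>vgrp G v\<^esub> = 0"
  using path_val_move[OF elementary_move.unit] by simp

lemma elt_val_mult:
  "v \<in> verts (gr G) \<Longrightarrow> g \<in> carrier (vgrp G v) \<Longrightarrow> h \<in> carrier (vgrp G v) \<Longrightarrow>
    elt_val G v (g \<otimes>\<^bsub>vgrp G v\<^esub> h) = elt_val G v g + elt_val G v h"
  using path_val_move[OF elementary_move.mult] by simp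

lemma elt_val_inv:
  assumes "v \<in> verts (gr G)" "g \<in> carrier (vgrp G v)"
  shows "elt_val G v (inv\<^bsub>vgrp G v\<^esub> g) = - elt_val G v g"
proof -
  interpret group "vgrp G v" using assms group_vgrp by blast
  have "elt_val G v (inv\<^bsub>vgrp G v\<^esub> g) + elt_val G v g = 0"
    using assms elt_val_mult[of v "inv\<^bsub>vgrp G v\<^esub> g" g] by simp
  then show ?thesis
    by (simp add: eq_neg_iff_add_eq_0)
qed

lemma path_val_Seg:
  assumes "e \<in> arcs (gr G)" "0 \<le> a" "a < b" "b \<le> 1"
  shows "path_val G (Seg e a b # w) = - seg_val G e a + (seg_val G e b + path_val G w)"
proof (cases "a = 0")
  case True
  with assms show ?thesis by (simp add: path_val_def seg_val_def)
next
  case False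
  with assms path_val_move[OF elementary_move.join[of e G 0 a b]]
  have "seg_val G e a + piece_val G (Seg e a b) = seg_val G e b"
    by (simp add: path_val_def seg_val_def)
  from this[symmetric] show ?thesis
    by (simp add: path_val_def add.assoc)
qed

text \<open>Backtracking over the last stretch of \<open>e\<close>, from \<open>1 - a\<close> to 1,
  has value zero.\<close>

lemma seg_val_erev:
  assumes "e \<in> arcs (gr G)" "0 \<le> a" "a \<le> 1"
  shows "seg_val G (erev G e) a = - seg_val G e 1 + seg_val G e (1 - a)"
proof (cases "a = 0")
  case False
  with assms path_val_move[OF elementary_move.backtrack[of e G "1 - a" 1]]
  have "path_val G (Seg e (1 - a) 1 # [Seg (erev G e) 0 a]) = 0"
    by simp
  with False assms have "- seg_val G e (1 - a) + (seg_val G e 1 + seg_val G (erev G e) a) = 0"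
    by (subst (asm) path_val_Seg) (auto simp: seg_val_def path_val_def)
  then show ?thesis
    by (simp add: neg_add_eq_iff) (metis minus_add_cancel)
qed simp

lemma seg_val_slide:
  assumes "e \<in> arcs (gr G)" "h \<in> carrier (egrp G e)"
  shows "seg_val G e 1 + elt_val G (head (gr G) e) (inc G e h) =
    elt_val G (tail (gr G) e) (inc G (erev G e) h) + seg_val G e 1"
  using path_val_move[OF elementary_move.slide[OF assms]] assms by (simp add: path_val_Seg)

lemma path_val_rev:
  assumes "gog_path G x w y"
  shows "path_val G (reverse_path G w) = - path_val G w"
proof -
  have "path_val G (w @ reverse_path G w) = path_val G []"
    using homotopic_iff_path_val homotopic_rev_path[OF assms] unfolding homotopic_def by blast
  then have "path_val G w + path_val G (reverse_path G w) = 0" by simp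
  then show ?thesis
    by (metis minus_unique)
qed

end

section \<open>Normal forms\<close>

text \<open>The set is the same for \<open>e\<close> and \<open>erev G e\<close>, so the choice
  selects exactly one of the two orientations.\<close>

definition orient :: "('v, 'e, 'g) graph_of_groups \<Rightarrow> 'e \<Rightarrow> bool" where
  "orient G e \<longleftrightarrow> (SOME d. d \<in> {e, erev G e}) = e"

text \<open>
  Interior points of an edge are retracted to its head, for the chosen one of the two orientations.
  A segment crosses its edge if it contains the tail of that orientation; this makes \<open>crosses\<close>
  compatible with joining and reversing segments.
\<close>

definition crosses :: "('v, 'e, 'g) graph_of_groups \<Rightarrow> 'e \<Rightarrow> real \<Rightarrow> real \<Rightarrow> bool" where
  "crosses G e a b \<longleftrightarrow> (if orient G e then a = 0 else b = 1)"

definition retract_point :: "('v, 'e, 'g) graph_of_groups \<Rightarrow> ('v, 'e) point \<Rightarrow> 'v" where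
  "retract_point G x = (case x of Vert v \<Rightarrow> v | Mid A \<Rightarrow> head (gr G) (SOME e. orient G e \<and> e \<in> fst ` A))"

text \<open>
  Van der Waerden's method: paths act from the right on normal forms
  \<open>s\<^sub>1 e\<^sub>1 s\<^sub>2 e\<^sub>2 \<dots> s\<^sub>n e\<^sub>n g\<close>, where \<open>s\<^sub>i\<close> is the representative of a left coset of the edge group of \<open>e\<^sub>i\<close>
  and \<open>g\<close> is arbitrary. Such a word is stored as \<open>(g, [(e\<^sub>n, s\<^sub>n), \<dots>, (e\<^sub>1, s\<^sub>1)])\<close>.
\<close>

definition coset_rep :: "('v, 'e, 'g) graph_of_groups \<Rightarrow> 'e \<Rightarrow> 'g \<Rightarrow> 'g" where
  "coset_rep G e g =
     (if g \<in> inc G (erev G e) ` carrier (egrp G e) then \<one>\<^bsub>vgrp G (tail (gr G) e)\<^esub>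
      else SOME s. s \<in> carrier (vgrp G (tail (gr G) e)) \<and>
        (\<exists>k \<in> carrier (egrp G e). g = s \<otimes>\<^bsub>vgrp G (tail (gr G) e)\<^esub> inc G (erev G e) k))"

definition coset_rem :: "('v, 'e, 'g) graph_of_groups \<Rightarrow> 'e \<Rightarrow> 'g \<Rightarrow> 'g" where
  "coset_rem G e g = (THE k. k \<in> carrier (egrp G e) \<and>
     g = coset_rep G e g \<otimes>\<^bsub>vgrp G (tail (gr G) e)\<^esub> inc G (erev G e) k)"

text \<open>In this case appending \<open>e\<close> would make the word end in
  \<open>erev G e\<close> followed by \<open>e\<close> with only the trivial element between
  them.\<close>

definition reducible :: "('v, 'e, 'g) graph_of_groups \<Rightarrow> 'e \<Rightarrow> 'g \<Rightarrow> ('e \<times> 'g) list \<Rightarrow> bool" where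
  "reducible G e s st \<longleftrightarrow> s = \<one>\<^bsub>vgrp G (tail (gr G) e)\<^esub> \<and> st \<noteq> [] \<and> fst (hd st) = erev G e"

text \<open>Right multiplication by \<open>e\<close>: the vertex element splits as representative
  times edge group element, and the latter slides across \<open>e\<close>. If the word would then
  backtrack, the last letter is popped and its representative joins the vertex element at the other
  end.\<close>

definition cross_edge ::
  "('v, 'e, 'g) graph_of_groups \<Rightarrow> 'e \<Rightarrow> 'g \<times> ('e \<times> 'g) list \<Rightarrow> 'g \<times> ('e \<times> 'g) list" where
  "cross_edge G e = (\<lambda>(g, st).
     if reducible G e (coset_rep G e g) st
     then (snd (hd st) \<otimes>\<^bsub>vgrp G (head (gr G) e)\<^esub> inc G e (coset_rem G e g), tl st)
     else (inc G e (coset_rem G e g), (e, coset_rep G e g) # st))"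

fun stack_ok :: "('v, 'e, 'g) graph_of_groups \<Rightarrow> 'v \<Rightarrow> ('e \<times> 'g) list \<Rightarrow> bool" where
  "stack_ok G v [] \<longleftrightarrow> True"
| "stack_ok G v ((d, t) # st) \<longleftrightarrow>
     d \<in> arcs (gr G) \<and> head (gr G) d = v \<and> t \<in> carrier (vgrp G (tail (gr G) d)) \<and>
     coset_rep G d t = t \<and> \<not> reducible G d t st \<and> stack_ok G (tail (gr G) d) st"

definition state_ok :: "('v, 'e, 'g) graph_of_groups \<Rightarrow> 'v \<Rightarrow> 'g \<times> ('e \<times> 'g) list \<Rightarrow> bool" where
  "state_ok G v = (\<lambda>(g, st). g \<in> carrier (vgrp G v) \<and> stack_ok G v st)"

fun act_piece ::
  "('v, 'e, 'g) graph_of_groups \<Rightarrow> ('v, 'e, 'g) piece \<Rightarrow> 'g \<times> ('e \<times> 'g) list \<Rightarrow> 'g \<times> ('e \<times> 'g) list"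
where
  "act_piece G (Elt v h) (g, st) = (g \<otimes>\<^bsub>vgrp G v\<^esub> h, st)"
| "act_piece G (Seg e a b) S = (if crosses G e a b then cross_edge G e S else S)"

context groups_on_graph
begin

lemma orient_erev: "e \<in> arcs (gr G) \<Longrightarrow> orient G (erev G e) \<longleftrightarrow> \<not> orient G e"
proof -
  assume e: "e \<in> arcs (gr G)"
  have "(SOME d. d \<in> {e, erev G e}) \<in> {e, erev G e}"
    by (rule someI[of _ e]) simp
  moreover have "{erev G e, e} = {e, erev G e}" by auto
  ultimately show ?thesis
    using arev_neq[OF e] unfolding orient_def arev_arev by auto
qed

lemma crosses_erev:
  "e \<in> arcs (gr G) \<Longrightarrow> crosses G (erev G e) (1 - b) (1 - a) \<longleftrightarrow> crosses G e a b"
  by (auto simp: crosses_def orient_erev)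

lemma retract_point_Vert [simp]: "retract_point G (Vert v) = v"
  by (simp add: retract_point_def)

lemma retract_edge_point:
  assumes "e \<in> arcs (gr G)"
  shows "retract_point G (edge_point G e a) =
    (if orient G e then if a = 0 then tail (gr G) e else head (gr G) e
     else if a = 1 then head (gr G) e else tail (gr G) e)"
proof (cases "a = 0 \<or> a = 1")
  case False
  have "(SOME d. orient G d \<and> d \<in> {e, erev G e}) = (if orient G e then e else erev G e)"
    using orient_erev[OF assms] by (intro some_equality) auto
  with False assms show ?thesis
    by (simp add: retract_point_def edge_point_def)
qed auto

end

section \<open>Cosets of the edge groups\<close>

context graph_of_groups
begin

context
  fixes e assumes e: "e \<in> arcs (gr G)"
begin

interpretation T: group "vgrp G (tail (gr G) e)"
  using e by (simp add: group_vgrp)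

interpretation H: group "vgrp G (head (gr G) e)"
  using e by (simp add: group_vgrp)

interpretation E: group "egrp G e"
  using e by (simp add: group_egrp)

interpretation i: group_hom "egrp G e" "vgrp G (head (gr G) e)" "inc G e"
  using inc_in_hom[OF e] by unfold_locales

interpretation j: group_hom "egrp G e" "vgrp G (tail (gr G) e)" "inc G (erev G e)"
  using inc_in_hom[of "erev G e"] e by unfold_locales (simp add: egrp_rev)

private abbreviation "\<tau> \<equiv> vgrp G (tail (gr G) e)"
private abbreviation "j \<equiv> inc G (erev G e)"

lemma inc_erev_inj: "inj_on j (carrier (egrp G e))"
  using inc_inj[of "erev G e"] e by (simp add: egrp_rev)

lemma inc_coset_iff:
  assumes "g \<in> carrier \<tau>" "s \<in> carrier \<tau>" "k \<in> carrier (egrp G e)"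
  shows "(\<exists>h \<in> carrier (egrp G e). g \<otimes>\<^bsub>\<tau>\<^esub> j k = s \<otimes>\<^bsub>\<tau>\<^esub> j h) \<longleftrightarrow> (\<exists>h \<in> carrier (egrp G e). g = s \<otimes>\<^bsub>\<tau>\<^esub> j h)"
proof
  assume "\<exists>h \<in> carrier (egrp G e). g \<otimes>\<^bsub>\<tau>\<^esub> j k = s \<otimes>\<^bsub>\<tau>\<^esub> j h"
  then obtain h where h: "h \<in> carrier (egrp G e)" "g \<otimes>\<^bsub>\<tau>\<^esub> j k = s \<otimes>\<^bsub>\<tau>\<^esub> j h" by blast
  have "g = g \<otimes>\<^bsub>\<tau>\<^esub> j k \<otimes>\<^bsub>\<tau>\<^esub> inv\<^bsub>\<tau>\<^esub> j k"
    using assms by (simp add: T.m_assoc)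
  also have "\<dots> = s \<otimes>\<^bsub>\<tau>\<^esub> j (h \<otimes>\<^bsub>egrp G e\<^esub> inv\<^bsub>egrp G e\<^esub> k)"
    using assms h by (simp add: T.m_assoc)
  finally show "\<exists>h \<in> carrier (egrp G e). g = s \<otimes>\<^bsub>\<tau>\<^esub> j h"
    using assms h by blast
next
  assume "\<exists>h \<in> carrier (egrp G e). g = s \<otimes>\<^bsub>\<tau>\<^esub> j h"
  then obtain h where h: "h \<in> carrier (egrp G e)" "g = s \<otimes>\<^bsub>\<tau>\<^esub> j h" by blast
  then have "g \<otimes>\<^bsub>\<tau>\<^esub> j k = s \<otimes>\<^bsub>\<tau>\<^esub> j (h \<otimes>\<^bsub>egrp G e\<^esub> k)"
    using assms by (simp add: T.m_assoc)
  then show "\<exists>h \<in> carrier (egrp G e). g \<otimes>\<^bsub>\<tau>\<^esub> j k = s \<otimes>\<^bsub>\<tau>\<^esub> j h"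
    using assms h by blast
qed

lemma coset_rep_inc: "k \<in> carrier (egrp G e) \<Longrightarrow> coset_rep G e (j k) = \<one>\<^bsub>\<tau>\<^esub>"
  by (simp add: coset_rep_def)

text \<open>The predicate under the choice depends on \<open>g\<close> only through its coset, hence
  so does the chosen element.\<close>

lemma coset_rep_mult:
  assumes "g \<in> carrier \<tau>" "k \<in> carrier (egrp G e)"
  shows "coset_rep G e (g \<otimes>\<^bsub>\<tau>\<^esub> j k) = coset_rep G e g"
proof -
  have "g \<otimes>\<^bsub>\<tau>\<^esub> j k \<in> j ` carrier (egrp G e) \<longleftrightarrow> g \<in> j ` carrier (egrp G e)"
    using inc_coset_iff[of g "\<one>\<^bsub>\<tau>\<^esub>" k] assms by (auto simp: image_iff)
  moreover have "(\<lambda>s. s \<in> carrier \<tau> \<and> (\<exists>h \<in> carrier (egrp G e). g \<otimes>\<^bsub>\<tau>\<^esub> j k = s \<otimes>\<^bsub>\<tau>\<^esub> j h)) =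
    (\<lambda>s. s \<in> carrier \<tau> \<and> (\<exists>h \<in> carrier (egrp G e). g = s \<otimes>\<^bsub>\<tau>\<^esub> j h))"
    by (intro ext conj_cong refl inc_coset_iff[OF assms(1) _ assms(2)])
  ultimately show ?thesis
    by (simp add: coset_rep_def)
qed

lemma coset_rep_decomposition:
  assumes "g \<in> carrier \<tau>"
  shows "coset_rep G e g \<in> carrier \<tau>" (is ?A) "\<exists>k \<in> carrier (egrp G e). g = coset_rep G e g \<otimes>\<^bsub>\<tau>\<^esub> j k" (is ?B)
proof -
  have "coset_rep G e g \<in> carrier \<tau> \<and> (\<exists>k \<in> carrier (egrp G e). g = coset_rep G e g \<otimes>\<^bsub>\<tau>\<^esub> j k)"
  proof (cases "g \<in> j ` carrier (egrp G e)")
    case True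
    then show ?thesis by (auto simp: coset_rep_inc)
  next
    case False
    have "g = g \<otimes>\<^bsub>\<tau>\<^esub> j \<one>\<^bsub>egrp G e\<^esub>" using assms by simp
    then have "\<exists>s. s \<in> carrier \<tau> \<and> (\<exists>k \<in> carrier (egrp G e). g = s \<otimes>\<^bsub>\<tau>\<^esub> j k)"
      using assms by blast
    from someI_ex[OF this] False show ?thesis
      by (simp add: coset_rep_def)
  qed
  then show ?A ?B
    by blast+
qed

lemma coset_rep_idem:
  assumes "g \<in> carrier \<tau>"
  shows "coset_rep G e (coset_rep G e g) = coset_rep G e g"
proof -
  obtain k where "k \<in> carrier (egrp G e)" "g = coset_rep G e g \<otimes>\<^bsub>\<tau>\<^esub> j k"
    using coset_rep_decomposition[OF assms] by blast
  then show ?thesis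
    using coset_rep_mult coset_rep_decomposition(1)[OF assms] by metis
qed

lemma coset_rem_eqI:
  assumes "g \<in> carrier \<tau>" "k \<in> carrier (egrp G e)" "g = coset_rep G e g \<otimes>\<^bsub>\<tau>\<^esub> j k"
  shows "coset_rem G e g = k"
  unfolding coset_rem_def
proof (rule the_equality)
  fix h assume h: "h \<in> carrier (egrp G e) \<and> g = coset_rep G e g \<otimes>\<^bsub>\<tau>\<^esub> j h"
  with assms(3) have "coset_rep G e g \<otimes>\<^bsub>\<tau>\<^esub> j h = coset_rep G e g \<otimes>\<^bsub>\<tau>\<^esub> j k" by simp
  \<comment> \<open>Cancelling the representative leaves an equation of images, which injectivity of
    the edge monomorphism resolves.\<close>
  then have "j h = j k"
    using coset_rep_decomposition(1)[OF assms(1)] assms(2) conjunct1[OF h] by simp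
  then show "h = k"
    using h assms inc_erev_inj by (auto dest: inj_onD)
qed (use assms in simp)

lemma coset_rem:
  assumes "g \<in> carrier \<tau>"
  shows "coset_rem G e g \<in> carrier (egrp G e)" "coset_rep G e g \<otimes>\<^bsub>\<tau>\<^esub> j (coset_rem G e g) = g"
  using coset_rep_decomposition(2)[OF assms] coset_rem_eqI[OF assms] by metis+

lemma coset_rem_mult:
  assumes "g \<in> carrier \<tau>" "k \<in> carrier (egrp G e)"
  shows "coset_rem G e (g \<otimes>\<^bsub>\<tau>\<^esub> j k) = coset_rem G e g \<otimes>\<^bsub>egrp G e\<^esub> k"
proof (rule coset_rem_eqI)
  have "coset_rep G e g \<otimes>\<^bsub>\<tau>\<^esub> (j (coset_rem G e g) \<otimes>\<^bsub>\<tau>\<^esub> j k) = g \<otimes>\<^bsub>\<tau>\<^esub> j k"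
    using assms coset_rem coset_rep_decomposition(1) by (simp add: T.m_assoc[symmetric])
  then show "g \<otimes>\<^bsub>\<tau>\<^esub> j k = coset_rep G e (g \<otimes>\<^bsub>\<tau>\<^esub> j k) \<otimes>\<^bsub>\<tau>\<^esub> j (coset_rem G e g \<otimes>\<^bsub>egrp G e\<^esub> k)"
    using assms coset_rem by (simp add: coset_rep_mult)
qed (use assms coset_rem in auto)

lemma coset_rem_rep:
  assumes "s \<in> carrier \<tau>" "coset_rep G e s = s" "k \<in> carrier (egrp G e)"
  shows "coset_rep G e (s \<otimes>\<^bsub>\<tau>\<^esub> j k) = s" "coset_rem G e (s \<otimes>\<^bsub>\<tau>\<^esub> j k) = k"
  using assms coset_rep_mult[of s k] by (auto intro: coset_rem_eqI)

lemma coset_rem_inc: "k \<in> carrier (egrp G e) \<Longrightarrow> coset_rem G e (j k) = k"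
  by (rule coset_rem_eqI) (simp_all add: coset_rep_inc)

section \<open>Crossing an edge in a normal form\<close>

lemma cross_edge_ok:
  assumes "state_ok G (tail (gr G) e) S"
  shows "state_ok G (head (gr G) e) (cross_edge G e S)"
proof -
  obtain g st where S: "S = (g, st)" by (cases S)
  with assms have g: "g \<in> carrier \<tau>" and st: "stack_ok G (tail (gr G) e) st"
    by (auto simp: state_ok_def)
  show ?thesis
  proof (cases "reducible G e (coset_rep G e g) st")
    case True
    then obtain t st' where "st = (erev G e, t) # st'"
      by (cases st) (auto simp: reducible_def)
    with True S st g e show ?thesis
      by (auto simp: cross_edge_def state_ok_def coset_rem)
  next
    case False
    with S st g e show ?thesis
      by (auto simp: cross_edge_def state_ok_def coset_rem coset_rep_decomposition coset_rep_idem)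
  qed
qed

text \<open>The factor from the edge group does not change the representative; it is added to the
  remainder, which is what comes out at the other end of \<open>e\<close>.\<close>

lemma cross_edge_slide:
  assumes "g \<in> carrier \<tau>" "stack_ok G (tail (gr G) e) st" "k \<in> carrier (egrp G e)"
  shows "cross_edge G e (g \<otimes>\<^bsub>\<tau>\<^esub> j k, st) =
    act_piece G (Elt (head (gr G) e) (inc G e k)) (cross_edge G e (g, st))"
proof (cases "reducible G e (coset_rep G e g) st")
  case True
  then obtain t st' where "st = (erev G e, t) # st'"
    by (cases st) (auto simp: reducible_def)
  with True assms e show ?thesis
    by (auto simp: cross_edge_def coset_rem coset_rem_mult coset_rep_mult H.m_assoc)
next
  case False
  with assms e show ?thesis
    by (auto simp: cross_edge_def coset_rem coset_rem_mult coset_rep_mult)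
qed

end

text \<open>A pushed letter is popped again, since the element now standing after it lies in the
  edge group and has representative 1. A popped letter is pushed again, since its element is its own
  coset representative and, by \<open>stack_ok\<close>, does not reduce against the rest of the
  stack.\<close>

lemma cross_edge_erev:
  assumes e: "e \<in> arcs (gr G)" and S: "state_ok G (tail (gr G) e) S"
  shows "cross_edge G (erev G e) (cross_edge G e S) = S"
proof -
  obtain g st where S': "S = (g, st)" by (cases S)
  with S have g: "g \<in> carrier (vgrp G (tail (gr G) e))" and st: "stack_ok G (tail (gr G) e) st"
    by (auto simp: state_ok_def)
  have e': "erev G e \<in> arcs (gr G)" using e by simp
  have k: "coset_rem G e g \<in> carrier (egrp G e)" "coset_rem G e g \<in> carrier (egrp G (erev G e))"
    using coset_rem[OF e g] e by (simp_all add: egrp_rev)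
  show ?thesis
  proof (cases "reducible G e (coset_rep G e g) st")
    case True
    then obtain t st' where t: "st = (erev G e, t) # st'" and "coset_rep G e g = \<one>\<^bsub>vgrp G (tail (gr G) e)\<^esub>"
      by (cases st) (auto simp: reducible_def)
    then have gk: "inc G (erev G e) (coset_rem G e g) = g"
      using coset_rem[OF e g] inc_erev_closed[OF e k(1)] group_vgrp e group.is_monoid monoid.l_one
      by (metis tail_in_verts)
    have "coset_rep G (erev G e) (t \<otimes>\<^bsub>vgrp G (head (gr G) e)\<^esub> inc G e (coset_rem G e g)) = t"
      "coset_rem G (erev G e) (t \<otimes>\<^bsub>vgrp G (head (gr G) e)\<^esub> inc G e (coset_rem G e g)) = coset_rem G e g"
      using coset_rem_rep[OF e', of t "coset_rem G e g"] st t k e by auto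
    with True t st gk S' e show ?thesis
      by (simp add: cross_edge_def)
  next
    case False
    have "coset_rep G (erev G e) (inc G e (coset_rem G e g)) = \<one>\<^bsub>vgrp G (head (gr G) e)\<^esub>"
      "coset_rem G (erev G e) (inc G e (coset_rem G e g)) = coset_rem G e g"
      using coset_rep_inc[OF e' k(2)] coset_rem_inc[OF e' k(2)] e by auto
    moreover have "cross_edge G e S = (inc G e (coset_rem G e g), (e, coset_rep G e g) # st)"
      using False S' by (simp add: cross_edge_def)
    ultimately show ?thesis
      using coset_rem[OF e g] S' e by (simp add: cross_edge_def reducible_def)
  qed
qed

section \<open>The action of paths on normal forms\<close>

lemma act_piece_ok:
  assumes "piece_ok G s" "state_ok G (retract_point G (piece_start G s)) S"
  shows "state_ok G (retract_point G (piece_end G s)) (act_piece G s S)"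
proof (cases s)
  case (Elt v g)
  with assms show ?thesis
    by (cases S) (auto simp: state_ok_def group_vgrp group.is_monoid intro: monoid.m_closed)
next
  case (Seg e a b)
  with assms show ?thesis
    using cross_edge_ok[of e S] by (auto simp: retract_edge_point crosses_def split: if_splits)
qed

lemma fold_act_piece_ok:
  "gog_path G x w y \<Longrightarrow> state_ok G (retract_point G x) S \<Longrightarrow>
    state_ok G (retract_point G y) (fold (act_piece G) w S)"
proof (induction w arbitrary: x S)
  case (Cons s w)
  then have "state_ok G (retract_point G (piece_end G s)) (act_piece G s S)"
    using act_piece_ok by auto
  then show ?case
    using Cons.IH[of "piece_end G s"] Cons.prems by simp
qed simp

lemma act_piece_move:
  assumes "elementary_move G c d" "gog_path G x c y" "state_ok G (retract_point G x) S"
  shows "fold (act_piece G) c S = fold (act_piece G) d S"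
  using assms(1)
proof cases
  case (unit v)
  with assms show ?thesis
    by (cases S) (auto simp: state_ok_def group_vgrp group.is_monoid intro: monoid.r_one)
next
  case (mult v g h)
  with assms show ?thesis
    by (cases S) (auto simp: state_ok_def group_vgrp group.is_monoid intro: monoid.m_assoc)
next
  \<comment> \<open>Only one of the two parts can reach the tail of the chosen orientation, and it
    does so exactly if the whole segment does.\<close>
  case (join e a b c)
  then show ?thesis by (auto simp: crosses_def)
next
  \<comment> \<open>By \<open>crosses_erev\<close> both segments cross or neither does.\<close>
  case (backtrack e a b)
  with assms show ?thesis
    using cross_edge_erev[of e S] crosses_erev[of e b a]
    by (auto simp: retract_edge_point crosses_def split: if_splits)
next
  case (slide e h)
  with assms show ?thesis
    using cross_edge_slide[of e "fst S" "snd S" h]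
    by (cases S) (auto simp: retract_edge_point crosses_def state_ok_def split: if_splits)
qed

lemma fold_act_piece_homotopic:
  assumes "homotopic G x y u w" and S: "state_ok G (retract_point G x) S"
  shows "fold (act_piece G) u S = fold (act_piece G) w S"
proof -
  have move: "fold (act_piece G) u S = fold (act_piece G) w S" if uw: "homotopy_step G x y u w" for u w
  proof -
    obtain l c d r where lr: "u = l @ c @ r" "w = l @ d @ r" "elementary_move G c d" "gog_path G x u y"
      using uw unfolding homotopy_step_def by blast
    then obtain z z' where z: "gog_path G x l z" "gog_path G z c z'"
      by (auto simp: gog_path_append)
    show ?thesis
      using act_piece_move[OF lr(3) z(2) fold_act_piece_ok[OF z(1) S]] by (simp add: lr(1,2))
  qed
  have "equivclp (homotopy_step G x y) u w"
    using assms by (simp add: homotopic_def)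
  then show ?thesis
  proof (induction rule: equivclp_induct)
    case (step s t)
    then show ?case
      using move[of s t] move[of t s] by auto
  qed simp
qed

lemma state_ok_start: "v \<in> verts (gr G) \<Longrightarrow> state_ok G v (\<one>\<^bsub>vgrp G v\<^esub>, [])"
  by (auto simp: state_ok_def group_vgrp group.is_monoid intro: monoid.one_closed)

text \<open>Acting on the empty normal form, an element of the vertex group leaves itself
  behind.\<close>

lemma elt_val_inj:
  assumes "v \<in> verts (gr G)" "g \<in> carrier (vgrp G v)" "h \<in> carrier (vgrp G v)"
    and "elt_val G v g = elt_val G v h"
  shows "g = h"
proof -
  interpret group "vgrp G v" using assms group_vgrp by blast
  have "homotopic G (Vert v) (Vert v) [Elt v g] [Elt v h]"
    using assms homotopic_iff_path_val[of "Vert v" "[Elt v g]" "Vert v" "[Elt v h]"] by simp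
  then have "fold (act_piece G) [Elt v g] (\<one>\<^bsub>vgrp G v\<^esub>, []) = fold (act_piece G) [Elt v h] (\<one>\<^bsub>vgrp G v\<^esub>, [])"
    using fold_act_piece_homotopic state_ok_start assms by force
  then show ?thesis
    using assms by simp
qed

text \<open>Both words act on the empty normal form. The word \<open>m\<close> \<open>e\<close>
  leaves the representative of \<open>m\<close> on the stack and the image of its remainder as
  vertex element; \<open>e\<close> \<open>n\<close> leaves 1 on the stack and \<open>n\<close> as
  vertex element. So \<open>m\<close> has trivial representative, and its remainder is the required
  \<open>k\<close>.\<close>

lemma seg_val_commute:
  assumes e: "e \<in> arcs (gr G)"
    and m: "m \<in> carrier (vgrp G (tail (gr G) e))" and n: "n \<in> carrier (vgrp G (head (gr G) e))"
    and eq: "elt_val G (tail (gr G) e) m + seg_val G e 1 = seg_val G e 1 + elt_val G (head (gr G) e) n"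
  shows "\<exists>k \<in> carrier (egrp G e). m = inc G (erev G e) k \<and> n = inc G e k"
proof -
  interpret T: group "vgrp G (tail (gr G) e)" using assms group_vgrp by simp
  interpret H: group "vgrp G (head (gr G) e)" using assms group_vgrp by simp
  let ?u = "[Elt (tail (gr G) e) m, Seg e 0 1]" and ?w = "[Seg e 0 1, Elt (head (gr G) e) n]"
    and ?S = "(\<one>\<^bsub>vgrp G (tail (gr G) e)\<^esub>, [])"
  have "homotopic G (Vert (tail (gr G) e)) (Vert (head (gr G) e)) ?u ?w"
    using assms by (subst homotopic_iff_path_val) (auto simp: path_val_Seg)
  then have "fold (act_piece G) ?u ?S = fold (act_piece G) ?w ?S"
    using e by (intro fold_act_piece_homotopic) (auto simp: state_ok_start)
  moreover have "crosses G e 0 1" by (simp add: crosses_def)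
  moreover have one: "coset_rep G e \<one>\<^bsub>vgrp G (tail (gr G) e)\<^esub> = \<one>\<^bsub>vgrp G (tail (gr G) e)\<^esub>"
    "inc G e (coset_rem G e \<one>\<^bsub>vgrp G (tail (gr G) e)\<^esub>) = \<one>\<^bsub>vgrp G (head (gr G) e)\<^esub>"
  proof -
    interpret E: group "egrp G e" using e by (simp add: group_egrp)
    have "inc G (erev G e) \<one>\<^bsub>egrp G e\<^esub> = \<one>\<^bsub>vgrp G (tail (gr G) e)\<^esub>" "inc G e \<one>\<^bsub>egrp G e\<^esub> = \<one>\<^bsub>vgrp G (head (gr G) e)\<^esub>"
      using inc_in_hom[OF e] inc_in_hom[of "erev G e"] e hom_one T.group_axioms H.group_axioms E.group_axioms
      by (auto simp: egrp_rev)
    then show "coset_rep G e \<one>\<^bsub>vgrp G (tail (gr G) e)\<^esub> = \<one>\<^bsub>vgrp G (tail (gr G) e)\<^esub>"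
      "inc G e (coset_rem G e \<one>\<^bsub>vgrp G (tail (gr G) e)\<^esub>) = \<one>\<^bsub>vgrp G (head (gr G) e)\<^esub>"
      using coset_rep_inc[OF e E.one_closed] coset_rem_inc[OF e E.one_closed] by auto
  qed
  ultimately have "coset_rep G e m = \<one>\<^bsub>vgrp G (tail (gr G) e)\<^esub>" "inc G e (coset_rem G e m) = n"
    using m n by (auto simp: cross_edge_def reducible_def)
  then show ?thesis
    using coset_rem[OF e m] inc_erev_closed[OF e] by (intro bexI[of _ "coset_rem G e m"]) auto
qed

end

section \<open>Action of morphisms on paths\<close>

locale graph_hom = T: groups_on_graph T + G: groups_on_graph G
  for T :: "('v, 'e, 'g) graph_of_groups" and G :: "('w, 'd, 'k) graph_of_groups" +
  fixes f :: "('v, 'e, 'w, 'd, 'z) graph_map_scheme"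
  assumes morphism: "graph_morphism T G f"
begin

lemma vmap_closed: "v \<in> verts (gr T) \<Longrightarrow> vmap f v \<in> verts (gr G)"
  using morphism by (auto simp: graph_morphism_def)

lemma emap_Inl:
  "e \<in> arcs (gr T) \<Longrightarrow> emap f e = Inl v \<Longrightarrow>
    vmap f (tail (gr T) e) = v \<and> vmap f (head (gr T) e) = v \<and> emap f (erev T e) = Inl v"
  using morphism by (fastforce simp: graph_morphism_def)

lemma emap_Inr:
  "e \<in> arcs (gr T) \<Longrightarrow> emap f e = Inr d \<Longrightarrow>
    d \<in> arcs (gr G) \<and> tail (gr G) d = vmap f (tail (gr T) e) \<and>
    head (gr G) d = vmap f (head (gr T) e) \<and> emap f (erev T e) = Inr (erev G d)"
  using morphism by (fastforce simp: graph_morphism_def)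

lemma point_map_Vert [simp]: "point_map f (Vert v) = Vert (vmap f v)"
  by (simp add: point_map_def)

lemma point_map_edge_point:
  assumes "e \<in> arcs (gr T)"
  shows "point_map f (edge_point T e a) = (case emap f e of Inl v \<Rightarrow> Vert v | Inr d \<Rightarrow> edge_point G d a)"
proof (cases "emap f e")
  case (Inl v)
  then show ?thesis
    using emap_Inl[OF assms Inl] by (auto simp: edge_point_def point_map_def)
next
  case (Inr d)
  then show ?thesis
    using emap_Inr[OF assms Inr] by (auto simp: edge_point_def point_map_def)
qed

lemma point_map_closed:
  assumes "x \<in> points T"
  shows "point_map f x \<in> points G"
proof -
  consider v where "v \<in> verts (gr T)" "x = Vert v"
    | e a where "e \<in> arcs (gr T)" "0 \<le> a" "a \<le> 1" "x = edge_point T e a"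
    using assms by (auto simp: points_def)
  then show ?thesis
  proof cases
    case 2
    then show ?thesis
      using emap_Inl[of e] emap_Inr[of e] vmap_closed T.tail_in_verts
      by (auto simp: point_map_edge_point G.edge_point_in_points split: sum.split)
  qed (simp add: vmap_closed)
qed

end

lemma (in groups_on_graph) points_cases:
  assumes "x \<in> points G"
  obtains v where "v \<in> verts (gr G)" "x = Vert v"
  | e a where "e \<in> arcs (gr G)" "orient G e" "0 < a" "a < 1" "x = edge_point G e a"
proof -
  consider v where "v \<in> verts (gr G)" "x = Vert v"
    | e a where "e \<in> arcs (gr G)" "0 < a" "a < 1" "x = edge_point G e a"
  proof (cases "x \<in> Vert ` verts (gr G)")
    case False
    then obtain e a where e: "e \<in> arcs (gr G)" "0 \<le> a" "a \<le> 1" "x = edge_point G e a"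
      using assms by (auto simp: points_def)
    with False have "a \<noteq> 0" "a \<noteq> 1" by auto
    with e that(2)[of e a] show ?thesis by simp
  qed (use that(1) in auto)
  then show thesis
  proof cases
    case (2 e a)
    show thesis
    proof (cases "orient G e")
      case False
      with 2 that(2)[of "erev G e" "1 - a"] show thesis
        by (simp add: orient_erev edge_point_erev)
    qed (use 2 that in blast)
  qed (use that in blast)
qed

text \<open>The potential of the image of \<open>e\<close>, in analogy to \<open>seg_val\<close>. It
  jumps just after 0 and at 1, where the segment acquires the twists.\<close>

definition edge_image_val ::
  "('v, 'e, 'g) graph_of_groups \<Rightarrow> ('w, 'd, 'k) graph_of_groups \<Rightarrow>
   ('v, 'e, 'g, 'w, 'd, 'k) gog_map \<Rightarrow> 'e \<Rightarrow> real \<Rightarrow> ('w, 'd, 'k) piece list set permutation" where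
  "edge_image_val T G f e a =
     (if a = 0 then 0
      else elt_val G (vmap f (tail (gr T) e)) (twist f (erev T e)) +
        (case emap f e of Inl v \<Rightarrow> 0 | Inr d \<Rightarrow> seg_val G d a) +
        (if a = 1 then - elt_val G (vmap f (head (gr T) e)) (twist f e) else 0))"

section \<open>Morphisms of graphs of groups preserve homotopy\<close>

locale gog_hom = T: groups_on_graph T + G: graph_of_groups G
  for T :: "('v, 'e, 'g) graph_of_groups" and G :: "('w, 'd, 'k) graph_of_groups" +
  fixes f :: "('v, 'e, 'g, 'w, 'd, 'k) gog_map"
  assumes gog_morphism: "gog_morphism T G f"

sublocale gog_hom \<subseteq> graph_hom T G f
  using gog_morphism by unfold_locales (simp add: gog_morphism_def)

context gog_hom
begin

lemma vhom_hom: "v \<in> verts (gr T) \<Longrightarrow> vhom f v \<in> hom (vgrp T v) (vgrp G (vmap f v))"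
  using gog_morphism by (simp add: gog_morphism_def)

lemma vhom_closed: "v \<in> verts (gr T) \<Longrightarrow> g \<in> carrier (vgrp T v) \<Longrightarrow> vhom f v g \<in> carrier (vgrp G (vmap f v))"
  using vhom_hom by (auto simp: hom_def)

lemma twist_closed: "e \<in> arcs (gr T) \<Longrightarrow> twist f e \<in> carrier (vgrp G (vmap f (head (gr T) e)))"
  using gog_morphism by (simp add: gog_morphism_def Let_def)

lemma twist_erev_closed: "e \<in> arcs (gr T) \<Longrightarrow> twist f (erev T e) \<in> carrier (vgrp G (vmap f (tail (gr T) e)))"
  using twist_closed[of "erev T e"] by simp

lemma ehom_closed: "e \<in> arcs (gr T) \<Longrightarrow> h \<in> carrier (egrp T e) \<Longrightarrow> ehom f e h \<in> carrier (cell_grp G (emap f e))"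
  using gog_morphism by (auto simp: gog_morphism_def hom_def)

lemma ehom_erev: "e \<in> arcs (gr T) \<Longrightarrow> h \<in> carrier (egrp T e) \<Longrightarrow> ehom f (erev T e) h = ehom f e h"
  using gog_morphism by (auto simp: gog_morphism_def)

lemma vhom_inc:
  "e \<in> arcs (gr T) \<Longrightarrow> h \<in> carrier (egrp T e) \<Longrightarrow>
    vhom f (head (gr T) e) (inc T e h) =
      twist f e \<otimes>\<^bsub>vgrp G (vmap f (head (gr T) e))\<^esub> cell_inc G (emap f e) (ehom f e h)
        \<otimes>\<^bsub>vgrp G (vmap f (head (gr T) e))\<^esub> inv\<^bsub>vgrp G (vmap f (head (gr T) e))\<^esub> (twist f e)"
  using gog_morphism by (simp add: gog_morphism_def Let_def)

lemma cell_inc_closed: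
  assumes "e \<in> arcs (gr T)" "h \<in> carrier (egrp T e)"
  shows "cell_inc G (emap f e) (ehom f e h) \<in> carrier (vgrp G (vmap f (head (gr T) e)))"
  using ehom_closed[OF assms] emap_Inl[OF assms(1)] emap_Inr[OF assms(1)] G.inc_closed
  by (fastforce simp: cell_inc_def cell_grp_def split: sum.splits)

lemma gog_map_piece_path:
  assumes "piece_ok T s"
  shows "gog_path G (point_map f (piece_start T s)) (gog_map_piece T G f s) (point_map f (piece_end T s))"
proof (cases s)
  case (Elt v g)
  with assms show ?thesis by (simp add: vhom_closed vmap_closed)
next
  case (Seg e a b)
  with assms have e: "e \<in> arcs (gr T)" "0 \<le> a" "a < b" "b \<le> 1" by auto
  have tw: "twist f e \<in> carrier (vgrp G (vmap f (head (gr T) e)))"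
    "twist f (erev T e) \<in> carrier (vgrp G (vmap f (tail (gr T) e)))"
    "inv\<^bsub>vgrp G (vmap f (head (gr T) e))\<^esub> twist f e \<in> carrier (vgrp G (vmap f (head (gr T) e)))"
    "vmap f (head (gr T) e) \<in> verts (gr G)" "vmap f (tail (gr T) e) \<in> verts (gr G)"
    using twist_closed[OF e(1)] twist_erev_closed[OF e(1)] vmap_closed e(1) G.group_vgrp group.inv_closed
    by auto
  show ?thesis
  proof (cases "emap f e")
    case (Inl v)
    with emap_Inl[OF e(1) Inl] e tw Seg show ?thesis
      by (auto simp: Let_def point_map_edge_point)
  next
    case (Inr d)
    with emap_Inr[OF e(1) Inr] e tw Seg show ?thesis
      by (auto simp: Let_def point_map_edge_point G.edge_point_in_points)
  qed
qed

lemma gog_map_path_simps [simp]: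
  "gog_map_path T G f [] = []"
  "gog_map_path T G f (s # w) = gog_map_piece T G f s @ gog_map_path T G f w"
  "gog_map_path T G f (u @ w) = gog_map_path T G f u @ gog_map_path T G f w"
  by (simp_all add: gog_map_path_def)

lemma gog_map_path_path:
  "gog_path T x w y \<Longrightarrow> gog_path G (point_map f x) (gog_map_path T G f w) (point_map f y)"
proof (induction w arbitrary: x)
  case Nil
  then show ?case using point_map_closed by auto
next
  case (Cons s w)
  then have "gog_path G (point_map f x) (gog_map_piece T G f s) (point_map f (piece_end T s))"
    "gog_path G (point_map f (piece_end T s)) (gog_map_path T G f w) (point_map f y)"
    using gog_map_piece_path[of s] by auto
  then show ?case by (auto simp: G.gog_path_append)
qed

lemma edge_image_val_0 [simp]: "edge_image_val T G f e 0 = 0"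
  by (simp add: edge_image_val_def)

lemma path_val_gog_map_Seg:
  assumes e: "e \<in> arcs (gr T)" "0 \<le> a" "a < b" "b \<le> 1"
  shows "path_val G (gog_map_piece T G f (Seg e a b)) = - edge_image_val T G f e a + edge_image_val T G f e b"
proof -
  let ?w = "vmap f (head (gr T) e)"
  have tw: "elt_val G ?w (inv\<^bsub>vgrp G ?w\<^esub> twist f e) = - elt_val G ?w (twist f e)"
    using twist_closed[OF e(1)] vmap_closed e(1) by (simp add: G.elt_val_inv)
  show ?thesis
  proof (cases "emap f e")
    case (Inl v)
    with e tw show ?thesis
      by (simp add: edge_image_val_def Let_def group_add_calc)
  next
    case (Inr d)
    with emap_Inr[OF e(1) Inr] e tw show ?thesis
      by (simp add: edge_image_val_def Let_def G.path_val_Seg group_add_calc)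
  qed
qed

lemma edge_image_val_erev:
  assumes "e \<in> arcs (gr T)" "0 \<le> a" "a \<le> 1"
  shows "edge_image_val T G f (erev T e) a = - edge_image_val T G f e 1 + edge_image_val T G f e (1 - a)"
proof (cases "emap f e")
  case (Inl v)
  with emap_Inl[OF assms(1) Inl] assms show ?thesis
    by (simp add: edge_image_val_def group_add_calc)
next
  case (Inr d)
  with emap_Inr[OF assms(1) Inr] assms show ?thesis
    by (simp add: edge_image_val_def group_add_calc G.seg_val_erev)
qed

lemma edge_image_val_slide:
  assumes e: "e \<in> arcs (gr T)" and h: "h \<in> carrier (egrp T e)"
  shows "edge_image_val T G f e 1 + elt_val G (vmap f (head (gr T) e)) (vhom f (head (gr T) e) (inc T e h)) =
    elt_val G (vmap f (tail (gr T) e)) (vhom f (tail (gr T) e) (inc T (erev T e) h)) + edge_image_val T G f e 1"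
proof -
  let ?v = "vmap f (tail (gr T) e)" and ?w = "vmap f (head (gr T) e)"
  have val: "elt_val G (vmap f (head (gr T) e)) (vhom f (head (gr T) e) (inc T e h)) =
      elt_val G (vmap f (head (gr T) e)) (twist f e) +
      elt_val G (vmap f (head (gr T) e)) (cell_inc G (emap f e) (ehom f e h)) +
      - elt_val G (vmap f (head (gr T) e)) (twist f e)"
    if e: "e \<in> arcs (gr T)" and h: "h \<in> carrier (egrp T e)" for e
  proof -
    interpret group "vgrp G (vmap f (head (gr T) e))"
      using e vmap_closed G.group_vgrp by simp
    show ?thesis
      using e h vmap_closed twist_closed cell_inc_closed
      by (simp add: vhom_inc G.elt_val_mult G.elt_val_inv)
  qed
  \<comment> \<open>After the twists cancel, this is the slide relation of the image edge. One
    element serves for both ends because \<open>ehom\<close> agrees on \<open>e\<close> and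
    \<open>erev T e\<close>.\<close>
  have swap: "(case emap f e of Inl v \<Rightarrow> 0 | Inr d \<Rightarrow> seg_val G d 1) + elt_val G ?w (cell_inc G (emap f e) (ehom f e h)) =
    elt_val G ?v (cell_inc G (emap f (erev T e)) (ehom f e h)) + (case emap f e of Inl v \<Rightarrow> 0 | Inr d \<Rightarrow> seg_val G d 1)"
  proof (cases "emap f e")
    case (Inl v)
    with emap_Inl[OF e Inl] show ?thesis by (simp add: cell_inc_def)
  next
    case (Inr d)
    with emap_Inr[OF e Inr] ehom_closed[OF e h] show ?thesis
      using G.seg_val_slide[of d "ehom f e h"] by (simp add: cell_inc_def cell_grp_def)
  qed
  show ?thesis
    using val[of e] val[of "erev T e"] e h swap
    by (simp add: T.egrp_rev ehom_erev edge_image_val_def group_add_calc) (simp add: add.assoc[symmetric])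
qed

lemma path_val_gog_map_move:
  assumes "elementary_move T c d"
  shows "path_val G (gog_map_path T G f c) = path_val G (gog_map_path T G f d)"
  using assms
proof cases
  case (unit v)
  interpret group_hom "vgrp T v" "vgrp G (vmap f v)" "vhom f v"
    using unit vhom_hom T.group_vgrp G.group_vgrp vmap_closed by (auto simp: group_hom_def group_hom_axioms_def)
  show ?thesis using unit by (simp add: G.elt_val_one vmap_closed)
next
  case (mult v g h)
  interpret group_hom "vgrp T v" "vgrp G (vmap f v)" "vhom f v"
    using mult vhom_hom T.group_vgrp G.group_vgrp vmap_closed by (auto simp: group_hom_def group_hom_axioms_def)
  show ?thesis using mult by (simp add: G.elt_val_mult vmap_closed)
next
  case (join e a b c)
  then show ?thesis
    using path_val_gog_map_Seg[of e] by (simp del: gog_map_piece.simps add: add.assoc)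
next
  case (backtrack e a b)
  then show ?thesis
    using path_val_gog_map_Seg[of e a b] path_val_gog_map_Seg[of "erev T e" "1 - b" "1 - a"]
    by (simp del: gog_map_piece.simps add: group_add_calc edge_image_val_erev)
next
  case (slide e h)
  then show ?thesis
    using path_val_gog_map_Seg[of e 0 1] edge_image_val_slide[of e h]
    by (simp del: gog_map_piece.simps(2))
qed

lemma path_val_gog_map_homotopic:
  assumes "homotopic T x y u w"
  shows "path_val G (gog_map_path T G f u) = path_val G (gog_map_path T G f w)"
proof -
  have move: "path_val G (gog_map_path T G f u) = path_val G (gog_map_path T G f w)"
    if "homotopy_step T x y u w" for u w
    using that path_val_gog_map_move by (auto simp: homotopy_step_def)
  have "equivclp (homotopy_step T x y) u w"
    using assms by (simp add: homotopic_def)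
  then show ?thesis
  proof (induction rule: equivclp_induct)
    case (step s t)
    then show ?case
      using move[of s t] move[of t s] by auto
  qed simp
qed

end

section \<open>Retraction of paths onto whole edges\<close>

fun retract_piece :: "('v, 'e, 'g) graph_of_groups \<Rightarrow> ('v, 'e, 'g) piece \<Rightarrow> ('v, 'e, 'g) piece list" where
  "retract_piece G (Elt v g) = [Elt v g]"
| "retract_piece G (Seg e a b) = (if crosses G e a b then [Seg e 0 1] else [])"

definition retract_path :: "('v, 'e, 'g) graph_of_groups \<Rightarrow> ('v, 'e, 'g) piece list \<Rightarrow> ('v, 'e, 'g) piece list" where
  "retract_path G w = concat (map (retract_piece G) w)"

text \<open>The track of a point under the retraction \<open>retract_point\<close>.\<close>

definition to_vertex :: "('v, 'e, 'g) graph_of_groups \<Rightarrow> ('v, 'e) point \<Rightarrow> ('v, 'e, 'g) piece list" where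
  "to_vertex G x =
     (case x of Vert v \<Rightarrow> []
      | Mid A \<Rightarrow> (case SOME (e, a). orient G e \<and> (e, a) \<in> A of (e, a) \<Rightarrow> [Seg e a 1]))"

context graph_of_groups
begin

lemma to_vertex_Vert [simp]: "to_vertex G (Vert v) = []"
  by (simp add: to_vertex_def)

lemma to_vertex_Mid:
  assumes "e \<in> arcs (gr G)" "orient G e" "0 < a" "a < 1"
  shows "to_vertex G (edge_point G e a) = [Seg e a 1]"
proof -
  have "(SOME (d, b). orient G d \<and> (d, b) \<in> {(e, a), (erev G e, 1 - a)}) = (e, a)"
    using orient_erev[OF assms(1)] assms(2) by (intro some_equality) auto
  with assms show ?thesis
    by (simp add: to_vertex_def edge_point_def)
qed

lemma gog_path_to_vertex:
  assumes "x \<in> points G"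
  shows "gog_path G x (to_vertex G x) (Vert (retract_point G x))"
  using assms
proof (cases rule: points_cases)
  case (2 e a)
  then show ?thesis by (simp add: to_vertex_Mid retract_edge_point)
qed simp

lemma path_val_to_vertex:
  assumes "e \<in> arcs (gr G)" "orient G e" "0 \<le> a" "a \<le> 1"
  shows "path_val G (to_vertex G (edge_point G e a)) = (if a = 0 then 0 else - seg_val G e a + seg_val G e 1)"
  using assms by (cases "a = 0 \<or> a = 1") (auto simp: to_vertex_Mid path_val_Seg)

lemma path_val_retract_piece:
  assumes "piece_ok G s"
  shows "path_val G [s] + path_val G (to_vertex G (piece_end G s)) =
    path_val G (to_vertex G (piece_start G s)) + path_val G (retract_piece G s)"
proof (cases s)
  case (Seg e a b)
  with assms have e: "e \<in> arcs (gr G)" "0 \<le> a" "a < b" "b \<le> 1" by auto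
  show ?thesis
  proof (cases "orient G e")
    case True
    with e Seg show ?thesis
      by (auto simp: path_val_to_vertex path_val_Seg crosses_def add.assoc)
  next
    case False
    \<comment> \<open>The tracks run along the chosen orientation, so the segment is rewritten in
      terms of it.\<close>
    define d where "d = erev G e"
    have d: "d \<in> arcs (gr G)" "orient G d" "e = erev G d"
      using False e by (auto simp: d_def orient_erev)
    with e Seg False show ?thesis
      by (auto simp: path_val_to_vertex path_val_Seg crosses_def edge_point_erev seg_val_erev group_add_calc
          orient_erev)
  qed
qed simp

lemma gog_path_retract_piece:
  assumes "piece_ok G s"
  shows "gog_path G (Vert (retract_point G (piece_start G s))) (retract_piece G s)
    (Vert (retract_point G (piece_end G s)))"
  using assms by (cases s) (auto simp: retract_edge_point crosses_def)

lemma retract_path_simps [simp]: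
  "retract_path G [] = []" "retract_path G (s # w) = retract_piece G s @ retract_path G w"
  by (simp_all add: retract_path_def)

text \<open>Naturality of the retraction, piece by piece. It reduces paths starting inside an edge
  to paths between vertices made of group elements and whole edges.\<close>

lemma retract_path:
  assumes "gog_path G x w y"
  shows "gog_path G (Vert (retract_point G x)) (retract_path G w) (Vert (retract_point G y))" (is ?A)
    and "path_val G w + path_val G (to_vertex G y) = path_val G (to_vertex G x) + path_val G (retract_path G w)" (is ?B)
proof -
  have "?A \<and> ?B"
    using assms
  proof (induction w arbitrary: x)
    case Nil
    then have "Vert (retract_point G x) \<in> points G"
      using gog_path_to_vertex gog_path_points by blast
    with Nil show ?case by auto
  next
    case (Cons s w)
    then have s: "piece_ok G s" "piece_start G s = x" and w: "gog_path G (piece_end G s) w y" by auto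
    have "path_val G (s # w) + path_val G (to_vertex G y) =
      path_val G [s] + (path_val G w + path_val G (to_vertex G y))"
      using path_val_simps(2)[of G "[s]" w] by (simp add: add.assoc)
    also have "\<dots> = path_val G (to_vertex G x) + path_val G (retract_path G (s # w))"
      using Cons.IH[OF w] path_val_retract_piece[OF s(1)] s(2) by (simp add: add.assoc[symmetric])
    finally show ?case
      using Cons.IH[OF w] gog_path_retract_piece[OF s(1)] s(2) gog_path_append by fastforce
  qed
  then show ?A ?B
    by blast+
qed

lemma retract_path_whole: "Seg e a b \<in> set (retract_path G w) \<Longrightarrow> a = 0 \<and> b = 1"
proof (induction w)
  case (Cons s w)
  then show ?case by (cases s) (auto split: if_splits)
qed simp

end

section \<open>Lifts to the Bass--Serre tree\<close>

text \<open>The end point of the lift of \<open>u\<close>, for a path \<open>u\<close> from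
  \<open>q\<close> to \<open>y\<close>; \<open>base_lift\<close> is the case of the empty
  path.\<close>

definition lift_point ::
  "('v, 'e, 'g) graph_of_groups \<Rightarrow> ('v, 'e) point \<Rightarrow> ('v, 'e, 'g) piece list \<Rightarrow> ('v, 'e) point \<Rightarrow>
   (('v, 'e, 'g) tvert, ('v, 'e, 'g) tedge) point" where
  "lift_point G q u y =
     (case y of
        Vert v \<Rightarrow> Vert (v, coset G q v u)
      | Mid A \<Rightarrow> Mid ((\<lambda>(e, a). (lift_edge G q u e a, a)) ` A))"

lemma lift_point_Vert [simp]: "lift_point G q u (Vert v) = Vert (v, coset G q v u)"
  by (simp add: lift_point_def)

lemma base_lift_eq_lift_point: "base_lift G q = lift_point G q [] q"
  by (simp add: base_lift_def lift_point_def)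

lemma bs_tree_simps [simp]:
  "arcs (gr (bs_tree G q)) = bs_arcs G q"
  "tail (gr (bs_tree G q)) d = fst (snd d)"
  "head (gr (bs_tree G q)) d = snd (snd d)"
  "vgrp (bs_tree G q) x = singleton_group ()"
  "egrp (bs_tree G q) d = singleton_group ()"
  by (simp_all add: bs_tree_def split: prod.split)

lemma verts_bs_tree:
  "verts (gr (bs_tree G q)) = {(v, coset G q v u) | v u. v \<in> verts (gr G) \<and> gog_path G q u (Vert v)}"
  by (simp add: bs_tree_def)

lemma fst_lift_edge [simp]: "fst (lift_edge G q u e a) = e"
  by (simp add: lift_edge_def Let_def)

section \<open>Shortening of backtracks\<close>

context groups_on_graph
begin

text \<open>The bounds \<open>0 < b\<close> and \<open>c < 1\<close> exclude the coincidence of the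
  two ends of a loop.\<close>

lemma edge_point_backtrack:
  assumes "e \<in> arcs (gr G)" "0 < b" "b \<le> 1" "0 \<le> c" "c < 1" "edge_point G e b = edge_point G (erev G e) c"
  shows "c = 1 - b"
  using assms arev_neq[of e]
  by (auto simp: edge_point_def doubleton_eq_iff split: if_splits)

text \<open>The second segment starts where the first one stops, so the shorter one is absorbed. The
  cases compare how far the second segment runs back, the longer segment being split there.\<close>

lemma backtrack_shortens:
  assumes "gog_path G x [Seg e a b, Seg (erev G e) c d] y"
  shows "\<exists>w. length w \<le> 1 \<and> homotopic G x y [Seg e a b, Seg (erev G e) c d] w"
proof -
  have e: "e \<in> arcs (gr G)" "0 \<le> a" "a < b" "b \<le> 1" "0 \<le> c" "c < d" "d \<le> 1" "x = edge_point G e a"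
    "y = edge_point G (erev G e) d" and "edge_point G e b = edge_point G (erev G e) c"
    using assms by auto
  then have c: "c = 1 - b"
    by (intro edge_point_backtrack[of e]) auto
  have y: "y = edge_point G e (1 - d)"
    using e by (simp add: edge_point_erev)
  have s: "gog_path G x [Seg e a b] (edge_point G e b)"
    "gog_path G (edge_point G e b) [Seg (erev G e) c d] y"
    using assms by (auto intro: edge_point_in_points)
  have join: "homotopic G (edge_point G e r) (edge_point G e t) [Seg e r s, Seg e s t] [Seg e r t]"
    if "e \<in> arcs (gr G)" "0 \<le> r" "r < s" "s < t" "t \<le> 1" for e r s t
    using that by (intro homotopic_move elementary_move.join) (auto intro: edge_point_in_points)
  have cancel: "homotopic G (edge_point G e r) (edge_point G e r) [Seg e r s, Seg (erev G e) (1 - s) (1 - r)] []"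
    if "e \<in> arcs (gr G)" "0 \<le> r" "r < s" "s \<le> 1" for e r s
    using homotopic_rev_piece[of "Seg e r s"] that by simp
  consider "d = 1 - a" | "d < 1 - a" | "1 - a < d" by linarith
  then show ?thesis
  proof cases
    case 1
    then have "homotopic G x y [Seg e a b, Seg (erev G e) c d] []"
      using cancel[of e a b] e(1-4,8) c y by simp
    then show ?thesis by (intro exI[of _ "[]"]) simp
  next
    case 2
    have "homotopic G x (edge_point G e b) [Seg e a (1 - d), Seg e (1 - d) b] [Seg e a b]"
      using join[of e a "1 - d" b] e(1-8) c 2 by simp
    from homotopic_append[OF homotopic_sym[OF this] homotopic_refl[OF s(2)]]
    have "homotopic G x y [Seg e a b, Seg (erev G e) c d] ([Seg e a (1 - d)] @ [Seg e (1 - d) b, Seg (erev G e) c d])"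
      by simp
    also have "homotopic G x y \<dots> ([Seg e a (1 - d)] @ [])"
    proof (rule homotopic_append)
      show "homotopic G x y [Seg e a (1 - d)] [Seg e a (1 - d)]"
        using e(1-8) y 2 by (intro homotopic_refl) (auto intro: edge_point_in_points)
      show "homotopic G y y [Seg e (1 - d) b, Seg (erev G e) c d] []"
        using cancel[of e "1 - d" b] e(1-7) c y by simp
    qed
    finally show ?thesis by (intro exI[of _ "[Seg e a (1 - d)]"]) simp
  next
    case 3
    have "homotopic G (edge_point G e b) y [Seg (erev G e) c (1 - a), Seg (erev G e) (1 - a) d] [Seg (erev G e) c d]"
      using join[of "erev G e" c "1 - a" d] e(1-7,9) c 3 by (simp add: edge_point_erev)
    from homotopic_append[OF homotopic_refl[OF s(1)] homotopic_sym[OF this]]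
    have "homotopic G x y [Seg e a b, Seg (erev G e) c d] ([Seg e a b, Seg (erev G e) c (1 - a)] @ [Seg (erev G e) (1 - a) d])"
      by simp
    also have "homotopic G x y \<dots> ([] @ [Seg (erev G e) (1 - a) d])"
    proof (rule homotopic_append)
      show "homotopic G x x [Seg e a b, Seg (erev G e) c (1 - a)] []"
        using cancel[of e a b] e(1-4,8) c by simp
      show "homotopic G x y [Seg (erev G e) (1 - a) d] [Seg (erev G e) (1 - a) d]"
        using e(1-9) 3 by (intro homotopic_refl) (auto simp: edge_point_erev intro: edge_point_in_points)
    qed
    finally show ?thesis by (intro exI[of _ "[Seg (erev G e) (1 - a) d]"]) simp
  qed
qed

end

section \<open>Vertices and edges of the tree\<close>

locale pointed_graph_of_groups = graph_of_groups G for G :: "('v, 'e, 'g) graph_of_groups" +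
  fixes q :: "('v, 'e) point"
  assumes base_point: "q \<in> points G"
begin

abbreviation "T \<equiv> bs_tree G q"

lemma path_vert: "gog_path G x u (Vert v) \<Longrightarrow> v \<in> verts (gr G)"
  using gog_path_points by fastforce

lemma mem_coset_iff:
  assumes "gog_path G q u (Vert v)"
  shows "w \<in> coset G q v u \<longleftrightarrow>
    gog_path G q w (Vert v) \<and> (\<exists>g \<in> carrier (vgrp G v). path_val G w = path_val G u + elt_val G v g)"
proof -
  have "gog_path G q (u @ [Elt v g]) (Vert v)" if "g \<in> carrier (vgrp G v)" for g
    using assms that path_vert by (auto simp: gog_path_append)
  then show ?thesis
    using homotopic_iff_path_val[of q w "Vert v"] unfolding coset_def
    by (fastforce simp: homotopic_def)
qed

lemma coset_subset:
  assumes u: "gog_path G q u (Vert v)" and u': "gog_path G q u' (Vert v)"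
    and g: "g \<in> carrier (vgrp G v)" "path_val G u' = path_val G u + elt_val G v g"
  shows "coset G q v u' \<subseteq> coset G q v u"
proof
  fix w assume "w \<in> coset G q v u'"
  then obtain h where w: "gog_path G q w (Vert v)" "h \<in> carrier (vgrp G v)"
    "path_val G w = path_val G u' + elt_val G v h"
    using mem_coset_iff[OF u'] by blast
  interpret group "vgrp G v" using group_vgrp path_vert[OF u] by blast
  have "path_val G w = path_val G u + elt_val G v (g \<otimes>\<^bsub>vgrp G v\<^esub> h)"
    using w g path_vert[OF u] by (simp add: elt_val_mult add.assoc)
  with w g show "w \<in> coset G q v u"
    using mem_coset_iff[OF u] by blast
qed

lemma coset_eq_iff:
  assumes u: "gog_path G q u (Vert v)" and u': "gog_path G q u' (Vert v)"
  shows "coset G q v u = coset G q v u' \<longleftrightarrow>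
    (\<exists>g \<in> carrier (vgrp G v). path_val G u' = path_val G u + elt_val G v g)"
proof
  interpret group "vgrp G v" using group_vgrp path_vert[OF u] by blast
  {
    assume eq: "coset G q v u = coset G q v u'"
    have "path_val G u' = path_val G u' + elt_val G v \<one>\<^bsub>vgrp G v\<^esub>"
      using path_vert[OF u] by simp
    then have "u' \<in> coset G q v u"
      using mem_coset_iff[OF u'] u' eq one_closed by blast
    then show "\<exists>g \<in> carrier (vgrp G v). path_val G u' = path_val G u + elt_val G v g"
      using mem_coset_iff[OF u] by blast
  next
    assume "\<exists>g \<in> carrier (vgrp G v). path_val G u' = path_val G u + elt_val G v g"
    then obtain g where g: "g \<in> carrier (vgrp G v)" "path_val G u' = path_val G u + elt_val G v g"
      by blast
    then have "path_val G u = path_val G u' + elt_val G v (inv\<^bsub>vgrp G v\<^esub> g)"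
      using path_vert[OF u] by (simp add: elt_val_inv add.assoc)
    then show "coset G q v u = coset G q v u'"
      using coset_subset[OF u u' g] coset_subset[OF u' u] g(1) by blast
  }
qed

lemma coset_cong:
  assumes "gog_path G q u (Vert v)" "gog_path G q u' (Vert v)" "path_val G u = path_val G u'"
  shows "coset G q v u = coset G q v u'"
proof -
  interpret group "vgrp G v" using group_vgrp path_vert[OF assms(1)] by blast
  have "path_val G u' = path_val G u + elt_val G v \<one>\<^bsub>vgrp G v\<^esub>"
    using path_vert[OF assms(1)] assms(3) by simp
  then show ?thesis
    using coset_eq_iff[OF assms(1,2)] one_closed by blast
qed

lemma lift_edge_ends:
  assumes "e \<in> arcs (gr G)" "0 \<le> a" "a \<le> 1" "gog_path G q u (edge_point G e a)"
  shows "\<exists>s t. lift_edge G q u e a = (e, (tail (gr G) e, coset G q (tail (gr G) e) s),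
      (head (gr G) e, coset G q (head (gr G) e) t)) \<and>
    gog_path G q s (Vert (tail (gr G) e)) \<and> path_val G s = path_val G u + - seg_val G e a \<and>
    gog_path G q t (Vert (head (gr G) e)) \<and> path_val G t = path_val G u + - seg_val G e a + seg_val G e 1"
proof (intro exI conjI)
  show "lift_edge G q u e a = (e,
      (tail (gr G) e, coset G q (tail (gr G) e) (u @ (if a = 0 then [] else [Seg (erev G e) (1 - a) 1]))),
      (head (gr G) e, coset G q (head (gr G) e) (u @ (if a = 1 then [] else [Seg e a 1]))))"
    by (simp add: lift_edge_def Let_def)
qed (use assms in \<open>auto simp: gog_path_append edge_point_erev path_val_Seg seg_val_erev group_add_calc\<close>)

text \<open>An edge of the tree is recorded by its two ends, so equality yields one vertex group
  element at each end. By \<open>seg_val_commute\<close> both come from a single element of the edge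
  group: stabilisers of edges are edge groups.\<close>

lemma lift_edge_eq_iff:
  assumes e: "e \<in> arcs (gr G)"
    and a: "0 \<le> a" "a \<le> 1" "gog_path G q u (edge_point G e a)"
    and b: "0 \<le> b" "b \<le> 1" "gog_path G q u' (edge_point G e b)"
  shows "lift_edge G q u e a = lift_edge G q u' e b \<longleftrightarrow>
    (\<exists>k \<in> carrier (egrp G e). path_val G u' + - seg_val G e b =
      path_val G u + - seg_val G e a + elt_val G (tail (gr G) e) (inc G (erev G e) k))"
proof -
  obtain s t where st: "lift_edge G q u e a = (e, (tail (gr G) e, coset G q (tail (gr G) e) s),
      (head (gr G) e, coset G q (head (gr G) e) t))"
    "gog_path G q s (Vert (tail (gr G) e))" "path_val G s = path_val G u + - seg_val G e a"
    "gog_path G q t (Vert (head (gr G) e))" "path_val G t = path_val G u + - seg_val G e a + seg_val G e 1"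
    using lift_edge_ends[OF e a] by blast
  obtain s' t' where st': "lift_edge G q u' e b = (e, (tail (gr G) e, coset G q (tail (gr G) e) s'),
      (head (gr G) e, coset G q (head (gr G) e) t'))"
    "gog_path G q s' (Vert (tail (gr G) e))" "path_val G s' = path_val G u' + - seg_val G e b"
    "gog_path G q t' (Vert (head (gr G) e))" "path_val G t' = path_val G u' + - seg_val G e b + seg_val G e 1"
    using lift_edge_ends[OF e b] by blast
  let ?v = "tail (gr G) e" and ?w = "head (gr G) e"
  have "lift_edge G q u e a = lift_edge G q u' e b \<longleftrightarrow>
    (\<exists>m \<in> carrier (vgrp G ?v). path_val G s' = path_val G s + elt_val G ?v m) \<and>
    (\<exists>n \<in> carrier (vgrp G ?w). path_val G t' = path_val G t + elt_val G ?w n)"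
    using st st' coset_eq_iff by simp
  also have "\<dots> \<longleftrightarrow> (\<exists>k \<in> carrier (egrp G e). path_val G s' = path_val G s + elt_val G ?v (inc G (erev G e) k))"
  proof
    assume "(\<exists>m \<in> carrier (vgrp G ?v). path_val G s' = path_val G s + elt_val G ?v m) \<and>
      (\<exists>n \<in> carrier (vgrp G ?w). path_val G t' = path_val G t + elt_val G ?w n)"
    then obtain m n where mn: "m \<in> carrier (vgrp G ?v)" "path_val G s' = path_val G s + elt_val G ?v m"
      "n \<in> carrier (vgrp G ?w)" "path_val G t' = path_val G t + elt_val G ?w n" by blast
    have t: "path_val G t = path_val G s + seg_val G e 1" "path_val G t' = path_val G s' + seg_val G e 1"
      using st st' by simp_all
    have "elt_val G ?v m + seg_val G e 1 = seg_val G e 1 + elt_val G ?w n"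
      using mn(2,4) unfolding t by (simp add: add.assoc)
    then show "\<exists>k \<in> carrier (egrp G e). path_val G s' = path_val G s + elt_val G ?v (inc G (erev G e) k)"
      using seg_val_commute[OF e mn(1,3)] mn(2) by blast
  next
    assume "\<exists>k \<in> carrier (egrp G e). path_val G s' = path_val G s + elt_val G ?v (inc G (erev G e) k)"
    then obtain k where k: "k \<in> carrier (egrp G e)"
      "path_val G s' = path_val G s + elt_val G ?v (inc G (erev G e) k)" by blast
    have t: "path_val G t = path_val G s + seg_val G e 1" "path_val G t' = path_val G s' + seg_val G e 1"
      using st st' by simp_all
    have "path_val G t' = path_val G t + elt_val G ?w (inc G e k)"
      using k(2) seg_val_slide[OF e k(1)] unfolding t by (simp add: add.assoc)
    with k show "(\<exists>m \<in> carrier (vgrp G ?v). path_val G s' = path_val G s + elt_val G ?v m) \<and>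
      (\<exists>n \<in> carrier (vgrp G ?w). path_val G t' = path_val G t + elt_val G ?w n)"
      using inc_closed[OF e] inc_erev_closed[OF e] by blast
  qed
  finally show ?thesis
    using st(3) st'(3) by simp
qed

lemma lift_edge_cong:
  assumes e: "e \<in> arcs (gr G)"
    and a: "0 \<le> a" "a \<le> 1" "gog_path G q u (edge_point G e a)"
    and b: "0 \<le> b" "b \<le> 1" "gog_path G q u' (edge_point G e b)"
    and "path_val G u' + - seg_val G e b = path_val G u + - seg_val G e a"
  shows "lift_edge G q u e a = lift_edge G q u' e b"
proof -
  interpret i: group_hom "egrp G e" "vgrp G (tail (gr G) e)" "inc G (erev G e)"
    using inc_in_hom[of "erev G e"] e group_egrp group_vgrp
    by (auto simp: egrp_rev group_hom_def group_hom_axioms_def)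
  show ?thesis
    using assms by (subst lift_edge_eq_iff) (auto intro!: bexI[of _ "\<one>\<^bsub>egrp G e\<^esub>"])
qed

lemma lift_edge_in_arcs:
  assumes "e \<in> arcs (gr G)" "0 \<le> a" "a \<le> 1" "gog_path G q u (edge_point G e a)"
  shows "lift_edge G q u e a \<in> bs_arcs G q"
proof -
  \<comment> \<open>The path is run back to the tail of \<open>e\<close>, since
    \<open>bs_arcs\<close> lists lifts through the tail.\<close>
  define s where "s = u @ (if a = 0 then [] else [Seg (erev G e) (1 - a) 1])"
  have s: "gog_path G q s (Vert (tail (gr G) e))" "path_val G s = path_val G u + - seg_val G e a"
    using assms by (auto simp: s_def gog_path_append edge_point_erev path_val_Seg seg_val_erev group_add_calc)
  then have "lift_edge G q u e a = lift_edge G q s e 0"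
    using assms by (intro lift_edge_cong) auto
  also have "\<dots> \<in> bs_arcs G q"
    using s assms(1) by (auto simp: lift_edge_def Let_def bs_arcs_def)
  finally show ?thesis .
qed

lemma bs_arcs_cases:
  assumes "d \<in> bs_arcs G q"
  obtains e u where "e \<in> arcs (gr G)" "gog_path G q u (Vert (tail (gr G) e))" "d = lift_edge G q u e 0"
  using assms by (auto simp: bs_arcs_def lift_edge_def Let_def)

lemma bs_arcs_cases_mid:
  assumes "d \<in> bs_arcs G q" "0 \<le> a" "a \<le> 1"
  obtains e u where "e \<in> arcs (gr G)" "gog_path G q u (edge_point G e a)" "d = lift_edge G q u e a"
proof -
  obtain e u where u: "e \<in> arcs (gr G)" "gog_path G q u (Vert (tail (gr G) e))" "d = lift_edge G q u e 0"
    using assms(1) by (rule bs_arcs_cases)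
  let ?u = "u @ (if a = 0 then [] else [Seg e 0 a])"
  have "gog_path G q ?u (edge_point G e a)"
    using u assms by (auto simp: gog_path_append edge_point_in_points)
  moreover from this have "d = lift_edge G q ?u e a"
    using u assms by (auto intro!: lift_edge_cong simp: path_val_Seg add.assoc)
  ultimately show thesis
    using that u(1) by blast
qed

lemma erev_bs_tree_lift_edge:
  assumes "e \<in> arcs (gr G)" "0 \<le> a" "a \<le> 1" "gog_path G q u (edge_point G e a)"
  shows "erev T (lift_edge G q u e a) = lift_edge G q u (erev G e) (1 - a)"
  using lift_edge_in_arcs[OF assms] assms(1) by (auto simp: bs_tree_def lift_edge_def Let_def)

sublocale tree: groups_on_graph T
proof (intro groups_on_graph.intro groups_on_graph_axioms.intro)
  have wf: "wf_digraph (gr T)"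
  proof
    fix d assume "d \<in> arcs (gr T)"
    then have "d \<in> bs_arcs G q" by simp
    then obtain e u where "e \<in> arcs (gr G)" "gog_path G q u (Vert (tail (gr G) e))" "d = lift_edge G q u e 0"
      by (rule bs_arcs_cases)
    then show "tail (gr T) d \<in> verts (gr T)"
      "head (gr T) d \<in> verts (gr T)"
      using lift_edge_ends[of e 0 u] unfolding verts_bs_tree by force+
  qed
  show "bidirected_digraph (gr T) (erev T)"
  proof (rule wf_digraph.bidirected_digraphI[OF wf])
    fix d
    {
      assume "d \<notin> arcs (gr T)"
      then show "erev T d = d"
        by (auto simp: bs_tree_def split: prod.split)
    next
      assume "d \<in> arcs (gr T)"
      then have "d \<in> bs_arcs G q" by simp
      then obtain e u where d: "e \<in> arcs (gr G)" "gog_path G q u (edge_point G e 0)" "d = lift_edge G q u e 0"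
        by (rule bs_arcs_cases_mid[where a = 0]) simp_all
      then have rev: "erev T d = lift_edge G q u (erev G e) 1"
        using erev_bs_tree_lift_edge[of e 0 u] by simp
      show "erev T d \<noteq> d"
        using rev d arev_neq[of e] by (auto simp: lift_edge_def Let_def)
      show "erev T (erev T d) = d"
        using rev d erev_bs_tree_lift_edge[of "erev G e" 1 u] by (simp add: edge_point_erev)
      show "tail (gr T) (erev T d) = head (gr T) d"
        using rev d by (simp add: lift_edge_def Let_def)
    }
  qed
qed (auto simp: bs_tree_def hom_def)

section \<open>Lifts of points and of paths\<close>

lemma lift_point_edge_point:
  assumes "e \<in> arcs (gr G)" "0 \<le> a" "a \<le> 1" "gog_path G q u (edge_point G e a)"
  shows "lift_point G q u (edge_point G e a) = edge_point T (lift_edge G q u e a) a"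
proof -
  consider "a = 0" | "a = 1" | "0 < a" "a < 1" using assms by linarith
  then show ?thesis
  proof cases
    case 3
    then show ?thesis
      by (simp add: lift_point_def edge_point_Mid erev_bs_tree_lift_edge[OF assms])
  qed (simp_all add: lift_edge_def Let_def)
qed

lemma lift_point_cong:
  assumes u: "gog_path G q u y" and u': "gog_path G q u' y" and eq: "path_val G u = path_val G u'"
  shows "lift_point G q u y = lift_point G q u' y"
proof -
  have "y \<in> points G" using u gog_path_points by blast
  then show ?thesis
  proof (cases rule: points_cases)
    case (1 v)
    then show ?thesis using assms coset_cong[of u v u'] by simp
  next
    case (2 e a)
    with assms lift_edge_cong[of e a u a u'] show ?thesis
      by (simp add: lift_point_edge_point)
  qed
qed

lemma coset_Elt:
  assumes "gog_path G q u (Vert v)" "g \<in> carrier (vgrp G v)"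
  shows "coset G q v (u @ [Elt v g]) = coset G q v u"
proof -
  have "gog_path G q (u @ [Elt v g]) (Vert v)"
    using assms path_vert by (auto simp: gog_path_append)
  with assms coset_eq_iff[of u v "u @ [Elt v g]"] show ?thesis by auto
qed

lemma lift_edge_Seg:
  assumes "e \<in> arcs (gr G)" "0 \<le> a" "a < b" "b \<le> 1" "gog_path G q u (edge_point G e a)"
  shows "lift_edge G q (u @ [Seg e a b]) e b = lift_edge G q u e a"
proof -
  have "gog_path G q (u @ [Seg e a b]) (edge_point G e b)"
    using assms by (auto simp: gog_path_append edge_point_in_points)
  with assms show ?thesis
    by (intro lift_edge_cong) (auto simp: path_val_Seg group_add_calc)
qed

lemma lift_path_path:
  assumes "gog_path G q u x" "gog_path G x w y"
  shows "gog_path T (lift_point G q u x) (lift_path G q u w) (lift_point G q (u @ w) y)"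
  using assms
proof (induction w arbitrary: u x)
  case Nil
  then have "x \<in> points G" by auto
  then have "lift_point G q u x \<in> points T"
  proof (cases rule: points_cases)
    case (1 v)
    with Nil show ?thesis by (auto simp: verts_bs_tree)
  next
    case (2 e a)
    with Nil show ?thesis
      by (auto simp: lift_point_edge_point lift_edge_in_arcs intro!: tree.edge_point_in_points)
  qed
  with Nil show ?case by auto
next
  case (Cons s w)
  then have s: "piece_ok G s" "piece_start G s = x" and w: "gog_path G (piece_end G s) w y" by auto
  then have us: "gog_path G q (u @ [s]) (piece_end G s)"
    using Cons.prems(1) piece_points by (auto simp: gog_path_append)
  show ?case
  proof (cases s)
    case (Elt v g)
    with Cons.IH[OF us w] s Cons.prems show ?thesis
      by (auto simp: coset_Elt)
  next
    case (Seg e a b)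
    with s Cons.prems have e: "e \<in> arcs (gr G)" "0 \<le> a" "a < b" "b \<le> 1" "gog_path G q u (edge_point G e a)"
      by auto
    then have "lift_point G q (u @ [Seg e a b]) (edge_point G e b) =
        edge_point T (lift_edge G q u e a) b"
      using us Seg by (simp add: lift_point_edge_point lift_edge_Seg)
    with Cons.IH[OF us w] Seg s e show ?thesis
      by (auto simp: lift_point_edge_point lift_edge_in_arcs)
  qed
qed

lemma base_lift_to_lift_point:
  "gog_path G q u y \<Longrightarrow> gog_path T (base_lift G q) (lift_path G q [] u) (lift_point G q u y)"
  using lift_path_path[of "[]" q u y] base_point by (simp add: base_lift_eq_lift_point)

text \<open>Statements about points of the tree thereby become statements about paths from
  \<open>q\<close>.\<close>

lemma points_bs_tree_cases:
  assumes "x \<in> points T"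
  obtains u y where "gog_path G q u y" "x = lift_point G q u y"
  using assms
proof (cases rule: tree.points_cases)
  case (1 v)
  then show ?thesis using that by (force simp: verts_bs_tree)
next
  case (2 d a)
  then obtain e u where "e \<in> arcs (gr G)" "gog_path G q u (edge_point G e a)" "d = lift_edge G q u e a"
    by (auto elim: bs_arcs_cases_mid[of d a])
  with 2 that show ?thesis
    by (metis lift_point_edge_point less_imp_le)
qed

text \<open>An interior point has two descriptions, and \<open>point_group_loops\<close> attaches
  the edge group from either end of the edge. The slide relation carries the second form into the
  first.\<close>

lemma point_group_loops_edge_point:
  assumes "e \<in> arcs (gr G)" "0 < a" "a < 1" "c \<in> point_group_loops G (edge_point G e a)"
  shows "gog_path G (edge_point G e a) c (edge_point G e a) \<and>
    (\<exists>h \<in> carrier (egrp G e). path_val G c =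
      - seg_val G e a + elt_val G (tail (gr G) e) (inc G (erev G e) h) + seg_val G e a)"
proof -
  have *: "gog_path G (edge_point G e a) c (edge_point G e a)"
    "path_val G c = - seg_val G e a + elt_val G (tail (gr G) e) (inc G (erev G e) h) + seg_val G e a"
    if "e \<in> arcs (gr G)" "0 < a" "a < 1" "h \<in> carrier (egrp G e)"
      "c = [Seg (erev G e) (1 - a) 1, Elt (tail (gr G) e) (inc G (erev G e) h), Seg e 0 a]"
    for e a h
    using that
    by (auto simp: path_val_Seg seg_val_erev edge_point_erev edge_point_in_points inc_erev_closed group_add_calc)
  from assms obtain d b h where d: "(d, b) = (e, a) \<or> (d, b) = (erev G e, 1 - a)" "h \<in> carrier (egrp G d)"
    "c = [Seg (erev G d) (1 - b) 1, Elt (tail (gr G) d) (inc G (erev G d) h), Seg d 0 b]"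
    by (auto simp: point_group_loops_def edge_point_Mid)
  from d(1) show ?thesis
  proof
    assume "(d, b) = (e, a)"
    then have "d = e" "b = a" by simp_all
    with *[of e a h] d(2,3) assms(1-3) show ?thesis by blast
  next
    assume "(d, b) = (erev G e, 1 - a)"
    then have db: "d = erev G e" "b = 1 - a" by simp_all
    have h: "h \<in> carrier (egrp G e)"
      using d(2) assms(1) db by (simp add: egrp_rev)
    have "gog_path G (edge_point G e a) c (edge_point G e a)"
      using *(1)[of d b h] d(2,3) assms(1-3) by (simp add: db edge_point_erev)
    moreover have "path_val G c = - seg_val G e a +
        (seg_val G e 1 + elt_val G (head (gr G) e) (inc G e h) + - seg_val G e 1) + seg_val G e a"
      using *(2)[of d b h] d(2,3) assms(1-3) by (simp add: db seg_val_erev group_add_calc)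
    ultimately show ?thesis
      using h unfolding seg_val_slide[OF assms(1) h] by (auto simp: add.assoc)
  qed
qed

text \<open>This is what turns commutation of the square, with its indeterminacy at the end point,
  into an equality of points of the tree. At a vertex it is \<open>coset_eq_iff\<close>, inside an
  edge \<open>lift_edge_eq_iff\<close> conjugated by the initial segment.\<close>

lemma lift_point_eq_iff:
  assumes u: "gog_path G q u y" and u': "gog_path G q u' y"
  shows "lift_point G q u y = lift_point G q u' y \<longleftrightarrow>
    (\<exists>c \<in> point_group_loops G y. homotopic G q y u' (u @ c))"
proof -
  have "y \<in> points G" using u gog_path_points by blast
  then show ?thesis
  proof (cases rule: points_cases)
    case (1 v)
    have "gog_path G q (u @ [Elt v g]) (Vert v)" if "g \<in> carrier (vgrp G v)" for g
      using u 1 that by (auto simp: gog_path_append)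
    with assms 1 coset_eq_iff[of u v u'] show ?thesis
      by (auto simp: point_group_loops_def homotopic_iff_path_val)
  next
    case (2 e a)
    have path: "gog_path G q (u @ c) y" if "c \<in> point_group_loops G y" for c
      using point_group_loops_edge_point[of e a c] 2 that u by (auto simp: gog_path_append)
    \<comment> \<open>The two edges lie over opposite orientations of \<open>e\<close>. So equality
      of the interior points can only match \<open>e\<close> with \<open>e\<close>, even at
      parameter 1/2.\<close>
    have "erev T (lift_edge G q u' e a) \<noteq> lift_edge G q u e a"
      using 2 u' arev_neq[of e] by (simp add: erev_bs_tree_lift_edge) (metis fst_lift_edge)
    then have "lift_point G q u y = lift_point G q u' y \<longleftrightarrow> lift_edge G q u e a = lift_edge G q u' e a"
      using 2 u u' lift_point_edge_point[of e a u] lift_point_edge_point[of e a u']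
      by (auto simp: edge_point_Mid[of a T] doubleton_eq_iff)
    also have "\<dots> \<longleftrightarrow> (\<exists>h \<in> carrier (egrp G e). path_val G u' + - seg_val G e a =
      path_val G u + - seg_val G e a + elt_val G (tail (gr G) e) (inc G (erev G e) h))"
      using assms 2 by (intro lift_edge_eq_iff) auto
    also have "\<dots> \<longleftrightarrow> (\<exists>h \<in> carrier (egrp G e). path_val G u' = path_val G u +
      (- seg_val G e a + elt_val G (tail (gr G) e) (inc G (erev G e) h) + seg_val G e a))"
      by (simp add: add_neg_eq_iff add.assoc)
    also have "\<dots> \<longleftrightarrow> (\<exists>c \<in> point_group_loops G y. path_val G u' = path_val G u + path_val G c)"
    proof
      assume "\<exists>h \<in> carrier (egrp G e). path_val G u' = path_val G u +
        (- seg_val G e a + elt_val G (tail (gr G) e) (inc G (erev G e) h) + seg_val G e a)"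
      then obtain h where h: "h \<in> carrier (egrp G e)" "path_val G u' = path_val G u +
        (- seg_val G e a + elt_val G (tail (gr G) e) (inc G (erev G e) h) + seg_val G e a)" by blast
      let ?c = "[Seg (erev G e) (1 - a) 1, Elt (tail (gr G) e) (inc G (erev G e) h), Seg e 0 a]"
      have "?c \<in> point_group_loops G y"
        using 2 h by (auto simp: point_group_loops_def edge_point_Mid)
      moreover have "path_val G u' = path_val G u + path_val G ?c"
        using 2 h by (simp add: path_val_Seg seg_val_erev group_add_calc)
      ultimately show "\<exists>c \<in> point_group_loops G y. path_val G u' = path_val G u + path_val G c"
        by blast
    next
      assume "\<exists>c \<in> point_group_loops G y. path_val G u' = path_val G u + path_val G c"
      then show "\<exists>h \<in> carrier (egrp G e). path_val G u' = path_val G u +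
        (- seg_val G e a + elt_val G (tail (gr G) e) (inc G (erev G e) h) + seg_val G e a)"
        using point_group_loops_edge_point[of e a] 2 by fastforce
    qed
    also have "\<dots> \<longleftrightarrow> (\<exists>c \<in> point_group_loops G y. homotopic G q y u' (u @ c))"
      using homotopic_iff_path_val[OF u' path] by simp
    finally show ?thesis .
  qed
qed

section \<open>The action of the fundamental group on lifts\<close>

lemma act_vert_coset:
  assumes h: "gog_path G q h q" and u: "gog_path G q u (Vert v)"
  shows "act_vert G q (hclass G q q h) (v, coset G q v u) = (v, coset G q v (h @ u))"
proof -
  have "coset G q v (h' @ u') = coset G q v (h @ u)" if h'_in: "h' \<in> hclass G q q h" and u'_in: "u' \<in> coset G q v u" for h' u'
  proof -
    have hh: "homotopic G q q h h'"
      using h'_in by (simp add: hclass_def)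
    then have "gog_path G q h' q" by (simp add: homotopic_def)
    with hh have h': "gog_path G q h' q" "path_val G h' = path_val G h"
      using homotopic_iff_path_val[OF h, of h'] by simp_all
    obtain g where g: "gog_path G q u' (Vert v)" "g \<in> carrier (vgrp G v)" "path_val G u' = path_val G u + elt_val G v g"
      using u'_in mem_coset_iff[OF u] by blast
    have "gog_path G q (h @ u) (Vert v)" "gog_path G q (h' @ u') (Vert v)"
      using h h' u g by (auto simp: gog_path_append)
    moreover have "path_val G (h' @ u') = path_val G (h @ u) + elt_val G v g"
      using h' g by (simp add: add.assoc)
    ultimately show ?thesis
      using coset_eq_iff[of "h @ u" v "h' @ u'"] g(2) by blast
  qed
  then have "(\<Union>h'\<in>hclass G q q h. \<Union>u'\<in>coset G q v u. coset G q v (h' @ u')) =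
    (\<Union>h'\<in>hclass G q q h. \<Union>u'\<in>coset G q v u. coset G q v (h @ u))"
    by simp
  also have "\<dots> = coset G q v (h @ u)"
  proof -
    interpret group "vgrp G v" using group_vgrp path_vert[OF u] by blast
    have "path_val G u = path_val G u + elt_val G v \<one>\<^bsub>vgrp G v\<^esub>"
      using path_vert[OF u] by simp
    then have "u \<in> coset G q v u"
      using mem_coset_iff[OF u] u one_closed by blast
    then show ?thesis
      using hclass_self[OF h] by auto
  qed
  finally show ?thesis
    by (simp add: act_vert_def)
qed

lemma act_edge_lift_edge:
  assumes "e \<in> arcs (gr G)" "0 \<le> a" "a \<le> 1" "gog_path G q u (edge_point G e a)" "gog_path G q h q"
  shows "act_edge G q (hclass G q q h) (lift_edge G q u e a) = lift_edge G q (h @ u) e a"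
proof -
  let ?s = "u @ (if a = 0 then [] else [Seg (erev G e) (1 - a) 1])"
    and ?t = "u @ (if a = 1 then [] else [Seg e a 1])"
  have "gog_path G q ?s (Vert (tail (gr G) e))" "gog_path G q ?t (Vert (head (gr G) e))"
    using assms by (auto simp: gog_path_append edge_point_erev)
  then show ?thesis
    unfolding act_edge_def lift_edge_def Let_def using act_vert_coset[OF assms(5)] by simp
qed

lemma act_point_lift_point:
  assumes u: "gog_path G q u y" and h: "gog_path G q h q"
  shows "act_point G q (hclass G q q h) (lift_point G q u y) = lift_point G q (h @ u) y"
proof -
  have "y \<in> points G" using u gog_path_points by blast
  then show ?thesis
  proof (cases rule: points_cases)
    case (1 v)
    with assms show ?thesis by (simp add: act_point_def act_vert_coset)
  next
    case (2 e a)
    then have "gog_path G q u (edge_point G e a)" "gog_path G q u (edge_point G (erev G e) (1 - a))"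
      using u by (auto simp: edge_point_erev)
    with 2 act_edge_lift_edge[of e a u h] act_edge_lift_edge[of "erev G e" "1 - a" u h] h show ?thesis
      by (simp add: act_point_def edge_point_Mid lift_point_def)
  qed
qed

text \<open>A path that is not tight contains a trivial group element or a backtrack, and either can
  be replaced by something shorter.\<close>

lemma homotopic_tight:
  assumes "gog_path T x w y"
  shows "\<exists>w'. tight_tree_path T x w' y \<and> homotopic T x y w w'"
  using assms
proof (induction "length w" arbitrary: w rule: less_induct)
  case less
  have shorter: ?case if lcr: "w = l @ c @ r" and len: "length d < length c"
    and cd: "homotopic T z z' c d"
    and lr: "gog_path T x l z" "gog_path T z' r y" for l c r d z z'
  proof -
    have w: "homotopic T x y w (l @ d @ r)"
      using lcr tree.homotopic_context[OF lr(1) cd lr(2)] by simp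
    then have "gog_path T x (l @ d @ r) y"
      by (simp add: homotopic_def)
    moreover have "length (l @ d @ r) < length w"
      using lcr len by simp
    ultimately obtain w' where "tight_tree_path T x w' y" "homotopic T x y (l @ d @ r) w'"
      using less.hyps[of "l @ d @ r"] by blast
    with w show ?thesis
      using tree.homotopic_trans by blast
  qed
  consider v g where "Elt v g \<in> set w"
    | l e a b c d r where "w = l @ [Seg e a b, Seg (erev T e) c d] @ r"
    | "\<forall>s \<in> set w. \<exists>e a b. s = Seg e a b"
      "\<not> (\<exists>l r e a b c d. w = l @ [Seg e a b, Seg (erev T e) c d] @ r)"
  proof (cases "\<exists>v g. Elt v g \<in> set w")
    case True
    then show ?thesis using that(1) by blast
  next
    case False
    have "\<exists>e a b. s = Seg e a b" if "s \<in> set w" for s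
    proof (cases s)
      case (Elt v g)
      with that False show ?thesis by blast
    qed blast
    then show ?thesis using that(2,3) by blast
  qed
  then show ?case
  proof cases
    case (1 v g)
    then obtain l r where lr: "w = l @ [Elt v ()] @ r"
      using split_list[of "Elt v g" w] by auto
    then have v: "v \<in> verts (gr T)" "gog_path T x l (Vert v)"
      "gog_path T (Vert v) r y" "gog_path T (Vert v) [Elt v ()] (Vert v)"
      using less.prems by (auto simp: tree.gog_path_append)
    have "homotopic T (Vert v) (Vert v) [Elt v ()] []"
      using elementary_move.unit[OF v(1)] v by (intro tree.homotopic_move) (auto simp: singleton_group_def)
    then show ?thesis
      using shorter[OF lr _ _ v(2,3)] by simp
  next
    case (2 l e a b c d r)
    then have "gog_path T x (l @ [Seg e a b, Seg (erev T e) c d] @ r) y"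
      using less.prems by simp
    then obtain z z' where z: "gog_path T x l z" "gog_path T z' r y"
      "gog_path T z [Seg e a b, Seg (erev T e) c d] z'"
      unfolding tree.gog_path_append by blast
    obtain t where t: "length t \<le> 1"
      "homotopic T z z' [Seg e a b, Seg (erev T e) c d] t"
      using tree.backtrack_shortens[OF z(3)] by blast
    show ?thesis
      using shorter[OF 2 _ t(2) z(1,2)] t(1) by simp
  next
    case 3
    then show ?thesis
      using less.prems tree.homotopic_refl unfolding tight_tree_path_def by blast
  qed
qed

end

text \<open>At 1/2 an edge and its reverse have the same point; any other interior parameter, such
  as 1/3, remembers the orientation.\<close>

lemma (in groups_on_graph) edge_point_third_inj:
  assumes "e \<in> arcs (gr G)" "edge_point G e (1 / 3) = edge_point G d (1 / 3)"
  shows "e = d"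
  using assms by (auto simp: edge_point_def doubleton_eq_iff)

lemma (in groups_on_graph) edge_point_eqD:
  assumes "0 < a" "a < 1" "edge_point G e a = edge_point G d b"
  shows "d = e \<and> b = a \<or> e = erev G d \<and> b = 1 - a"
proof -
  have "b \<noteq> 0" "b \<noteq> 1"
    using assms by (auto simp: edge_point_def)
  with assms have "(e, a) \<in> {(d, b), (erev G d, 1 - b)}"
    by (auto simp: edge_point_def)
  then show ?thesis by auto
qed

section \<open>Covering projections\<close>

locale covering = pointed_graph_of_groups G q
  for G :: "('v, 'e, 'g) graph_of_groups" and q :: "('v, 'e) point" +
  fixes \<pi> :: "(('v, 'e, 'g) tvert, ('v, 'e, 'g) tedge, unit, 'v, 'e, 'g) gog_map"
  assumes covering: "covering_projection G q \<pi>"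

sublocale covering \<subseteq> proj: gog_hom "bs_tree G q" G \<pi>
  using covering by unfold_locales (simp add: covering_projection_def)

context covering
begin

lemma vmap_proj: "x \<in> verts (gr (bs_tree G q)) \<Longrightarrow> vmap \<pi> x = fst x"
  using covering by (simp add: covering_projection_def)

lemma emap_proj: "d \<in> bs_arcs G q \<Longrightarrow> emap \<pi> d = Inr (fst d)"
  using covering by (simp add: covering_projection_def)

lemma point_map_lift_point:
  assumes u: "gog_path G q u y"
  shows "point_map \<pi> (lift_point G q u y) = y"
proof -
  have "y \<in> points G" using u gog_path_points by blast
  then show ?thesis
  proof (cases rule: points_cases)
    case (1 v)
    with u have "(v, coset G q v u) \<in> verts (gr (bs_tree G q))" by (auto simp: verts_bs_tree)
    with 1 vmap_proj show ?thesis by simp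
  next
    case (2 e a)
    with u lift_edge_in_arcs[of e a u] have "lift_edge G q u e a \<in> bs_arcs G q" by simp
    with 2 u show ?thesis
      by (simp add: lift_point_edge_point proj.point_map_edge_point emap_proj)
  qed
qed

text \<open>The lifting property is given for tight paths. Any path is homotopic to a tight one with
  the same end, and homotopic paths have projections of equal value, whose lifts end at the same
  point.\<close>

lemma lift_point_proj:
  assumes w: "gog_path (bs_tree G q) (base_lift G q) w x"
  shows "gog_path G q (gog_map_path (bs_tree G q) G \<pi> w) (point_map \<pi> x)"
    and "lift_point G q (gog_map_path (bs_tree G q) G \<pi> w) (point_map \<pi> x) = x"
proof -
  let ?proj = "gog_map_path (bs_tree G q) G \<pi>"
  have base: "point_map \<pi> (base_lift G q) = q"
    using point_map_lift_point[of "[]" q] base_point by (simp add: base_lift_eq_lift_point)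
  show w': "gog_path G q (?proj w) (point_map \<pi> x)"
    using proj.gog_map_path_path[OF w] by (simp add: base)
  obtain t where t: "tight_tree_path (bs_tree G q) (base_lift G q) t x"
    "homotopic (bs_tree G q) (base_lift G q) x w t"
    using homotopic_tight[OF w] by blast
  then have path: "gog_path (bs_tree G q) (base_lift G q) t x" and "lift_path G q [] (?proj t) = t"
    using covering by (auto simp: tight_tree_path_def covering_projection_def)
  moreover have t': "gog_path G q (?proj t) (point_map \<pi> x)"
    using proj.gog_map_path_path[OF path] by (simp add: base)
  ultimately have "gog_path (bs_tree G q) (base_lift G q) t (lift_point G q (?proj t) (point_map \<pi> x))"
    using base_lift_to_lift_point by metis
  with path have "lift_point G q (?proj t) (point_map \<pi> x) = x"
    using gog_path_end_unique by blast
  moreover have "lift_point G q (?proj w) (point_map \<pi> x) = lift_point G q (?proj t) (point_map \<pi> x)"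
    using lift_point_cong[OF w' t'] proj.path_val_gog_map_homotopic[OF t(2)] by blast
  ultimately show "lift_point G q (?proj w) (point_map \<pi> x) = x" by simp
qed

end

lemma graph_map_path_path:
  fixes T :: "('v, 'e, 'g) graph_of_groups" and G :: "('w, 'd, 'g) graph_of_groups"
  assumes "graph_hom T G f" "gog_path T x w y" "\<forall>s \<in> set w. \<exists>e a b. s = Seg e a b"
  shows "gog_path G (point_map f x) (graph_map_path f w) (point_map f y)"
  using assms(2,3)
proof (induction w arbitrary: x)
  case Nil
  then show ?case using graph_hom.point_map_closed[OF assms(1)] by (auto simp: graph_map_path_def)
next
  case (Cons s w)
  then obtain e a b where s: "s = Seg e a b" by auto
  with Cons have e: "e \<in> arcs (gr T)" "0 \<le> a" "a < b" "b \<le> 1" "x = edge_point T e a" by auto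
  have IH: "gog_path G (point_map f (edge_point T e b)) (graph_map_path f w) (point_map f y)"
    using Cons s by auto
  show ?case
  proof (cases "emap f e")
    case (Inl v)
    with IH e s show ?thesis
      by (simp add: graph_hom.point_map_edge_point[OF assms(1)] graph_map_path_def)
  next
    case (Inr d)
    with IH e s graph_hom.emap_Inr[OF assms(1) e(1) Inr] show ?thesis
      by (simp add: graph_hom.point_map_edge_point[OF assms(1)] graph_map_path_def)
  qed
qed

section \<open>Construction of the morphism\<close>

locale equivariant_tree_morphism =
  L: covering L p \<pi>L + G: covering G q \<pi>G + ft: graph_hom "bs_tree L p" "bs_tree G q" ft
  for L :: "('v, 'e, 'g) graph_of_groups" and p \<pi>L
    and G :: "('w, 'd, 'k) graph_of_groups" and q \<pi>G
    and ft :: "(('v, 'e, 'g) tvert, ('v, 'e, 'g) tedge, ('w, 'd, 'k) tvert, ('w, 'd, 'k) tedge) graph_map" +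
  fixes \<phi> :: "('v, 'e, 'g) piece list set \<Rightarrow> ('w, 'd, 'k) piece list set"
  assumes pointed: "point_map ft (base_lift L p) = base_lift G q"
    and hom: "\<phi> \<in> hom (pi1 L p) (pi1 G q)"
    and equivariant: "equivariant L p G q \<phi> ft"
begin

section \<open>The given homomorphism in terms of values\<close>

definition loop_image :: "('v, 'e, 'g) piece list \<Rightarrow> ('w, 'd, 'k) piece list" where
  "loop_image u = (SOME w. gog_path G q w q \<and> \<phi> (hclass L p p u) = hclass G q q w)"

definition loop_val where "loop_val u = path_val G (loop_image u)"

lemma loop_image:
  assumes "gog_path L p u p"
  shows "gog_path G q (loop_image u) q" (is ?A) "\<phi> (hclass L p p u) = hclass G q q (loop_image u)" (is ?B)
proof -
  have "hclass L p p u \<in> carrier (pi1 L p)"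
    using assms L.pi1_carrier by blast
  then have "\<phi> (hclass L p p u) \<in> carrier (pi1 G q)"
    using hom by (auto simp: hom_def)
  then have "\<exists>w. gog_path G q w q \<and> \<phi> (hclass L p p u) = hclass G q q w"
    using G.pi1_carrier by blast
  from someI_ex[OF this] show ?A ?B
    unfolding loop_image_def by blast+
qed

lemma loop_val_eqI:
  assumes "gog_path L p u p" "gog_path G q w q" "\<phi> (hclass L p p u) = hclass G q q w"
  shows "loop_val u = path_val G w"
  using assms loop_image[OF assms(1)] G.hclass_eq_iff G.homotopic_iff_path_val
  unfolding loop_val_def by metis

lemma loop_val_append:
  assumes u: "gog_path L p u p" and w: "gog_path L p w p"
  shows "loop_val (u @ w) = loop_val u + loop_val w"
proof -
  have uw: "gog_path L p (u @ w) p"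
    using u w by (auto simp: L.gog_path_append)
  have "hclass L p p u \<in> carrier (pi1 L p)" "hclass L p p w \<in> carrier (pi1 L p)"
    using u w L.pi1_carrier by blast+
  then have "\<phi> (hclass L p p u \<otimes>\<^bsub>pi1 L p\<^esub> hclass L p p w) = \<phi> (hclass L p p u) \<otimes>\<^bsub>pi1 G q\<^esub> \<phi> (hclass L p p w)"
    using hom by (auto simp: hom_def)
  then have "\<phi> (hclass L p p (u @ w)) = hclass G q q (loop_image u @ loop_image w)"
    using u w loop_image by (simp add: L.pi1_mult G.pi1_mult)
  moreover have "gog_path G q (loop_image u @ loop_image w) q"
    using loop_image u w by (auto simp: G.gog_path_append)
  ultimately show ?thesis
    using loop_val_eqI[OF uw] by (simp add: loop_val_def)
qed

lemma loop_val_cong: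
  assumes u: "gog_path L p u p" and w: "gog_path L p w p" and eq: "path_val L u = path_val L w"
  shows "loop_val u = loop_val w"
proof -
  have "hclass L p p u = hclass L p p w"
    using L.hclass_eq_iff[OF u] L.homotopic_iff_path_val[OF u w] eq by simp
  then show ?thesis
    by (simp add: loop_val_def loop_image_def)
qed

lemma loop_val_Nil: "loop_val [] = 0"
  using loop_val_append[of "[]" "[]"] L.base_point
  by simp (metis add.right_neutral add_left_cancel)

text \<open>\<open>(U, z)\<close> describes the image under \<open>ft\<close> of the end point of the lift of \<open>u\<close>.\<close>

definition lies_over where
  "lies_over u y U z \<longleftrightarrow> gog_path L p u y \<and> gog_path G q U z \<and>
     point_map ft (lift_point L p u y) = lift_point G q U z"

lemma lies_over_Nil: "lies_over [] p [] q"
  using pointed L.base_point G.base_point by (simp add: lies_over_def base_lift_eq_lift_point)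

lemma lies_over_exists:
  assumes u: "gog_path L p u y"
  shows "\<exists>U z. lies_over u y U z"
proof -
  have "lift_point L p u y \<in> points (bs_tree L p)"
    using L.base_lift_to_lift_point[OF u] L.tree.gog_path_points by blast
  then have "point_map ft (lift_point L p u y) \<in> points (bs_tree G q)"
    by (rule ft.point_map_closed)
  then obtain U z where "gog_path G q U z" "point_map ft (lift_point L p u y) = lift_point G q U z"
    by (rule G.points_bs_tree_cases)
  with u show ?thesis unfolding lies_over_def by blast
qed

text \<open>The projection \<open>\<pi>G\<close> recovers \<open>z\<close> from the point of the
  tree.\<close>

lemma lies_over_unique:
  assumes "lies_over u y U z" "lies_over u y U' z'"
  shows "z = z'" "lift_point G q U z = lift_point G q U' z"
proof -
  have eq: "lift_point G q U z = lift_point G q U' z'"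
    using assms by (simp add: lies_over_def)
  have "gog_path G q U z" "gog_path G q U' z'"
    using assms by (simp_all add: lies_over_def)
  then have "point_map \<pi>G (lift_point G q U z) = z" "point_map \<pi>G (lift_point G q U' z') = z'"
    by (simp_all add: G.point_map_lift_point)
  with eq show "z = z'" by simp
  with eq show "lift_point G q U z = lift_point G q U' z" by simp
qed

lemma lies_over_cong:
  assumes "lies_over u y U z" "gog_path L p u' y" "path_val L u' = path_val L u"
    and "gog_path G q U' z" "path_val G U' = path_val G U"
  shows "lies_over u' y U' z"
  using assms L.lift_point_cong[of u y u'] G.lift_point_cong[of U z U'] by (simp add: lies_over_def)

text \<open>The form in which equivariance is used: acting on the end point of a lift means
  prefixing the path by a loop.\<close>

lemma lies_over_equivariant:
  assumes u: "lies_over u y U z" and h: "gog_path L p h p"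
  shows "lies_over (h @ u) y (loop_image h @ U) z"
proof -
  have uy: "gog_path L p u y" and Uz: "gog_path G q U z"
    and eq: "point_map ft (lift_point L p u y) = lift_point G q U z"
    using u by (auto simp: lies_over_def)
  have x: "lift_point L p u y \<in> points (bs_tree L p)"
    using L.base_lift_to_lift_point[OF uy] L.tree.gog_path_points by blast
  have hc: "hclass L p p h \<in> carrier (pi1 L p)"
    using h L.pi1_carrier by blast
  have "point_map ft (lift_point L p (h @ u) y) = point_map ft (act_point L p (hclass L p p h) (lift_point L p u y))"
    by (simp add: L.act_point_lift_point[OF uy h])
  also have "\<dots> = act_point G q (\<phi> (hclass L p p h)) (point_map ft (lift_point L p u y))"
    using equivariant x hc unfolding equivariant_def by blast
  also have "\<dots> = lift_point G q (loop_image h @ U) z"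
    by (simp add: eq loop_image[OF h] G.act_point_lift_point[OF Uz])
  finally show ?thesis
    using uy Uz h loop_image[OF h] by (auto simp: lies_over_def L.gog_path_append G.gog_path_append)
qed

lemma lies_over_Vert_iff:
  "lies_over u (Vert v) U (Vert w) \<longleftrightarrow> gog_path L p u (Vert v) \<and> gog_path G q U (Vert w) \<and>
     vmap ft (v, coset L p v u) = (w, coset G q w U)"
  by (simp add: lies_over_def)

section \<open>The base point and its image\<close>

lemma base_edge_cases:
  assumes e: "e \<in> arcs (gr L)" "0 < a" "a < 1" "p = edge_point L e a"
  obtains (collapsed) x where "emap ft (lift_edge L p [] e a) = Inl x" "q = Vert (fst x)" "x = (fst x, coset G q (fst x) [])"
  | (edge) d where "emap ft (lift_edge L p [] e a) = Inr (lift_edge G q [] d a)" "d \<in> arcs (gr G)" "q = edge_point G d a"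
proof -
  let ?d = "lift_edge L p [] e a"
  have d: "?d \<in> bs_arcs L p"
    using e L.base_point by (intro L.lift_edge_in_arcs) auto
  have "base_lift L p = edge_point (bs_tree L p) ?d a"
    using e L.base_point L.lift_point_edge_point[of e a "[]"] by (simp add: base_lift_eq_lift_point)
  \<comment> \<open>On an edge that is not collapsed \<open>ft\<close> keeps the parameter, so the
    base lift of \<open>q\<close> is a vertex or has parameter \<open>a\<close> on the image
    edge.\<close>
  then have img: "(case emap ft ?d of Inl x \<Rightarrow> Vert x | Inr d' \<Rightarrow> edge_point (bs_tree G q) d' a) = lift_point G q [] q"
    using pointed d by (simp add: ft.point_map_edge_point base_lift_eq_lift_point)
  show thesis
    using G.base_point
  proof (cases rule: G.points_cases)
    case (1 v)
    with img e show thesis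
      using collapsed by (auto simp: edge_point_Mid split: sum.splits)
  next
    case (2 d b)
    then have l: "lift_point G q [] q = edge_point (bs_tree G q) (lift_edge G q [] d b) b"
      using G.base_point G.lift_point_edge_point[of d b "[]"] by simp
    with img 2 obtain d' where d': "emap ft ?d = Inr d'"
      "edge_point (bs_tree G q) d' a = edge_point (bs_tree G q) (lift_edge G q [] d b) b"
      by (auto simp: edge_point_Mid split: sum.splits)
    from G.tree.edge_point_eqD[OF e(2,3) d'(2)] show thesis
    proof
      assume "lift_edge G q [] d b = d' \<and> b = a"
      then have "emap ft ?d = Inr (lift_edge G q [] d a)" "b = a"
        using d'(1) by auto
      moreover from this have "q = edge_point G d a"
        using 2(5) by simp
      ultimately show thesis using edge 2(1) by blast
    next
      \<comment> \<open>The description of \<open>q\<close> in the chosen orientation of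
        \<open>G\<close> may run against the image of \<open>e\<close>.\<close>
      assume "d' = erev (bs_tree G q) (lift_edge G q [] d b) \<and> b = 1 - a"
      moreover have "erev (bs_tree G q) (lift_edge G q [] d b) = lift_edge G q [] (erev G d) (1 - b)"
        using 2 G.base_point by (intro G.erev_bs_tree_lift_edge) simp_all
      ultimately have "emap ft ?d = Inr (lift_edge G q [] (erev G d) a)" "b = 1 - a"
        using d'(1) by simp_all
      moreover from this have "q = edge_point G (erev G d) a"
        using 2(1,5) by (simp add: G.edge_point_erev)
      ultimately show thesis
        using edge G.arev_in_arcs[OF 2(1)] by blast
    qed
  qed
qed

definition base_vert :: 'v where "base_vert = retract_point L p"

definition base_path :: "('v, 'e, 'g) piece list" where "base_path = to_vertex L p"

lemma base_path: "gog_path L p base_path (Vert base_vert)"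
  unfolding base_path_def base_vert_def using L.gog_path_to_vertex[OF L.base_point] .

text \<open>Lying over \<open>base_path\<close> fixes \<open>U\<close> only up to the vertex group
  at its end. The other clauses remove this freedom: \<open>U\<close> has to be the image of
  \<open>base_path\<close> under the map still to be built, or that map would induce a conjugate of
  \<phi>.\<close>

definition base_image_ok :: "('w, 'd, 'k) piece list \<Rightarrow> 'w \<Rightarrow> bool" where
  "base_image_ok U z \<longleftrightarrow> lies_over base_path (Vert base_vert) U (Vert z) \<and>
     ((\<exists>v. p = Vert v) \<longrightarrow> U = []) \<and>
     (\<forall>e a. e \<in> arcs (gr L) \<and> orient L e \<and> 0 < a \<and> a < 1 \<and> p = edge_point L e a \<longrightarrow>
        U = (case emap ft (lift_edge L p [] e a) of Inl x \<Rightarrow> [] | Inr d \<Rightarrow> [Seg (fst d) a 1]))"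

lemma base_image_ok_exists: "\<exists>U z. base_image_ok U z"
  using L.base_point
proof (cases rule: L.points_cases)
  case (1 v)
  then have "base_path = []" "base_vert = v"
    unfolding base_path_def base_vert_def by simp_all
  obtain w where "q = Vert w"
    using G.base_point
  proof (cases rule: G.points_cases)
    case (2 d b)
    then have "base_lift G q = edge_point (bs_tree G q) (lift_edge G q [] d b) b"
      using G.base_point G.lift_point_edge_point[of d b "[]"] by (simp add: base_lift_eq_lift_point)
    with pointed 1 2 show ?thesis
      by (simp add: base_lift_eq_lift_point edge_point_Mid)
  qed (use that in blast)
  moreover have "lies_over [] p [] q" by (rule lies_over_Nil)
  ultimately have "base_image_ok [] w"
    unfolding base_image_ok_def \<open>base_path = []\<close> \<open>base_vert = v\<close> using 1 by (auto simp: edge_point_Mid)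
  then show ?thesis by blast
next
  case (2 e a)
  then have base: "base_path = [Seg e a 1]" "base_vert = head (gr L) e"
    unfolding base_path_def base_vert_def by (simp_all add: L.to_vertex_Mid L.retract_edge_point)
  let ?d = "lift_edge L p [] e a"
  have d: "?d \<in> arcs (gr (bs_tree L p))"
    using L.lift_edge_in_arcs[of e a "[]"] 2 L.base_point by simp
  have hd: "snd (snd ?d) = (head (gr L) e, coset L p (head (gr L) e) [Seg e a 1])"
    using 2 by (simp add: lift_edge_def Let_def)
  \<comment> \<open>A point has only one description in the chosen orientation, so the quantified
    clause of \<open>base_image_ok\<close> speaks of \<open>e\<close> and \<open>a\<close>
    alone.\<close>
  have same: "e' = e \<and> a' = a"
    if "e' \<in> arcs (gr L)" "orient L e'" "0 < a'" "a' < 1" "p = edge_point L e' a'" for e' a'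
    using L.edge_point_eqD[of a e e' a'] L.orient_erev[of e'] 2 that by auto
  have p: "gog_path L p [Seg e a 1] (Vert (head (gr L) e))" "p \<noteq> Vert v" for v
    using 2 by (auto simp: edge_point_Mid)
  from 2(1,3,4,5) show ?thesis
  proof (cases rule: base_edge_cases)
    case (collapsed x)
    have "vmap ft (snd (snd ?d)) = x"
      using ft.emap_Inl[OF d collapsed(1)] by simp
    then have "lies_over base_path (Vert base_vert) [] (Vert (fst x))"
      using collapsed(2,3) hd p G.base_point unfolding base lies_over_Vert_iff
      by (metis G.gog_path_Nil)
    then have "base_image_ok [] (fst x)"
      using same collapsed(1) p(2) unfolding base_image_ok_def by auto
    then show ?thesis by blast
  next
    case (edge d')
    have "vmap ft (snd (snd ?d)) = snd (snd (lift_edge G q [] d' a))"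
      using ft.emap_Inr[OF d edge(1)] by simp
    then have "lies_over base_path (Vert base_vert) [Seg d' a 1] (Vert (head (gr G) d'))"
      using edge(2,3) hd p 2 unfolding base lies_over_Vert_iff
      by (simp add: lift_edge_def Let_def)
    then have "base_image_ok [Seg d' a 1] (head (gr G) d')"
      using same edge(1) p(2) unfolding base_image_ok_def by auto
    then show ?thesis by blast
  qed
qed

definition base_image :: "('w, 'd, 'k) piece list" where
  "base_image = (SOME U. \<exists>z. base_image_ok U z)"

lemma base_image: "\<exists>z. base_image_ok base_image z"
  unfolding base_image_def using base_image_ok_exists by (rule someI_ex)

text \<open>The paths \<open>\<gamma>\<^sub>v\<close> and \<open>\<beta>\<^sub>v\<close> of the introduction; \<open>transport\<close> below is \<open>\<Phi>\<close>.\<close>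

definition conn :: "'v \<Rightarrow> ('v, 'e, 'g) piece list" where
  "conn v = (if v = base_vert then base_path else SOME u. gog_path L p u (Vert v))"

definition image_vert :: "'v \<Rightarrow> 'w" where
  "image_vert v = fst (vmap ft (v, coset L p v (conn v)))"

definition image_conn :: "'v \<Rightarrow> ('w, 'd, 'k) piece list" where
  "image_conn v =
     (if v = base_vert then base_image else SOME U. lies_over (conn v) (Vert v) U (Vert (image_vert v)))"

lemma base_vert: "base_vert \<in> verts (gr L)" "conn base_vert = base_path" "image_conn base_vert = base_image"
  using base_path L.path_vert by (auto simp: conn_def image_conn_def)

lemma conn: "v \<in> verts (gr L) \<Longrightarrow> gog_path L p (conn v) (Vert v)"
  unfolding conn_def using base_path L.path_between[OF L.base_point, of "Vert v"]
  by (auto intro: someI_ex)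

lemma image_conn:
  assumes "v \<in> verts (gr L)"
  shows "lies_over (conn v) (Vert v) (image_conn v) (Vert (image_vert v))"
proof (cases "v = base_vert")
  case True
  from base_image obtain z where "lies_over base_path (Vert base_vert) base_image (Vert z)"
    unfolding base_image_ok_def by blast
  moreover from this have "image_vert base_vert = z"
    by (simp add: image_vert_def base_vert lies_over_Vert_iff)
  ultimately show ?thesis
    using True base_vert by simp
next
  case False
  obtain U z where U: "lies_over (conn v) (Vert v) U z"
    using lies_over_exists conn[OF assms] by blast
  then have "point_map ft (lift_point L p (conn v) (Vert v)) = lift_point G q U z" "z \<in> points G"
    using G.gog_path_points by (auto simp: lies_over_def)
  then have "z = Vert (image_vert v)"
    by (cases z) (auto simp: lift_point_def image_vert_def)
  with U have "\<exists>U. lies_over (conn v) (Vert v) U (Vert (image_vert v))" by blast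
  from someI_ex[OF this] False show ?thesis
    by (simp add: image_conn_def)
qed

lemma image_conn_path: "v \<in> verts (gr L) \<Longrightarrow> gog_path G q (image_conn v) (Vert (image_vert v))"
  using image_conn by (simp add: lies_over_Vert_iff)

lemma image_vert_closed: "v \<in> verts (gr L) \<Longrightarrow> image_vert v \<in> verts (gr G)"
  using image_conn_path G.path_vert by blast

lemma lies_over_vert:
  assumes u: "lies_over u (Vert v) U (Vert w)"
  shows "w = image_vert v"
    and "\<exists>k \<in> carrier (vgrp G (image_vert v)).
      path_val G U = loop_val (u @ reverse_path L (conn v)) + path_val G (image_conn v) + elt_val G (image_vert v) k"
proof -
  have up: "gog_path L p u (Vert v)" and Up: "gog_path G q U (Vert w)"
    using u by (auto simp: lies_over_def)
  then have v: "v \<in> verts (gr L)" by (simp add: L.path_vert)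
  let ?h = "u @ reverse_path L (conn v)"
  have h: "gog_path L p ?h p"
    using up L.gog_path_rev[OF conn[OF v]] by (auto simp: L.gog_path_append)
  have "lies_over (?h @ conn v) (Vert v) (loop_image ?h @ image_conn v) (Vert (image_vert v))"
    using lies_over_equivariant[OF image_conn[OF v] h] .
  then have over: "lies_over u (Vert v) (loop_image ?h @ image_conn v) (Vert (image_vert v))"
    by (rule lies_over_cong) (use up L.path_val_rev[OF conn[OF v]] loop_image[OF h] image_conn_path[OF v]
        in \<open>auto simp: G.gog_path_append add.assoc\<close>)
  from lies_over_unique(1)[OF u over] show w: "w = image_vert v" by simp
  from lies_over_unique(2)[OF u over]
  have "coset G q w (loop_image ?h @ image_conn v) = coset G q w U"
    using w by simp
  moreover have "gog_path G q (loop_image ?h @ image_conn v) (Vert w)"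
    using loop_image[OF h] image_conn_path[OF v] w by (auto simp: G.gog_path_append)
  ultimately show "\<exists>k \<in> carrier (vgrp G (image_vert v)). path_val G U =
      loop_val ?h + path_val G (image_conn v) + elt_val G (image_vert v) k"
    using G.coset_eq_iff[of "loop_image ?h @ image_conn v" w U] Up w
    by (simp add: loop_val_def)
qed

section \<open>The homomorphism of path groupoids\<close>

definition transport :: "'v \<Rightarrow> 'v \<Rightarrow> ('v, 'e, 'g) piece list \<Rightarrow> ('w, 'd, 'k) piece list set permutation" where
  "transport v w u = - path_val G (image_conn v) + loop_val (conn v @ u @ reverse_path L (conn w)) +
     path_val G (image_conn w)"

lemma conn_loop:
  assumes "gog_path L (Vert v) u (Vert w)"
  shows "gog_path L p (conn v @ u @ reverse_path L (conn w)) p"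
proof -
  have vw: "v \<in> verts (gr L)" "w \<in> verts (gr L)"
    using L.gog_path_points[OF assms] by auto
  then show ?thesis
    using assms conn[OF vw(1)] L.gog_path_rev[OF conn[OF vw(2)]] by (auto simp: L.gog_path_append)
qed

lemma transport_cong:
  assumes "gog_path L (Vert v) u (Vert w)" "gog_path L (Vert v) u' (Vert w)" "path_val L u = path_val L u'"
  shows "transport v w u = transport v w u'"
proof -
  have "loop_val (conn v @ u @ reverse_path L (conn w)) = loop_val (conn v @ u' @ reverse_path L (conn w))"
    using assms conn_loop by (intro loop_val_cong) auto
  then show ?thesis by (simp add: transport_def)
qed

lemma transport_append:
  assumes u: "gog_path L (Vert v) u (Vert w)" and u': "gog_path L (Vert w) u' (Vert x)"
  shows "transport v x (u @ u') = transport v w u + transport w x u'"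
proof -
  have w: "w \<in> verts (gr L)" using L.gog_path_points[OF u] by auto
  have uu': "gog_path L (Vert v) (u @ u') (Vert x)"
    using u u' by (auto simp: L.gog_path_append)
  let ?a = "conn v @ u @ reverse_path L (conn w)" and ?b = "conn w @ u' @ reverse_path L (conn x)"
  have ab: "gog_path L p (?a @ ?b) p"
    using conn_loop[OF u] conn_loop[OF u'] unfolding L.gog_path_append by blast
  have "loop_val (conn v @ (u @ u') @ reverse_path L (conn x)) = loop_val (?a @ ?b)"
    by (rule loop_val_cong[OF conn_loop[OF uu'] ab]) (simp add: L.path_val_rev[OF conn[OF w]] add.assoc)
  also have "\<dots> = loop_val ?a + loop_val ?b"
    using conn_loop[OF u] conn_loop[OF u'] by (rule loop_val_append)
  finally show ?thesis
    by (simp add: transport_def add.assoc)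
qed

lemma transport_Nil: "v \<in> verts (gr L) \<Longrightarrow> transport v v [] = 0"
  using transport_append[of v "[]" v "[]" v] by simp (metis add.right_neutral add_left_cancel)

lemma transport_reverse:
  assumes u: "gog_path L (Vert v) u (Vert w)"
  shows "transport w v (reverse_path L u) = - transport v w u"
proof -
  have v: "v \<in> verts (gr L)" using L.gog_path_points[OF u] by auto
  have "transport v w u + transport w v (reverse_path L u) = transport v v (u @ reverse_path L u)"
    using transport_append[OF u L.gog_path_rev[OF u]] by simp
  also have "\<dots> = transport v v []"
    using u v L.gog_path_rev[OF u] by (intro transport_cong) (auto simp: L.gog_path_append L.path_val_rev[OF u])
  also have "\<dots> = 0" using transport_Nil v by simp
  finally show ?thesis by (metis minus_unique)
qed

text \<open>The means to compute \<Phi>(u): exhibit a path over \<open>conn v @ u\<close>; it equals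
  \<beta> at v followed by \<Phi>(u), up to the vertex group at the end.\<close>

lemma lies_over_transport:
  assumes u: "gog_path L (Vert v) u (Vert w)" and over: "lies_over (conn v @ u) (Vert w) U (Vert z)"
  shows "z = image_vert w"
    and "\<exists>k \<in> carrier (vgrp G (image_vert w)).
      path_val G U = path_val G (image_conn v) + transport v w u + elt_val G (image_vert w) k"
  using lies_over_vert[OF over] by (auto simp: transport_def add.assoc)

text \<open>Appending \<open>g\<close> does not change the vertex of the tree, so the same path
  \<open>image_conn v\<close> lies over \<open>conn v @ [Elt v g]\<close>. Comparing the two
  descriptions, \<Phi>(g) is the inverse of a vertex group element.\<close>

lemma transport_Elt:
  assumes v: "v \<in> verts (gr L)" and g: "g \<in> carrier (vgrp L v)"
  shows "\<exists>k \<in> carrier (vgrp G (image_vert v)). elt_val G (image_vert v) k = transport v v [Elt v g]"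
proof -
  have path: "gog_path L (Vert v) [Elt v g] (Vert v)" using v g by simp
  have "lies_over (conn v @ [Elt v g]) (Vert v) (image_conn v) (Vert (image_vert v))"
    using image_conn[OF v] conn[OF v] g v L.coset_Elt[of "conn v" v g]
    unfolding lies_over_Vert_iff by (auto simp: L.gog_path_append)
  from lies_over_transport(2)[OF path this] obtain k where k: "k \<in> carrier (vgrp G (image_vert v))"
    "path_val G (image_conn v) = path_val G (image_conn v) + transport v v [Elt v g] + elt_val G (image_vert v) k"
    by blast
  interpret group "vgrp G (image_vert v)"
    using G.group_vgrp image_vert_closed[OF v] by blast
  have "path_val G (image_conn v) + (transport v v [Elt v g] + elt_val G (image_vert v) k) =
      path_val G (image_conn v) + 0"
    using k(2)[symmetric] by (simp add: add.assoc)
  then have "transport v v [Elt v g] = - elt_val G (image_vert v) k"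
    unfolding add_left_cancel by (rule iffD2[OF eq_neg_iff_add_eq_0])
  then have "elt_val G (image_vert v) (inv\<^bsub>vgrp G (image_vert v)\<^esub> k) = transport v v [Elt v g]"
    using k(1) image_vert_closed[OF v] by (simp add: G.elt_val_inv)
  with k(1) show ?thesis by blast
qed

lemma lies_over_proj: "lies_over u y U z \<Longrightarrow> point_map \<pi>G (point_map ft (lift_point L p u y)) = z"
  by (simp add: lies_over_def G.point_map_lift_point)

section \<open>Images of edges\<close>

lemma proj_image_edge_point:
  assumes d: "d \<in> bs_arcs L p"
  shows "point_map \<pi>G (point_map ft (edge_point (bs_tree L p) d a)) =
    (case map_sum fst fst (emap ft d) of Inl v \<Rightarrow> Vert v | Inr e \<Rightarrow> edge_point G e a)"
proof (cases "emap ft d")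
  case (Inl x)
  then have "x \<in> verts (gr (bs_tree G q))"
    using d ft.emap_Inl[of d x] ft.vmap_closed[of "fst (snd d)"] L.tree.tail_in_verts[of d] by simp
  with Inl d show ?thesis
    by (simp add: ft.point_map_edge_point G.vmap_proj)
next
  case (Inr d')
  then have "d' \<in> bs_arcs G q"
    using d ft.emap_Inr[of d d'] by simp
  with Inr d show ?thesis
    by (simp add: ft.point_map_edge_point G.proj.point_map_edge_point G.emap_proj)
qed

definition image_cell :: "'e \<Rightarrow> 'w + 'd" where
  "image_cell e = map_sum fst fst (emap ft (lift_edge L p (conn (tail (gr L) e)) e 0))"

text \<open>Any lift of the edge is a translate of the one through \<open>conn\<close>, and
  translation does not change the projection of the image. As \<open>equivariant\<close> speaks of
  points, this is read off from the point with parameter 1/3, which determines the image cell and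
  its orientation.\<close>

lemma image_cell_lift:
  assumes d: "d \<in> bs_arcs L p"
  shows "map_sum fst fst (emap ft d) = image_cell (fst d)"
proof -
  obtain e u where e: "e \<in> arcs (gr L)" "gog_path L p u (Vert (tail (gr L) e))" "d = lift_edge L p u e 0"
    using d by (rule L.bs_arcs_cases)
  let ?v = "tail (gr L) e" and ?a = "1 / 3 :: real"
  let ?h = "u @ reverse_path L (conn ?v)" and ?s = "[Seg e 0 ?a]"
  have v: "?v \<in> verts (gr L)" using e by simp
  let ?d = "lift_edge L p (conn ?v) e 0"
  have lift: "lift_point L p (u' @ ?s) (edge_point L e ?a) = edge_point (bs_tree L p) (lift_edge L p u' e 0) ?a"
    if "gog_path L p u' (Vert ?v)" for u'
  proof -
    have "gog_path L p (u' @ ?s) (edge_point L e ?a)"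
      using that e by (auto simp: L.gog_path_append intro: L.edge_point_in_points)
    with that e L.lift_edge_Seg[of e 0 ?a u'] show ?thesis
      by (simp add: L.lift_point_edge_point)
  qed
  have paths: "gog_path L p (conn ?v @ ?s) (edge_point L e ?a)" "gog_path L p (u @ ?s) (edge_point L e ?a)"
    using conn[OF v] e by (auto simp: L.gog_path_append intro: L.edge_point_in_points)
  have h: "gog_path L p ?h p"
    using e L.gog_path_rev[OF conn[OF v]] by (auto simp: L.gog_path_append)
  obtain U z where U: "lies_over (conn ?v @ ?s) (edge_point L e ?a) U z"
    using lies_over_exists[OF paths(1)] by blast
  have "lies_over (u @ ?s) (edge_point L e ?a) (loop_image ?h @ U) z"
    using lies_over_equivariant[OF U h]
    by (rule lies_over_cong)
      (use paths L.path_val_rev[OF conn[OF v]] U loop_image[OF h] in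
        \<open>auto simp: add.assoc lies_over_def G.gog_path_append\<close>)
  from lies_over_proj[OF this] lies_over_proj[OF U]
  have "point_map \<pi>G (point_map ft (edge_point (bs_tree L p) d ?a)) =
    point_map \<pi>G (point_map ft (edge_point (bs_tree L p) ?d ?a))"
    using lift[OF e(2)] lift[OF conn[OF v]] e(3) by simp
  moreover have d': "?d \<in> bs_arcs L p"
    using L.lift_edge_in_arcs[of e 0 "conn ?v"] e(1) conn[OF v] by simp
  ultimately have eq: "(case map_sum fst fst (emap ft d) of Inl v \<Rightarrow> Vert v | Inr e \<Rightarrow> edge_point G e ?a) =
    (case map_sum fst fst (emap ft ?d) of Inl v \<Rightarrow> Vert v | Inr e \<Rightarrow> edge_point G e ?a)"
    by (simp add: proj_image_edge_point[OF d] proj_image_edge_point[OF d'])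
  have arc: "fst c \<in> arcs (gr G)" if "emap ft d'' = Inr c" "d'' \<in> bs_arcs L p" for d'' c
    using ft.emap_Inr[of d'' c] that by (auto elim: G.bs_arcs_cases)
  have "map_sum fst fst (emap ft d) = map_sum fst fst (emap ft ?d)"
    using eq G.edge_point_third_inj arc[OF _ d] arc[OF _ d']
    by (auto simp: edge_point_Mid[of ?a] split: sum.splits)
  then show ?thesis
    by (simp add: image_cell_def e(3))
qed

lemma image_vert_lift:
  assumes u: "gog_path L p u (Vert v)"
  shows "\<exists>U. lies_over u (Vert v) U (Vert (image_vert v))"
proof -
  obtain U z where U: "lies_over u (Vert v) U z"
    using lies_over_exists[OF u] by blast
  then have "point_map ft (lift_point L p u (Vert v)) = lift_point G q U z"
    by (simp add: lies_over_def)
  then obtain w where "z = Vert w"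
    by (cases z) (auto simp: lift_point_def)
  with U lies_over_vert(1) show ?thesis by blast
qed

lemma fst_vmap_lift: "gog_path L p u (Vert v) \<Longrightarrow> fst (vmap ft (v, coset L p v u)) = image_vert v"
  using image_vert_lift[of u v] by (auto simp: lies_over_Vert_iff)

context
  fixes e assumes e: "e \<in> arcs (gr L)"
begin

private abbreviation "tl_e \<equiv> tail (gr L) e"
private abbreviation "hd_e \<equiv> head (gr L) e"
private abbreviation "d0 \<equiv> lift_edge L p (conn tl_e) e 0"

lemma conn_edge: "gog_path L p (conn tl_e @ [Seg e 0 1]) (Vert hd_e)"
  using e conn[of tl_e] by (auto simp: L.gog_path_append)

lemma conn_edge_arc:
  "d0 \<in> bs_arcs L p" "fst (snd d0) = (tl_e, coset L p tl_e (conn tl_e))"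
  "snd (snd d0) = (hd_e, coset L p hd_e (conn tl_e @ [Seg e 0 1]))"
  using L.lift_edge_in_arcs[of e 0 "conn tl_e"] e conn[of tl_e]
  by (simp_all add: lift_edge_def Let_def)

lemma image_cell_erev_lift: "image_cell (erev L e) = map_sum fst fst (emap ft (erev (bs_tree L p) d0))"
proof -
  have "erev (bs_tree L p) d0 = lift_edge L p (conn tl_e) (erev L e) 1"
    using L.erev_bs_tree_lift_edge[of e 0 "conn tl_e"] e conn[of tl_e] by simp
  then have "fst (erev (bs_tree L p) d0) = erev L e" by simp
  moreover have "erev (bs_tree L p) d0 \<in> bs_arcs L p"
    using conn_edge_arc(1) L.tree.arev_in_arcs[of d0] by simp
  ultimately show ?thesis
    using image_cell_lift by metis
qed

lemma image_cell_Inl: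
  assumes "image_cell e = Inl v"
  shows "v = image_vert tl_e" "v = image_vert hd_e" "image_cell (erev L e) = Inl v"
    "lies_over (conn tl_e @ [Seg e 0 1]) (Vert hd_e) (image_conn tl_e) (Vert (image_vert hd_e))"
proof -
  obtain x where x: "emap ft d0 = Inl x" "v = fst x"
    using assms by (cases "emap ft d0") (auto simp: image_cell_def)
  have v: "vmap ft (tl_e, coset L p tl_e (conn tl_e)) = x"
    "vmap ft (hd_e, coset L p hd_e (conn tl_e @ [Seg e 0 1])) = x"
    "emap ft (erev (bs_tree L p) d0) = Inl x"
    using ft.emap_Inl[of d0 x] x(1) conn_edge_arc by simp_all
  show "v = image_vert tl_e" "v = image_vert hd_e" "image_cell (erev L e) = Inl v"
    using v x(2) fst_vmap_lift[OF conn[of tl_e]] fst_vmap_lift[OF conn_edge] image_cell_erev_lift e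
    by simp_all
  then have eq: "image_vert tl_e = image_vert hd_e" by simp
  show "lies_over (conn tl_e @ [Seg e 0 1]) (Vert hd_e) (image_conn tl_e) (Vert (image_vert hd_e))"
    using image_conn[of tl_e] e v conn_edge eq unfolding lies_over_Vert_iff by simp
qed

lemma image_cell_Inr:
  assumes "image_cell e = Inr d"
  shows "d \<in> arcs (gr G)" "tail (gr G) d = image_vert tl_e" "head (gr G) d = image_vert hd_e"
    "image_cell (erev L e) = Inr (erev G d)"
    "\<exists>U. lies_over (conn tl_e) (Vert tl_e) U (Vert (image_vert tl_e)) \<and>
      lies_over (conn tl_e @ [Seg e 0 1]) (Vert hd_e) (U @ [Seg d 0 1]) (Vert (image_vert hd_e))"
proof -
  obtain d' where d': "emap ft d0 = Inr d'" "d = fst d'"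
    using assms by (cases "emap ft d0") (auto simp: image_cell_def)
  then have ft: "d' \<in> bs_arcs G q" "vmap ft (tl_e, coset L p tl_e (conn tl_e)) = fst (snd d')"
    "vmap ft (hd_e, coset L p hd_e (conn tl_e @ [Seg e 0 1])) = snd (snd d')"
    "emap ft (erev (bs_tree L p) d0) = Inr (erev (bs_tree G q) d')"
    using ft.emap_Inr[of d0 d'] conn_edge_arc by simp_all
  from ft(1) obtain d'' U where U'': "d'' \<in> arcs (gr G)" "gog_path G q U (Vert (tail (gr G) d''))"
    "d' = lift_edge G q U d'' 0"
    by (rule G.bs_arcs_cases)
  then have "d'' = d" using d'(2) by simp
  with U'' have U: "d \<in> arcs (gr G)" "gog_path G q U (Vert (tail (gr G) d))" "d' = lift_edge G q U d 0"
    by simp_all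
  then have tl: "vmap ft (tl_e, coset L p tl_e (conn tl_e)) = (tail (gr G) d, coset G q (tail (gr G) d) U)"
    and hd: "vmap ft (hd_e, coset L p hd_e (conn tl_e @ [Seg e 0 1])) =
      (head (gr G) d, coset G q (head (gr G) d) (U @ [Seg d 0 1]))"
    using ft by (simp_all add: lift_edge_def Let_def)
  show d: "d \<in> arcs (gr G)" "tail (gr G) d = image_vert tl_e" "head (gr G) d = image_vert hd_e"
    using U(1) tl hd fst_vmap_lift[OF conn[of tl_e]] fst_vmap_lift[OF conn_edge] e by simp_all
  have "fst (erev (bs_tree G q) d') = erev G d"
    using G.erev_bs_tree_lift_edge[of d 0 U] U by simp
  then show "image_cell (erev L e) = Inr (erev G d)"
    using image_cell_erev_lift ft(4) by simp
  have "gog_path G q (U @ [Seg d 0 1]) (Vert (head (gr G) d))"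
    using U by (auto simp: G.gog_path_append)
  then show "\<exists>U. lies_over (conn tl_e) (Vert tl_e) U (Vert (image_vert tl_e)) \<and>
      lies_over (conn tl_e @ [Seg e 0 1]) (Vert hd_e) (U @ [Seg d 0 1]) (Vert (image_vert hd_e))"
    using tl hd conn[of tl_e] conn_edge U e d unfolding lies_over_Vert_iff
    by (intro exI[of _ U]) simp
qed

end

section \<open>Factors of edge images and the twists\<close>

definition cell_val :: "'w + 'd \<Rightarrow> ('w, 'd, 'k) piece list set permutation" where
  "cell_val c = (case c of Inl v \<Rightarrow> 0 | Inr d \<Rightarrow> seg_val G d 1)"

text \<open>
  The last condition makes \<open>f\<close> map \<open>base_path\<close> to \<open>base_image\<close> when \<open>p\<close> is inside \<open>e\<close>. Otherwise \<open>f\<close>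
  might induce \<open>\<phi>\<close> only up to conjugation by an element of the edge group.
\<close>

definition edge_factor :: "'e \<Rightarrow> 'k \<Rightarrow> 'k \<Rightarrow> bool" where
  "edge_factor e m n \<longleftrightarrow>
     m \<in> carrier (vgrp G (image_vert (tail (gr L) e))) \<and> n \<in> carrier (vgrp G (image_vert (head (gr L) e))) \<and>
     transport (tail (gr L) e) (head (gr L) e) [Seg e 0 1] =
       elt_val G (image_vert (tail (gr L) e)) m + cell_val (image_cell e) +
       - elt_val G (image_vert (head (gr L) e)) n \<and>
     (\<forall>a. 0 < a \<and> a < 1 \<and> p = edge_point L e a \<longrightarrow> n = \<one>\<^bsub>vgrp G (image_vert (head (gr L) e))\<^esub>)"

lemma edge_path: "e \<in> arcs (gr L) \<Longrightarrow> gog_path L (Vert (tail (gr L) e)) [Seg e 0 1] (Vert (head (gr L) e))"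
  by simp

lemma edge_factor_exists:
  assumes e: "e \<in> arcs (gr L)" "orient L e"
  shows "\<exists>m n. edge_factor e m n"
proof -
  let ?t = "tail (gr L) e" and ?h = "head (gr L) e"
  have th: "?t \<in> verts (gr L)" "?h \<in> verts (gr L)" using e by simp_all
  interpret T: group "vgrp G (image_vert ?t)"
    using G.group_vgrp image_vert_closed th by simp
  interpret H: group "vgrp G (image_vert ?h)"
    using G.group_vgrp image_vert_closed th by simp
  consider v where "image_cell e = Inl v"
    | d a where "image_cell e = Inr d" "0 < a" "a < 1" "p = edge_point L e a"
    | d where "image_cell e = Inr d" "\<forall>a. 0 < a \<and> a < 1 \<longrightarrow> p \<noteq> edge_point L e a"
    by (cases "image_cell e") blast+
  then show ?thesis
  proof cases
    \<comment> \<open>Both ends of the lifted edge have the same image, so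
      \<open>image_conn ?t\<close> also lies over the far end. The whole discrepancy is put into
      \<open>m\<close>, which leaves \<open>n\<close> trivial.\<close>
    case (1 v)
    have eq: "image_vert ?t = image_vert ?h"
      using image_cell_Inl[OF e(1) 1] by simp
    obtain k where k: "k \<in> carrier (vgrp G (image_vert ?h))"
      "path_val G (image_conn ?t) = path_val G (image_conn ?t) + transport ?t ?h [Seg e 0 1] + elt_val G (image_vert ?h) k"
      using lies_over_transport(2)[OF edge_path[OF e(1)] image_cell_Inl(4)[OF e(1) 1]] by blast
    from k(2) have "transport ?t ?h [Seg e 0 1] = - elt_val G (image_vert ?h) k"
      by (rule add_cancel_eq_neg)
    then have "edge_factor e (inv\<^bsub>vgrp G (image_vert ?h)\<^esub> k) \<one>\<^bsub>vgrp G (image_vert ?h)\<^esub>"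
      using k(1) eq image_vert_closed[OF th(2)] 1
      by (simp add: edge_factor_def cell_val_def G.elt_val_inv)
    then show ?thesis by blast
  next
    \<comment> \<open>Here \<open>conn ?h\<close> and \<open>image_conn ?h\<close> are prescribed.
      The other end is reached from \<open>p\<close> by the path \<open>?u\<close> back to the tail,
      whose image is known exactly because the base lift goes to the base lift.\<close>
    case (2 d a)
    have base: "base_path = [Seg e a 1]" "base_vert = ?h"
      unfolding base_path_def base_vert_def using 2 e by (simp_all add: L.to_vertex_Mid L.retract_edge_point)
    let ?u = "[Seg (erev L e) (1 - a) 1]" and ?d = "lift_edge L p [] e a"
    have d: "?d \<in> bs_arcs L p"
      using e 2 L.base_point by (intro L.lift_edge_in_arcs) auto
    have u: "gog_path L p ?u (Vert ?t)"
      using 2 e by (simp add: L.edge_point_erev)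
    have d_arc: "d \<in> arcs (gr G)" "tail (gr G) d = image_vert ?t" "head (gr G) d = image_vert ?h"
      using image_cell_Inr[OF e(1) 2(1)] by simp_all
    from e(1) 2(2-4) have emap: "emap ft ?d = Inr (lift_edge G q [] d a) \<and> q = edge_point G d a"
    proof (cases rule: base_edge_cases)
      case (collapsed x)
      with 2(1) image_cell_lift[OF d] show ?thesis by simp
    next
      case (edge d')
      with 2(1) image_cell_lift[OF d] show ?thesis by simp
    qed
    then have "vmap ft (?t, coset L p ?t ?u) = (tail (gr G) d, coset G q (tail (gr G) d) [Seg (erev G d) (1 - a) 1])"
      using ft.emap_Inr[of ?d "lift_edge G q [] d a"] d 2 by (simp add: lift_edge_def Let_def)
    moreover have "gog_path G q [Seg (erev G d) (1 - a) 1] (Vert (tail (gr G) d))"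
      using emap 2(2,3) d_arc(1) by (simp add: G.edge_point_erev)
    ultimately have "lies_over ?u (Vert ?t) [Seg (erev G d) (1 - a) 1] (Vert (tail (gr G) d))"
      using u e(1) d_arc(1) by (simp add: lies_over_Vert_iff)
    from lies_over_vert(2)[OF this] obtain k where k: "k \<in> carrier (vgrp G (image_vert ?t))"
      "path_val G [Seg (erev G d) (1 - a) 1] = loop_val (?u @ reverse_path L (conn ?t)) +
        path_val G (image_conn ?t) + elt_val G (image_vert ?t) k" by blast
    \<comment> \<open>\<open>?A\<close> runs to the tail and on along \<open>e\<close> up to
      \<open>p\<close>, \<open>?B\<close> from \<open>p\<close> back to the tail: inverse loops,
      because \<open>conn ?h\<close> is the rest of \<open>e\<close> after \<open>p\<close>.\<close>
    let ?A = "conn ?t @ [Seg e 0 1] @ reverse_path L (conn ?h)" and ?B = "?u @ reverse_path L (conn ?t)"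
    have A: "gog_path L p ?A p"
      using conn_loop[OF edge_path[OF e(1)]] .
    have B: "gog_path L p ?B p"
      using u L.gog_path_rev[OF conn[OF th(1)]] by (auto simp: L.gog_path_append)
    have conn_h: "conn ?h = [Seg e a 1]" "path_val G (image_conn ?h) = - seg_val G d a + seg_val G d 1"
    proof -
      show "conn ?h = [Seg e a 1]" using base base_vert by simp
      from base_image obtain z where "base_image_ok base_image z" by blast
      then have "base_image = [Seg d a 1]"
        using emap 2 e unfolding base_image_ok_def by auto
      then have "image_conn ?h = [Seg d a 1]"
        using base base_vert by simp
      then show "path_val G (image_conn ?h) = - seg_val G d a + seg_val G d 1"
        using 2 d_arc by (simp add: G.path_val_Seg)
    qed
    have "loop_val ?A + loop_val ?B = loop_val (?A @ ?B)"
      using loop_val_append[OF A B] by simp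
    also have "\<dots> = loop_val []"
    proof (rule loop_val_cong)
      show "gog_path L p (?A @ ?B) p" using A B unfolding L.gog_path_append by blast
      show "gog_path L p [] p" using L.base_point by simp
      show "path_val L (?A @ ?B) = path_val L []"
        using e 2(2,3) L.path_val_rev[OF conn[OF th(1)]]
        by (simp add: conn_h L.path_val_Seg L.seg_val_erev group_add_calc)
    qed
    finally have AB: "loop_val ?A = - loop_val ?B"
      by (simp add: loop_val_Nil eq_neg_iff_add_eq_0)
    have "- seg_val G d a = path_val G [Seg (erev G d) (1 - a) 1]"
      using 2 d_arc by (simp add: G.path_val_Seg G.seg_val_erev group_add_calc)
    also note k(2)
    finally have "loop_val ?B = - seg_val G d a + - elt_val G (image_vert ?t) k + - path_val G (image_conn ?t)"
      by (simp add: group_add_calc)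
    then have "transport ?t ?h [Seg e 0 1] = elt_val G (image_vert ?t) k + seg_val G d 1"
      unfolding transport_def AB conn_h(2) by (simp add: group_add_calc)
    then have "edge_factor e k \<one>\<^bsub>vgrp G (image_vert ?h)\<^esub>"
      using k(1) image_vert_closed[OF th(2)] 2(1)
      by (simp add: edge_factor_def cell_val_def)
    then show ?thesis by blast
  next
    \<comment> \<open>The image of the lifted edge is the lift of \<open>d\<close> through some
      \<open>U\<close>. The element \<open>m\<close> corrects \<open>image_conn ?t\<close> to
      \<open>U\<close>, and \<open>k\<close> the other end in the same way.\<close>
    case (3 d)
    have d_arc: "d \<in> arcs (gr G)" "tail (gr G) d = image_vert ?t" "head (gr G) d = image_vert ?h"
      using image_cell_Inr[OF e(1) 3(1)] by simp_all
    obtain U where U: "lies_over (conn ?t) (Vert ?t) U (Vert (image_vert ?t))"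
      "lies_over (conn ?t @ [Seg e 0 1]) (Vert ?h) (U @ [Seg d 0 1]) (Vert (image_vert ?h))"
      using image_cell_Inr(5)[OF e(1) 3(1)] by blast
    have "coset G q (image_vert ?t) (image_conn ?t) = coset G q (image_vert ?t) U"
      using lies_over_unique(2)[OF image_conn[OF th(1)] U(1)] by simp
    then obtain m where m: "m \<in> carrier (vgrp G (image_vert ?t))"
      "path_val G U = path_val G (image_conn ?t) + elt_val G (image_vert ?t) m"
      using G.coset_eq_iff[OF image_conn_path[OF th(1)], of U] U(1) by (auto simp: lies_over_Vert_iff)
    obtain k where k: "k \<in> carrier (vgrp G (image_vert ?h))"
      "path_val G (U @ [Seg d 0 1]) = path_val G (image_conn ?t) + transport ?t ?h [Seg e 0 1] + elt_val G (image_vert ?h) k"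
      using lies_over_transport(2)[OF edge_path[OF e(1)] U(2)] by blast
    have "path_val G (image_conn ?t) + (elt_val G (image_vert ?t) m + seg_val G d 1) =
      path_val G (image_conn ?t) + (transport ?t ?h [Seg e 0 1] + elt_val G (image_vert ?h) k)"
      using k(2) m(2) d_arc(1) by (simp add: G.path_val_Seg add.assoc)
    then have "elt_val G (image_vert ?t) m + seg_val G d 1 + - elt_val G (image_vert ?h) k =
      transport ?t ?h [Seg e 0 1]"
      unfolding add_left_cancel by (simp add: add.assoc)
    then have "edge_factor e m k"
      using m(1) k(1) 3 by (auto simp: edge_factor_def cell_val_def)
    then show ?thesis by blast
  qed
qed

text \<open>The twist of the chosen orientation is selected first and that of its reverse to match
  it, so that together they form one pair satisfying \<open>edge_factor\<close>.\<close>

definition edge_twist :: "'e \<Rightarrow> 'k" where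
  "edge_twist e = (if orient L e then SOME n. \<exists>m. edge_factor e m n
     else SOME m. edge_factor (erev L e) m (SOME n. \<exists>m. edge_factor (erev L e) m n))"

lemma edge_factor_twist:
  assumes "e \<in> arcs (gr L)" "orient L e"
  shows "edge_factor e (edge_twist (erev L e)) (edge_twist e)"
proof -
  have "\<exists>m. edge_factor e m (SOME n. \<exists>m. edge_factor e m n)"
    by (rule someI_ex) (use edge_factor_exists[OF assms] in blast)
  from someI_ex[OF this] show ?thesis
    using assms by (simp add: edge_twist_def L.orient_erev)
qed

lemma cell_val_erev:
  assumes e: "e \<in> arcs (gr L)"
  shows "cell_val (image_cell (erev L e)) = - cell_val (image_cell e)"
proof (cases "image_cell e")
  case (Inl v)
  with image_cell_Inl(3)[OF e] show ?thesis by (simp add: cell_val_def)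
next
  case (Inr d)
  with image_cell_Inr(1,4)[OF e] show ?thesis
    by (simp add: cell_val_def G.seg_val_erev)
qed

lemma transport_edge_erev:
  assumes e: "e \<in> arcs (gr L)"
  shows "transport (head (gr L) e) (tail (gr L) e) [Seg (erev L e) 0 1] =
    - transport (tail (gr L) e) (head (gr L) e) [Seg e 0 1]"
  using transport_reverse[OF edge_path[OF e]] by simp

lemma edge_twist:
  assumes e: "e \<in> arcs (gr L)"
  shows "edge_twist e \<in> carrier (vgrp G (image_vert (head (gr L) e)))" (is ?A)
    and "transport (tail (gr L) e) (head (gr L) e) [Seg e 0 1] =
      elt_val G (image_vert (tail (gr L) e)) (edge_twist (erev L e)) + cell_val (image_cell e) +
      - elt_val G (image_vert (head (gr L) e)) (edge_twist e)" (is ?B)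
proof -
  have "?A \<and> ?B"
  proof (cases "orient L e")
    case True
    with edge_factor_twist[OF e] show ?thesis by (simp add: edge_factor_def)
  next
    case False
    then have "edge_factor (erev L e) (edge_twist e) (edge_twist (erev L e))"
      using edge_factor_twist[of "erev L e"] e by (simp add: L.orient_erev)
    then show ?thesis
      using e transport_edge_erev[of "erev L e"] cell_val_erev[OF e]
      by (simp add: edge_factor_def group_add_calc)
  qed
  then show ?A ?B
    by blast+
qed

section \<open>Vertex and edge homomorphisms\<close>

definition vert_hom :: "'v \<Rightarrow> 'g \<Rightarrow> 'k" where
  "vert_hom v g = (SOME k. k \<in> carrier (vgrp G (image_vert v)) \<and>
     elt_val G (image_vert v) k = transport v v [Elt v g])"

lemma vert_hom:
  assumes "v \<in> verts (gr L)" "g \<in> carrier (vgrp L v)"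
  shows "vert_hom v g \<in> carrier (vgrp G (image_vert v))" (is ?A)
    and "elt_val G (image_vert v) (vert_hom v g) = transport v v [Elt v g]" (is ?B)
proof -
  have "\<exists>k. k \<in> carrier (vgrp G (image_vert v)) \<and> elt_val G (image_vert v) k = transport v v [Elt v g]"
    using transport_Elt[OF assms] by blast
  from someI_ex[OF this] show ?A ?B
    by (auto simp: vert_hom_def)
qed

text \<open>\<Phi> is multiplicative, and vertex groups embed by \<open>elt_val_inj\<close>; hence
  the chosen preimages multiply correctly.\<close>

lemma vert_hom_mult:
  assumes v: "v \<in> verts (gr L)" and g: "g \<in> carrier (vgrp L v)" and h: "h \<in> carrier (vgrp L v)"
  shows "vert_hom v (g \<otimes>\<^bsub>vgrp L v\<^esub> h) = vert_hom v g \<otimes>\<^bsub>vgrp G (image_vert v)\<^esub> vert_hom v h"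
proof -
  interpret V: group "vgrp L v" using L.group_vgrp v by blast
  interpret W: group "vgrp G (image_vert v)" using G.group_vgrp image_vert_closed v by blast
  have "transport v v [Elt v (g \<otimes>\<^bsub>vgrp L v\<^esub> h)] = transport v v ([Elt v g] @ [Elt v h])"
    using v g h by (intro transport_cong) (simp_all add: L.elt_val_mult)
  also have "\<dots> = transport v v [Elt v g] + transport v v [Elt v h]"
    using v g h by (intro transport_append) simp_all
  finally have "elt_val G (image_vert v) (vert_hom v (g \<otimes>\<^bsub>vgrp L v\<^esub> h)) =
    elt_val G (image_vert v) (vert_hom v g \<otimes>\<^bsub>vgrp G (image_vert v)\<^esub> vert_hom v h)"
    using v g h vert_hom image_vert_closed by (simp add: G.elt_val_mult)
  then show ?thesis
    using v g h vert_hom image_vert_closed by (intro G.elt_val_inj[of "image_vert v"]) simp_all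
qed

text \<open>The element of the vertex group that the condition on \<delta> forces the image of
  \<open>h\<close> to have; it remains to find it in the edge group.\<close>

definition edge_conj :: "'e \<Rightarrow> 'g \<Rightarrow> 'k" where
  "edge_conj e h = inv\<^bsub>vgrp G (image_vert (head (gr L) e))\<^esub> edge_twist e
     \<otimes>\<^bsub>vgrp G (image_vert (head (gr L) e))\<^esub> vert_hom (head (gr L) e) (inc L e h)
     \<otimes>\<^bsub>vgrp G (image_vert (head (gr L) e))\<^esub> edge_twist e"

definition edge_hom :: "'e \<Rightarrow> 'g \<Rightarrow> 'k" where
  "edge_hom e h = (SOME k. k \<in> carrier (cell_grp G (image_cell e)) \<and>
     cell_inc G (image_cell e) k = edge_conj e h)"

lemma edge_conj:
  assumes e: "e \<in> arcs (gr L)" and h: "h \<in> carrier (egrp L e)"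
  shows "edge_conj e h \<in> carrier (vgrp G (image_vert (head (gr L) e)))" (is ?A)
    and "elt_val G (image_vert (head (gr L) e)) (edge_conj e h) =
      - elt_val G (image_vert (head (gr L) e)) (edge_twist e) +
      transport (head (gr L) e) (head (gr L) e) [Elt (head (gr L) e) (inc L e h)] +
      elt_val G (image_vert (head (gr L) e)) (edge_twist e)" (is ?B)
proof -
  have w: "head (gr L) e \<in> verts (gr L)" using e by simp
  interpret W: group "vgrp G (image_vert (head (gr L) e))" using G.group_vgrp image_vert_closed w by blast
  have closed: "edge_twist e \<in> carrier (vgrp G (image_vert (head (gr L) e)))"
    "vert_hom (head (gr L) e) (inc L e h) \<in> carrier (vgrp G (image_vert (head (gr L) e)))"
    using edge_twist(1)[OF e] vert_hom(1)[OF w] L.inc_closed[OF e h] by simp_all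
  then show ?A
    by (simp add: edge_conj_def)
  show ?B
    using closed image_vert_closed[OF w] vert_hom(2)[OF w L.inc_closed[OF e h]]
    by (simp add: edge_conj_def G.elt_val_mult G.elt_val_inv)
qed

lemma transport_slide:
  assumes e: "e \<in> arcs (gr L)" and h: "h \<in> carrier (egrp L e)"
  shows "transport (tail (gr L) e) (head (gr L) e) [Seg e 0 1] +
      transport (head (gr L) e) (head (gr L) e) [Elt (head (gr L) e) (inc L e h)] =
    transport (tail (gr L) e) (tail (gr L) e) [Elt (tail (gr L) e) (inc L (erev L e) h)] +
      transport (tail (gr L) e) (head (gr L) e) [Seg e 0 1]"
proof -
  let ?t = "tail (gr L) e" and ?h = "head (gr L) e"
  have "transport ?t ?h ([Seg e 0 1] @ [Elt ?h (inc L e h)]) =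
    transport ?t ?h ([Elt ?t (inc L (erev L e) h)] @ [Seg e 0 1])"
    using e L.inc_closed[OF e h] L.inc_erev_closed[OF e h] L.seg_val_slide[OF e h]
    by (intro transport_cong) (simp_all add: L.path_val_Seg)
  then show ?thesis
    using e L.inc_closed[OF e h] L.inc_erev_closed[OF e h]
    by (simp only: transport_append[OF edge_path[OF e], of "[Elt ?h (inc L e h)]" ?h]
        transport_append[OF _ edge_path[OF e], of ?t "[Elt ?t (inc L (erev L e) h)]"]
        gog_path.simps piece_ok.simps piece_start.simps piece_end.simps L.Vert_in_points L.head_in_verts
        L.tail_in_verts simp_thms)
qed

text \<open>\<Phi> is applied to the slide relation of \<open>e\<close>. With \<Phi>(e) in factored
  form, the twist at the tail cancels on the left and that at the head on the right.\<close>

lemma edge_conj_slide: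
  assumes e: "e \<in> arcs (gr L)" and h: "h \<in> carrier (egrp L e)"
  shows "cell_val (image_cell e) + elt_val G (image_vert (head (gr L) e)) (edge_conj e h) =
    elt_val G (image_vert (tail (gr L) e)) (edge_conj (erev L e) h) + cell_val (image_cell e)"
proof -
  let ?x = "elt_val G (image_vert (tail (gr L) e)) (edge_twist (erev L e))"
    and ?y = "elt_val G (image_vert (head (gr L) e)) (edge_twist e)"
  have h': "h \<in> carrier (egrp L (erev L e))"
    using e h by (simp add: L.egrp_rev)
  have "?x + (cell_val (image_cell e) + elt_val G (image_vert (head (gr L) e)) (edge_conj e h)) + - ?y =
    ?x + (elt_val G (image_vert (tail (gr L) e)) (edge_conj (erev L e) h) + cell_val (image_cell e)) + - ?y"
    using transport_slide[OF e h] edge_conj(2)[OF e h] edge_conj(2)[OF _ h'] e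
    by (simp add: edge_twist(2)[OF e] add.assoc)
  then show ?thesis
    by (simp only: add_left_cancel add_right_cancel)
qed

text \<open>The hypothesis of \<open>seg_val_commute\<close> is \<open>edge_conj_slide\<close>, and
  its conclusion gives one element for both ends; this is why the edge homomorphism ignores
  orientation. If the edge is collapsed, both conjugates have equal values and coincide.\<close>

lemma edge_hom_exists:
  assumes e: "e \<in> arcs (gr L)" and h: "h \<in> carrier (egrp L e)"
  shows "\<exists>k \<in> carrier (cell_grp G (image_cell e)).
    cell_inc G (image_cell e) k = edge_conj e h \<and> cell_inc G (image_cell (erev L e)) k = edge_conj (erev L e) h"
proof -
  have c: "edge_conj e h \<in> carrier (vgrp G (image_vert (head (gr L) e)))"
    "edge_conj (erev L e) h \<in> carrier (vgrp G (image_vert (tail (gr L) e)))"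
    using edge_conj(1)[OF e h] edge_conj(1)[of "erev L e" h] e h by (simp_all add: L.egrp_rev)
  show ?thesis
  proof (cases "image_cell e")
    case (Inl v)
    note v = image_cell_Inl[OF e Inl]
    have "elt_val G v (edge_conj e h) = elt_val G v (edge_conj (erev L e) h)"
      using edge_conj_slide[OF e h] Inl v(1,2)[symmetric] by (simp add: cell_val_def)
    then have "edge_conj e h = edge_conj (erev L e) h"
      using c image_vert_closed[of "head (gr L) e"] e v(1,2) by (intro G.elt_val_inj[of v]) simp_all
    with c v Inl show ?thesis
      by (simp add: cell_grp_def cell_inc_def)
  next
    case (Inr d)
    note d = image_cell_Inr[OF e Inr]
    have "elt_val G (tail (gr G) d) (edge_conj (erev L e) h) + seg_val G d 1 =
      seg_val G d 1 + elt_val G (head (gr G) d) (edge_conj e h)"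
      using edge_conj_slide[OF e h] Inr d(2,3) by (simp add: cell_val_def)
    then obtain k where "k \<in> carrier (egrp G d)" "edge_conj (erev L e) h = inc G (erev G d) k" "edge_conj e h = inc G d k"
      using G.seg_val_commute[OF d(1), of "edge_conj (erev L e) h" "edge_conj e h"] c d(2,3) by auto
    with d Inr show ?thesis
      by (auto simp: cell_grp_def cell_inc_def)
  qed
qed

lemma cell_inc_inj: "e \<in> arcs (gr L) \<Longrightarrow> inj_on (cell_inc G (image_cell e)) (carrier (cell_grp G (image_cell e)))"
  using image_cell_Inr(1)[of e] G.inc_inj
  by (cases "image_cell e") (auto simp: cell_inc_def cell_grp_def inj_on_def)

lemma edge_hom:
  assumes e: "e \<in> arcs (gr L)" and h: "h \<in> carrier (egrp L e)"
  shows "edge_hom e h \<in> carrier (cell_grp G (image_cell e))" (is ?A) "cell_inc G (image_cell e) (edge_hom e h) = edge_conj e h" (is ?B)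
proof -
  have "\<exists>k. k \<in> carrier (cell_grp G (image_cell e)) \<and> cell_inc G (image_cell e) k = edge_conj e h"
    using edge_hom_exists[OF assms] by blast
  from someI_ex[OF this] show ?A ?B
    by (auto simp: edge_hom_def)
qed

lemma edge_hom_erev:
  assumes e: "e \<in> arcs (gr L)" and h: "h \<in> carrier (egrp L e)"
  shows "edge_hom (erev L e) h = edge_hom e h"
proof -
  obtain k where k: "k \<in> carrier (cell_grp G (image_cell e))" "cell_inc G (image_cell e) k = edge_conj e h"
    "cell_inc G (image_cell (erev L e)) k = edge_conj (erev L e) h"
    using edge_hom_exists[OF assms] by blast
  have grp: "cell_grp G (image_cell (erev L e)) = cell_grp G (image_cell e)"
    using image_cell_Inl(3)[OF e] image_cell_Inr(1,4)[OF e] G.egrp_rev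
    by (cases "image_cell e") (auto simp: cell_grp_def)
  have e': "erev L e \<in> arcs (gr L)" "h \<in> carrier (egrp L (erev L e))"
    using e h by (simp_all add: L.egrp_rev)
  have "edge_hom e h = k"
    by (rule inj_onD[OF cell_inc_inj[OF e]]) (use edge_hom[OF e h] k in simp_all)
  moreover have "edge_hom (erev L e) h = k"
    by (rule inj_onD[OF cell_inc_inj[OF e'(1)]]) (use edge_hom[OF e'] k in \<open>simp_all add: grp\<close>)
  ultimately show ?thesis by simp
qed

lemma edge_hom_hom:
  assumes e: "e \<in> arcs (gr L)"
  shows "edge_hom e \<in> hom (egrp L e) (cell_grp G (image_cell e))"
proof (rule homI)
  fix h h' assume h: "h \<in> carrier (egrp L e)" "h' \<in> carrier (egrp L e)"
  let ?w = "head (gr L) e" and ?c = "image_cell e"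
  have w: "?w \<in> verts (gr L)" using e by simp
  interpret E: group "egrp L e" using e L.group_egrp by blast
  interpret W: group "vgrp G (image_vert ?w)" using G.group_vgrp image_vert_closed w by blast
  have hh: "h \<otimes>\<^bsub>egrp L e\<^esub> h' \<in> carrier (egrp L e)" using h by simp
  have closed: "edge_twist e \<in> carrier (vgrp G (image_vert ?w))"
    "vert_hom ?w (inc L e h) \<in> carrier (vgrp G (image_vert ?w))"
    "vert_hom ?w (inc L e h') \<in> carrier (vgrp G (image_vert ?w))"
    using edge_twist(1)[OF e] vert_hom(1)[OF w] L.inc_closed[OF e] h by simp_all
  have cancel: "edge_twist e \<otimes>\<^bsub>vgrp G (image_vert ?w)\<^esub>
      (inv\<^bsub>vgrp G (image_vert ?w)\<^esub> edge_twist e \<otimes>\<^bsub>vgrp G (image_vert ?w)\<^esub> x) = x"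
    if "x \<in> carrier (vgrp G (image_vert ?w))" for x
    using that closed(1) by (simp add: W.m_assoc[symmetric])
  have "inc L e (h \<otimes>\<^bsub>egrp L e\<^esub> h') = inc L e h \<otimes>\<^bsub>vgrp L ?w\<^esub> inc L e h'"
    using L.inc_in_hom[OF e] h by (simp add: hom_def)
  then have conj: "edge_conj e (h \<otimes>\<^bsub>egrp L e\<^esub> h') = edge_conj e h \<otimes>\<^bsub>vgrp G (image_vert ?w)\<^esub> edge_conj e h'"
    using closed vert_hom_mult[OF w L.inc_closed[OF e h(1)] L.inc_closed[OF e h(2)]]
    by (simp add: edge_conj_def W.m_assoc cancel)
  have inc_mult: "monoid.mult (cell_grp G ?c) k k' \<in> carrier (cell_grp G ?c) \<and> cell_inc G ?c (k \<otimes>\<^bsub>cell_grp G ?c\<^esub> k') =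
      cell_inc G ?c k \<otimes>\<^bsub>vgrp G (image_vert ?w)\<^esub> cell_inc G ?c k'"
    if "k \<in> carrier (cell_grp G ?c)" "k' \<in> carrier (cell_grp G ?c)" for k k'
  proof (cases ?c)
    case (Inl v)
    with that image_cell_Inl(2)[OF e Inl] show ?thesis
      by (simp add: cell_grp_def cell_inc_def)
  next
    case (Inr d)
    note d = image_cell_Inr[OF e Inr]
    interpret D: group "egrp G d" using G.group_egrp d(1) by blast
    show ?thesis
      using that Inr d(3) G.inc_in_hom[OF d(1)] by (simp add: cell_grp_def cell_inc_def hom_def)
  qed
  show "edge_hom e (h \<otimes>\<^bsub>egrp L e\<^esub> h') = edge_hom e h \<otimes>\<^bsub>cell_grp G ?c\<^esub> edge_hom e h'"
    \<comment> \<open>The equation is checked after the injective map into the vertex group, where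
      it is multiplicativity of \<open>edge_conj\<close>.\<close>
    by (rule inj_onD[OF cell_inc_inj[OF e]])
      (use edge_hom[OF e hh] edge_hom[OF e h(1)] edge_hom[OF e h(2)] conj
        inc_mult[OF edge_hom(1)[OF e h(1)] edge_hom(1)[OF e h(2)]] in simp_all)
qed (rule edge_hom(1)[OF e])

section \<open>The morphism and its action on paths\<close>

definition induced_map :: "('v, 'e, 'g, 'w, 'd, 'k) gog_map" where
  "induced_map = \<lparr>vmap = image_vert, emap = image_cell, vhom = vert_hom, ehom = edge_hom, twist = edge_twist\<rparr>"

lemma induced_map_simps [simp]:
  "vmap induced_map = image_vert" "emap induced_map = image_cell" "vhom induced_map = vert_hom"
  "ehom induced_map = edge_hom" "twist induced_map = edge_twist"
  by (simp_all add: induced_map_def)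

lemma vert_hom_inc:
  assumes e: "e \<in> arcs (gr L)" and h: "h \<in> carrier (egrp L e)"
  shows "vert_hom (head (gr L) e) (inc L e h) = edge_twist e
    \<otimes>\<^bsub>vgrp G (image_vert (head (gr L) e))\<^esub> edge_conj e h
    \<otimes>\<^bsub>vgrp G (image_vert (head (gr L) e))\<^esub> inv\<^bsub>vgrp G (image_vert (head (gr L) e))\<^esub> edge_twist e"
proof -
  have w: "head (gr L) e \<in> verts (gr L)" using e by simp
  interpret W: group "vgrp G (image_vert (head (gr L) e))" using G.group_vgrp image_vert_closed w by blast
  have closed: "edge_twist e \<in> carrier (vgrp G (image_vert (head (gr L) e)))"
    "vert_hom (head (gr L) e) (inc L e h) \<in> carrier (vgrp G (image_vert (head (gr L) e)))"
    using edge_twist(1)[OF e] vert_hom(1)[OF w] L.inc_closed[OF e h] by simp_all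
  show ?thesis
    using closed by (simp add: edge_conj_def W.m_assoc[symmetric]) (simp add: W.m_assoc)
qed

lemma gog_morphism_induced_map: "gog_morphism L G induced_map"
proof -
  have "graph_morphism L G induced_map"
    using image_vert_closed image_cell_Inl(1-3) image_cell_Inr(1-4)
    by (auto simp: graph_morphism_def split: sum.split)
  moreover have "vert_hom v \<in> hom (vgrp L v) (vgrp G (image_vert v))" if "v \<in> verts (gr L)" for v
    using that vert_hom(1) vert_hom_mult by (intro homI) simp_all
  ultimately show ?thesis
    using edge_hom_hom edge_hom_erev edge_twist(1) edge_hom(2) vert_hom_inc
    by (simp add: gog_morphism_def Let_def)
qed

sublocale f: gog_hom L G induced_map
  using gog_morphism_induced_map by unfold_locales

abbreviation "image_path \<equiv> gog_map_path L G induced_map"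

lemma edge_image_val_induced:
  "e \<in> arcs (gr L) \<Longrightarrow> edge_image_val L G induced_map e 1 = transport (tail (gr L) e) (head (gr L) e) [Seg e 0 1]"
  by (simp add: edge_image_val_def edge_twist(2) cell_val_def)

text \<open>Both sides are multiplicative. They agree on group elements by the choice of
  \<open>vert_hom\<close> and on whole edges by the choice of the twists.\<close>

lemma path_val_image_whole:
  assumes "gog_path L (Vert v) w (Vert v')" "\<forall>e a b. Seg e a b \<in> set w \<longrightarrow> a = 0 \<and> b = 1"
  shows "path_val G (image_path w) = transport v v' w"
  using assms
proof (induction w arbitrary: v)
  case Nil
  then show ?case by (auto simp: transport_Nil)
next
  case (Cons s w)
  show ?case
  proof (cases s)
    case (Elt x g)
    with Cons.prems have x: "x = v" "v \<in> verts (gr L)" "g \<in> carrier (vgrp L v)" "gog_path L (Vert v) w (Vert v')"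
      by auto
    then have "transport v v' ([Elt v g] @ w) = transport v v [Elt v g] + transport v v' w"
      by (intro transport_append) simp_all
    with Cons Elt x vert_hom(2)[of v g] show ?thesis by simp
  next
    case (Seg e a b)
    with Cons.prems have "a = 0" "b = 1" by auto
    with Seg Cons.prems(1) have e: "a = 0" "b = 1" "e \<in> arcs (gr L)" "v = tail (gr L) e"
      "gog_path L (Vert (head (gr L) e)) w (Vert v')"
      by auto
    then have "transport v v' ([Seg e 0 1] @ w) =
      transport v (head (gr L) e) [Seg e 0 1] + transport (head (gr L) e) v' w"
      by (intro transport_append) simp_all
    moreover have "path_val G (image_path w) = transport (head (gr L) e) v' w"
      using Cons.prems(2) by (intro Cons.IH[OF e(5)]) auto
    moreover have "path_val G (gog_map_piece L G induced_map (Seg e 0 1)) = transport v (head (gr L) e) [Seg e 0 1]"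
      using f.path_val_gog_map_Seg[of e 0 1] edge_image_val_induced[of e] e(3,4)
      by (simp del: gog_map_piece.simps)
    ultimately show ?thesis
      by (simp del: gog_map_piece.simps add: Seg e(1,2))
  qed
qed

lemma point_map_base: "point_map induced_map p = q"
  and path_val_image_base: "path_val G (image_path base_path) = path_val G base_image"
proof -
  obtain z where z: "base_image_ok base_image z" using base_image by blast
  have "point_map induced_map p = q \<and> path_val G (image_path base_path) = path_val G base_image"
    using L.base_point
  proof (cases rule: L.points_cases)
    case (1 v)
    then have base: "base_path = []" "base_vert = v"
      unfolding base_path_def base_vert_def by simp_all
    have "base_image = []"
      using z 1 unfolding base_image_ok_def by blast
    then have "lies_over [] (Vert v) [] (Vert (image_vert v))"
      using image_conn[OF base_vert(1)] base base_vert by simp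
    moreover have "lies_over [] (Vert v) [] q"
      using lies_over_Nil unfolding 1(2)[symmetric] .
    ultimately have "q = Vert (image_vert v)"
      using lies_over_unique(1) by blast
    moreover have "point_map induced_map p = Vert (image_vert v)"
      using f.point_map_Vert[of v] unfolding 1(2)[symmetric] by simp
    ultimately have "point_map induced_map p = q"
      by (rule trans[OF _ sym, rotated])
    then show ?thesis
      by (simp add: \<open>base_image = []\<close> base(1))
  next
    case (2 e a)
    have base: "base_path = [Seg e a 1]"
      unfolding base_path_def using 2 by (simp add: L.to_vertex_Mid)
    have img: "base_image = (case emap ft (lift_edge L p [] e a) of Inl x \<Rightarrow> [] | Inr d \<Rightarrow> [Seg (fst d) a 1])"
      using z 2 unfolding base_image_ok_def by blast
    have d: "lift_edge L p [] e a \<in> bs_arcs L p"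
      using 2 L.base_point by (intro L.lift_edge_in_arcs) auto
    \<comment> \<open>The base point clause of \<open>edge_factor\<close>: the image of
      \<open>base_path\<close> acquires no factor at its end.\<close>
    have tw: "edge_twist e = \<one>\<^bsub>vgrp G (image_vert (head (gr L) e))\<^esub>"
      using edge_factor_twist[OF 2(1,2)] 2(3-5) unfolding edge_factor_def by blast
    have val: "path_val G (image_path base_path) = - edge_image_val L G induced_map e a + edge_image_val L G induced_map e 1"
      using f.path_val_gog_map_Seg[of e a 1] 2(1,3,4) base by (simp del: gog_map_piece.simps)
    have pm: "point_map induced_map p = (case image_cell e of Inl v \<Rightarrow> Vert v | Inr d \<Rightarrow> edge_point G d a)"
      using f.point_map_edge_point[OF 2(1), of a] unfolding 2(5)[symmetric] by simp
    have head: "image_vert (head (gr L) e) \<in> verts (gr G)"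
      using image_vert_closed 2(1) by simp
    from 2(1,3,4,5) show ?thesis
    proof (cases rule: base_edge_cases)
      case (collapsed x)
      have c: "image_cell e = Inl (fst x)"
        using image_cell_lift[OF d] collapsed(1) by simp
      have "point_map induced_map p = q"
        by (simp only: pm c sum.case collapsed(2)[symmetric])
      moreover have "path_val G (image_path base_path) = path_val G base_image"
        using c collapsed(1) img val 2(3,4) tw head by (simp add: edge_image_val_def)
      ultimately show ?thesis by blast
    next
      case (edge d)
      have c: "image_cell e = Inr d"
        using image_cell_lift[OF \<open>lift_edge L p [] e a \<in> bs_arcs L p\<close>] edge(1) by simp
      have "point_map induced_map p = q"
        by (simp only: pm c sum.case edge(3)[symmetric])
      moreover have "path_val G (image_path base_path) = path_val G base_image"
        using c edge(1,2) img val 2(3,4) tw head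
        by (simp add: edge_image_val_def G.path_val_Seg group_add_calc)
      ultimately show ?thesis by blast
    qed
  qed
  then show "point_map induced_map p = q" "path_val G (image_path base_path) = path_val G base_image"
    by blast+
qed

lemma image_path_path: "gog_path L p u y \<Longrightarrow> gog_path G q (image_path u) (point_map induced_map y)"
  using f.gog_map_path_path[of p u y] by (simp add: point_map_base)

text \<open>The path is retracted to \<open>base_path\<close> followed by whole edges, on which f
  acts as \<Phi>. The image of \<open>base_path\<close> is \<open>base_image\<close>, which cancels
  the inverse of \<beta> with which \<Phi> begins.\<close>

lemma path_val_image_path:
  assumes u: "gog_path L p u (Vert v)"
  shows "path_val G (image_path u) = loop_val (u @ reverse_path L (conn v)) + path_val G (image_conn v)"
proof -
  have v: "v \<in> verts (gr L)" using L.path_vert[OF u] .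
  let ?r = "retract_path L u"
  have r: "gog_path L (Vert base_vert) ?r (Vert v)"
    "path_val L u = path_val L (base_path @ ?r)"
    using L.retract_path[OF u] by (simp_all add: base_vert_def base_path_def)
  have br: "gog_path L p (base_path @ ?r) (Vert v)"
    using base_path r by (auto simp: L.gog_path_append)
  then have "homotopic L p (Vert v) u (base_path @ ?r)"
    using L.homotopic_iff_path_val[OF u br] r(2) by simp
  then have "path_val G (image_path u) = path_val G (image_path base_path) + path_val G (image_path ?r)"
    using f.path_val_gog_map_homotopic by fastforce
  also have "\<dots> = path_val G base_image + transport base_vert v ?r"
    using path_val_image_whole[OF r(1)] L.retract_path_whole[of _ _ _ u] by (simp add: path_val_image_base)
  also have "\<dots> = loop_val (base_path @ ?r @ reverse_path L (conn v)) + path_val G (image_conn v)"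
    by (simp add: transport_def base_vert add.assoc)
  also have "loop_val (base_path @ ?r @ reverse_path L (conn v)) = loop_val (u @ reverse_path L (conn v))"
    using u br r(2) L.gog_path_rev[OF conn[OF v]]
    by (intro loop_val_cong) (auto simp: L.gog_path_append add.assoc)
  finally show ?thesis .
qed

text \<open>The loop is extended by \<open>base_path\<close> to end at a vertex. Then
  \<open>base_image\<close> appears on both sides and cancels, so no conjugation remains.\<close>

lemma path_val_image_loop:
  assumes u: "gog_path L p u p"
  shows "path_val G (image_path u) = loop_val u"
proof -
  have ub: "gog_path L p (u @ base_path) (Vert base_vert)"
    using u base_path by (auto simp: L.gog_path_append)
  have "path_val G (image_path u) + path_val G base_image =
    loop_val ((u @ base_path) @ reverse_path L base_path) + path_val G base_image"
    using path_val_image_path[OF ub] by (simp add: path_val_image_base base_vert)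
  moreover have "loop_val ((u @ base_path) @ reverse_path L base_path) = loop_val u"
    using u ub L.gog_path_rev[OF base_path] L.path_val_rev[OF base_path]
    by (intro loop_val_cong) (auto simp: L.gog_path_append add.assoc)
  ultimately show ?thesis by simp
qed

lemma induces_hom_induced_map: "induces_hom L p G q induced_map \<phi>"
  unfolding induces_hom_def
proof (intro allI impI)
  fix u assume u: "gog_path L p u p"
  have path: "gog_path G q (image_path u) q"
    using image_path_path[OF u] by (simp add: point_map_base)
  have "homotopic G q q (loop_image u) (image_path u)"
    using G.homotopic_iff_path_val[OF loop_image(1)[OF u] path] path_val_image_loop[OF u]
    by (simp add: loop_val_def)
  then show "\<phi> (hclass L p p u) = hclass G q q (image_path u)"
    using loop_image[OF u] G.hclass_eq_iff by simp
qed

section \<open>Lifts of image paths\<close>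

lemma lies_over_image_Vert:
  assumes u: "gog_path L p u (Vert v)"
  shows "lies_over u (Vert v) (image_path u) (Vert (image_vert v))"
proof -
  have v: "v \<in> verts (gr L)" using L.path_vert[OF u] .
  let ?h = "u @ reverse_path L (conn v)"
  have h: "gog_path L p ?h p"
    using u L.gog_path_rev[OF conn[OF v]] by (auto simp: L.gog_path_append)
  have "path_val L u = path_val L (?h @ conn v)"
    by (simp add: L.path_val_rev[OF conn[OF v]] add.assoc)
  moreover have "path_val G (image_path u) = path_val G (loop_image ?h @ image_conn v)"
    by (simp add: path_val_image_path[OF u] loop_val_def)
  moreover have "gog_path G q (image_path u) (Vert (image_vert v))"
    using image_path_path[OF u] by simp
  ultimately show ?thesis
    using lies_over_cong[OF lies_over_equivariant[OF image_conn[OF v] h] u] by blast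
qed

text \<open>Inside an edge, \<open>u\<close> is continued to the ends of the edge, where the vertex
  case applies; the twists that f adds there are absorbed by the cosets. A collapsed edge needs only
  the tail. Otherwise both ends and the edge below them determine the edge of the tree.\<close>

lemma lies_over_image:
  assumes u: "gog_path L p u y"
  shows "lies_over u y (image_path u) (point_map induced_map y)"
proof -
  have "y \<in> points L" using u L.gog_path_points by blast
  then show ?thesis
  proof (cases rule: L.points_cases)
    case (1 v)
    with lies_over_image_Vert[of u v] u show ?thesis by simp
  next
    case (2 e a)
    let ?d = "lift_edge L p u e a" and ?t = "tail (gr L) e" and ?h = "head (gr L) e"
    let ?s = "u @ [Seg (erev L e) (1 - a) 1]" and ?s' = "u @ [Seg e a 1]"
    have ue: "gog_path L p u (edge_point L e a)" using u 2(5) by simp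
    have d: "?d \<in> bs_arcs L p"
      using 2(1,3,4) ue by (intro L.lift_edge_in_arcs) auto
    have d_ends: "fst (snd ?d) = (?t, coset L p ?t ?s)" "snd (snd ?d) = (?h, coset L p ?h ?s')"
      using 2(3,4) by (simp_all add: lift_edge_def Let_def)
    have s: "gog_path L p ?s (Vert ?t)" "gog_path L p ?s' (Vert ?h)"
      using ue 2(1,3,4) by (auto simp: L.gog_path_append L.edge_point_erev)
    have tl: "vmap ft (fst (snd ?d)) = (image_vert ?t, coset G q (image_vert ?t) (image_path ?s))"
      and hd: "vmap ft (snd (snd ?d)) = (image_vert ?h, coset G q (image_vert ?h) (image_path ?s'))"
      using lies_over_image_Vert[OF s(1)] lies_over_image_Vert[OF s(2)]
      unfolding d_ends lies_over_Vert_iff by blast+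
    have tw: "inv\<^bsub>vgrp G (image_vert ?t)\<^esub> edge_twist (erev L e) \<in> carrier (vgrp G (image_vert ?t))"
      "inv\<^bsub>vgrp G (image_vert ?h)\<^esub> edge_twist e \<in> carrier (vgrp G (image_vert ?h))"
      using edge_twist(1)[of e] edge_twist(1)[of "erev L e"] 2(1) image_vert_closed G.group_vgrp group.inv_closed
      by auto
    have y: "point_map ft (lift_point L p u y) =
        (case emap ft ?d of Inl x \<Rightarrow> Vert x | Inr d \<Rightarrow> edge_point (bs_tree G q) d a)"
      using 2(1,3,4,5) ue d by (simp add: L.lift_point_edge_point ft.point_map_edge_point)
    have fy: "point_map induced_map y = (case image_cell e of Inl v \<Rightarrow> Vert v | Inr d \<Rightarrow> edge_point G d a)"
      using 2(1,5) by (simp add: f.point_map_edge_point)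
    have U: "gog_path G q (image_path u) (point_map induced_map y)"
      using image_path_path[OF u] .
    have cell: "map_sum fst fst (emap ft ?d) = image_cell e"
      using image_cell_lift[OF d] by simp
    show ?thesis
    proof (cases "emap ft ?d")
      case (Inl x)
      then have c: "image_cell e = Inl (fst x)" using cell by simp
      note v = image_cell_Inl(1-3)[OF 2(1) c]
      have "image_path ?s = image_path u @ [Elt (image_vert ?t) (inv\<^bsub>vgrp G (image_vert ?t)\<^esub> edge_twist (erev L e))]"
        using 2(1,3,4) v by (simp add: Let_def)
      moreover have "gog_path G q (image_path u) (Vert (image_vert ?t))"
        using U fy c v(1) by simp
      ultimately have "coset G q (image_vert ?t) (image_path ?s) = coset G q (image_vert ?t) (image_path u)"
        using G.coset_Elt tw(1) by simp
      moreover have "vmap ft (fst (snd ?d)) = x"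
        using ft.emap_Inl[of ?d x] d Inl by simp
      ultimately have "x = (image_vert ?t, coset G q (image_vert ?t) (image_path u))"
        using tl by simp
      then show ?thesis
        using y Inl fy c u U by (simp add: lies_over_def)
    next
      case (Inr d')
      define c where "c = fst d'"
      have cell_e: "image_cell e = Inr c" using cell Inr by (simp add: c_def)
      note v = image_cell_Inr(1-4)[OF 2(1) cell_e]
      have Uc: "gog_path G q (image_path u) (edge_point G c a)"
        using U fy cell_e by simp
      have "image_path ?s = (image_path u @ [Seg (erev G c) (1 - a) 1]) @
          [Elt (image_vert ?t) (inv\<^bsub>vgrp G (image_vert ?t)\<^esub> edge_twist (erev L e))]"
        using 2(1,3,4) v by (simp add: Let_def)
      moreover have "gog_path G q (image_path u @ [Seg (erev G c) (1 - a) 1]) (Vert (image_vert ?t))"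
        using Uc v 2(1,3,4) image_vert_closed[of ?t] by (auto simp: G.gog_path_append G.edge_point_erev)
      ultimately have t: "coset G q (image_vert ?t) (image_path ?s) =
          coset G q (image_vert ?t) (image_path u @ [Seg (erev G c) (1 - a) 1])"
        by (simp only: G.coset_Elt[OF _ tw(1)])
      have "image_path ?s' = (image_path u @ [Seg c a 1]) @
          [Elt (image_vert ?h) (inv\<^bsub>vgrp G (image_vert ?h)\<^esub> edge_twist e)]"
        using 2(1,3,4) cell_e by (simp add: Let_def)
      moreover have "gog_path G q (image_path u @ [Seg c a 1]) (Vert (image_vert ?h))"
        using Uc v 2(1,3,4) image_vert_closed[of ?h] by (auto simp: G.gog_path_append)
      ultimately have h: "coset G q (image_vert ?h) (image_path ?s') =
          coset G q (image_vert ?h) (image_path u @ [Seg c a 1])"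
        by (simp only: G.coset_Elt[OF _ tw(2)])
      have "fst (snd d') = vmap ft (fst (snd ?d))" "snd (snd d') = vmap ft (snd (snd ?d))"
        using ft.emap_Inr[of ?d d'] d Inr by simp_all
      then have "d' = lift_edge G q (image_path u) c a"
        using tl hd t h v 2(3,4) by (simp add: lift_edge_def Let_def c_def prod_eq_iff)
      then show ?thesis
        using y Inr fy cell_e u U Uc v(1) 2(3,4) by (simp add: lies_over_def G.lift_point_edge_point)
    qed
  qed
qed

section \<open>The square and uniqueness of the tree morphism\<close>

lemma tight_image:
  assumes w: "tight_tree_path (bs_tree L p) (base_lift L p) w x"
    and gt: "pointed_tree_morphism L p G q gt"
  shows "gog_path G q (gog_map_path (bs_tree G q) G \<pi>G (graph_map_path gt w)) (point_map \<pi>G (point_map gt x))" (is ?A)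
    and "lift_point G q (gog_map_path (bs_tree G q) G \<pi>G (graph_map_path gt w)) (point_map \<pi>G (point_map gt x)) =
      point_map gt x" (is ?B)
proof -
  have gt': "graph_hom (bs_tree L p) (bs_tree G q) gt" "point_map gt (base_lift L p) = base_lift G q"
    using gt L.tree.groups_on_graph_axioms G.tree.groups_on_graph_axioms
    by (auto simp: pointed_tree_morphism_def graph_hom_def graph_hom_axioms_def)
  have "gog_path (bs_tree G q) (base_lift G q) (graph_map_path gt w) (point_map gt x)"
    using graph_map_path_path[OF gt'(1), of "base_lift L p" w x] w gt'(2)
    by (simp add: tight_tree_path_def)
  from G.lift_point_proj[OF this]
  show ?A ?B .
qed

lemma tight_source:
  assumes w: "tight_tree_path (bs_tree L p) (base_lift L p) w x"
  shows "lies_over (gog_map_path (bs_tree L p) L \<pi>L w) (point_map \<pi>L x)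
      (image_path (gog_map_path (bs_tree L p) L \<pi>L w)) (point_map induced_map (point_map \<pi>L x))" (is ?A)
    and "lift_point G q (image_path (gog_map_path (bs_tree L p) L \<pi>L w)) (point_map induced_map (point_map \<pi>L x)) =
      point_map ft x" (is ?B)
proof -
  have "gog_path (bs_tree L p) (base_lift L p) w x"
    using w by (simp add: tight_tree_path_def)
  note u = L.lift_point_proj[OF this]
  show over: ?A
    using lies_over_image[OF u(1)] .
  then show ?B
    using u(2) by (simp add: lies_over_def)
qed

lemma pointed_tree_morphism_ft: "pointed_tree_morphism L p G q ft"
  using pointed ft.morphism by (simp add: pointed_tree_morphism_def)

text \<open>Both paths around the square lift to \<open>point_map ft x\<close>, one by
  \<open>lift_point_proj\<close> and the other by \<open>lies_over_image\<close>;
  \<open>lift_point_eq_iff\<close> supplies the loop at the end.\<close>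

lemma square_commutes_induced_map: "square_commutes L p G q \<pi>L \<pi>G induced_map ft"
  unfolding square_commutes_def Let_def
proof (intro allI impI)
  fix w x assume w: "tight_tree_path (bs_tree L p) (base_lift L p) w x"
  let ?V = "image_path (gog_map_path (bs_tree L p) L \<pi>L w)"
    and ?U = "gog_map_path (bs_tree G q) G \<pi>G (graph_map_path ft w)"
    and ?y = "point_map induced_map (point_map \<pi>L x)"
  note U = tight_image[OF w pointed_tree_morphism_ft]
  note V = tight_source[OF w]
  have Vp: "gog_path G q ?V ?y" using V(1) by (simp add: lies_over_def)
  have "point_map \<pi>G (point_map ft x) = ?y"
    using G.point_map_lift_point[OF Vp] V(2) by simp
  with U have "gog_path G q ?U ?y" "lift_point G q ?U ?y = point_map ft x" by simp_all
  then show "\<exists>c \<in> point_group_loops G ?y. homotopic G q ?y ?U (?V @ c)"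
    using G.lift_point_eq_iff[OF Vp, of ?U] V(2) by simp
qed

text \<open>The same equivalence read backwards: the loop forces both lifts to end at one point,
  which is the image of \<open>x\<close> under \<open>gt\<close> and under \<open>ft\<close>. Every
  point is reached by a tight path.\<close>

lemma square_commutes_unique:
  assumes gt: "pointed_tree_morphism L p G q gt" and sq: "square_commutes L p G q \<pi>L \<pi>G induced_map gt"
    and x: "x \<in> points (bs_tree L p)"
  shows "point_map gt x = point_map ft x"
proof -
  obtain u y where "gog_path L p u y" "x = lift_point L p u y"
    using x by (rule L.points_bs_tree_cases)
  then obtain w where w: "tight_tree_path (bs_tree L p) (base_lift L p) w x"
    using L.base_lift_to_lift_point L.homotopic_tight by blast
  let ?V = "image_path (gog_map_path (bs_tree L p) L \<pi>L w)"
    and ?U = "gog_map_path (bs_tree G q) G \<pi>G (graph_map_path gt w)"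
    and ?y = "point_map induced_map (point_map \<pi>L x)"
  note U = tight_image[OF w gt]
  note V = tight_source[OF w]
  have Vp: "gog_path G q ?V ?y" using V(1) by (simp add: lies_over_def)
  obtain c where c: "c \<in> point_group_loops G ?y" "homotopic G q ?y ?U (?V @ c)"
    using sq w unfolding square_commutes_def Let_def by blast
  then have Up: "gog_path G q ?U ?y" by (simp add: homotopic_def)
  then have y: "point_map \<pi>G (point_map gt x) = ?y"
    using U(1) gog_path_end_unique by blast
  have "lift_point G q ?V ?y = lift_point G q ?U ?y"
    using G.lift_point_eq_iff[OF Vp Up] c by blast
  then show ?thesis
    using U(2) V(2) y by simp
qed

lemma induces_tree_morphism_induced_map: "induces_tree_morphism L p G q \<pi>L \<pi>G induced_map ft"
  unfolding induces_tree_morphism_def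
proof (intro conjI allI impI ballI)
  fix gt assume gt: "pointed_tree_morphism L p G q gt \<and> square_commutes L p G q \<pi>L \<pi>G induced_map gt"
  then interpret gt: graph_hom "bs_tree L p" "bs_tree G q" gt
    by unfold_locales (simp add: pointed_tree_morphism_def)
  {
    fix x assume "x \<in> verts (gr (bs_tree L p))"
    then show "vmap gt x = vmap ft x"
      using square_commutes_unique[of gt "Vert x"] gt by simp
  next
    fix d assume d: "d \<in> arcs (gr (bs_tree L p))"
    \<comment> \<open>Agreement on points determines the image of an oriented edge through its point
      at 1/3.\<close>
    have "point_map gt (edge_point (bs_tree L p) d (1 / 3)) = point_map ft (edge_point (bs_tree L p) d (1 / 3))"
      using square_commutes_unique[of gt "edge_point (bs_tree L p) d (1 / 3)"] gt d
        L.tree.edge_point_in_points[OF d] by simp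
    then have eq: "(case emap gt d of Inl v \<Rightarrow> Vert v | Inr d' \<Rightarrow> edge_point (bs_tree G q) d' (1 / 3)) =
      (case emap ft d of Inl v \<Rightarrow> Vert v | Inr d' \<Rightarrow> edge_point (bs_tree G q) d' (1 / 3))"
      by (simp add: gt.point_map_edge_point[OF d] ft.point_map_edge_point[OF d])
    show "emap gt d = emap ft d"
    proof (cases "emap gt d")
      case (Inl v)
      with eq show ?thesis
        by (auto simp: edge_point_Mid[of "1 / 3"] split: sum.splits)
    next
      case (Inr d')
      with eq obtain d'' where d'': "emap ft d = Inr d''"
        "edge_point (bs_tree G q) d' (1 / 3) = edge_point (bs_tree G q) d'' (1 / 3)"
        by (auto simp: edge_point_Mid[of "1 / 3"] split: sum.splits)
      then show ?thesis
        using Inr G.tree.edge_point_third_inj[of d' d''] gt.emap_Inr[OF d Inr] by simp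
    qed
  }
qed (fact pointed_tree_morphism_ft square_commutes_induced_map)+

end

theorem proposition1p10p3:
  fixes L :: "('v, 'e, 'g) graph_of_groups"
    and G :: "('w, 'd, 'k) graph_of_groups"
    and p :: "('v, 'e) point"
    and q :: "('w, 'd) point"
    and \<phi> :: "('v, 'e, 'g) piece list set \<Rightarrow> ('w, 'd, 'k) piece list set"
    and ft :: "(('v, 'e, 'g) tvert, ('v, 'e, 'g) tedge,
                ('w, 'd, 'k) tvert, ('w, 'd, 'k) tedge) graph_map"
    and \<pi>L :: "(('v, 'e, 'g) tvert, ('v, 'e, 'g) tedge, unit, 'v, 'e, 'g) gog_map"
    and \<pi>G :: "(('w, 'd, 'k) tvert, ('w, 'd, 'k) tedge, unit, 'w, 'd, 'k) gog_map"
  assumes "graph_of_groups L" and "graph_of_groups G"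
    and "p \<in> points L" and "q \<in> points G"
    and "covering_projection L p \<pi>L" and "covering_projection G q \<pi>G"
    and "\<phi> \<in> hom (pi1 L p) (pi1 G q)"
    and "pointed_tree_morphism L p G q ft"
    and "equivariant L p G q \<phi> ft"
  shows "\<exists>f :: ('v, 'e, 'g, 'w, 'd, 'k) gog_map.
           gog_morphism L G f \<and> point_map f p = q \<and>
           induces_hom L p G q f \<phi> \<and>
           induces_tree_morphism L p G q \<pi>L \<pi>G f ft \<and>
           square_commutes L p G q \<pi>L \<pi>G f ft"
proof -
  interpret L: graph_of_groups L by fact
  interpret G: graph_of_groups G by fact
  interpret L: covering L p \<pi>L
    using assms by unfold_locales
  interpret G: covering G q \<pi>G
    using assms by unfold_locales
  interpret ft: graph_hom "bs_tree L p" "bs_tree G q" ft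
    using assms by unfold_locales (simp add: pointed_tree_morphism_def)
  interpret equivariant_tree_morphism L p \<pi>L G q \<pi>G ft \<phi>
    using assms by unfold_locales (simp_all add: pointed_tree_morphism_def)
  show ?thesis
    using gog_morphism_induced_map point_map_base induces_hom_induced_map
      induces_tree_morphism_induced_map square_commutes_induced_map by blast
qed

end
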